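(* Let $d\ge1$ be an integer, $I\subseteq\mathbb{R}$ a bounded open interval, $1\le q<\infty$, and let $\Delta:\mathcal{A}_d(\mathbb{C})\to\mathbb{R}^N$ be an Almgren embedding. Let $f,f_n\in W^{1,q}(I,\mathcal{A}_d(\mathbb{C}))$, $n\ge1$. Then $\mathbf d^{1,q}_I(f,f_n)\to0$ as $n\to\infty$ if and only if $\|\Delta\circ f-\Delta\circ f_n\|_{W^{1,q}(I,\mathbb{R}^N)}\to0$ as $n\to\infty$.
   Context: $\mathcal{A}_d(\mathbb{C})$ is the set of unordered $d$-tuples $[z]=[z_1,\dots,z_d]$ of complex numbers, with the metric $\mathbf d([z],[w])=\min_{\sigma\in S_d}\frac1{\sqrt d}\big(\sum_{i=1}^d|z_i-w_{\sigma(i)}|^2\big)^{1/2}$. Almgren embedding: for a unit complex number $\theta$ let $\eta(z)=\mathrm{Re}(\theta z)$; the associated Almgren map $H:\mathcal{A}_d(\mathbb{C})\to\mathbb{R}^d$ sends $[z_1,\dots,z_d]$ to the array of the $d$ real numbers $\eta(z_1),\dots,\eta(z_d)$ arranged in increasing order. Let $\eta_1,\dots,\eta_h$, $\eta_l(z)=\mathrm{Re}(\theta_l z)$, $|\theta_l|=1$, be finitely many such forms for which there is $\alpha=\alpha(d)>0$ such that for any $z_1,\dots,z_{d^2}\in\mathbb{C}$ there is $l$ with $|\eta_l(z_k)|\ge\alpha|z_k|$ for all $k\in\{1,\dots,d^2\}$ (e.g. $h=2d^2+1$ and $\theta_l$ the $h$-th roots of unity). With $H_l$ the Almgren map associated to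 $\eta_l$, the map $\Delta=h^{-1/2}(H_1,\dots,H_h):\mathcal{A}_d(\mathbb{C})\to\mathbb{R}^N$, $N=dh$, is called an Almgren embedding (it is bi-Lipschitz onto its image). $W^{1,q}(I,\mathcal{A}_d(\mathbb{C}))$ is the set of $f:I\to\mathcal{A}_d(\mathbb{C})$ with $\Delta\circ f\in W^{1,q}(I,\mathbb{R}^N)$, functions agreeing a.e. being identified. Every $f\in W^{1,q}(I,\mathcal{A}_d(\mathbb{C}))$ (after modification on a null set, always assumed done) is continuous and has a parameterization $f=[f_1,\dots,f_d]$ with continuous $f_i\in W^{1,q}(I,\mathbb{C})$. Such $f$ is called differentiable at $x_0$ if there are $L_1,\dots,L_d\in\mathbb{C}$ with (i) $\mathbf d\big(f(x),[f_1(x_0)+L_1(x-x_0),\dots,f_d(x_0)+L_d(x-x_0)]\big)=o(|x-x_0|)$ and (ii) $L_i=L_j$ whenever $f_i(x_0)=f_j(x_0)$; one writes $Df_i(x_0):=L_i$. This holds at a.e. $x_0$, with $Df_i(x_0)=f_i'(x_0)$ a.e. For $f=[f_1,\dots,f_d]$, $g=[g_1,\dots,g_d]$ in $W^{1,q}(I,\mathcal{A}_d(\mathbb{C}))$, where $f_1,\dots,f_d,g_1,\dots,g_d\in W^{1,q}(I,\mathbb{C})$ are continuous, set $\mathbf s_0(f,g)(x)=\mathbf d(f(x),g(x))$. Given a total ordering of $S_d$, let $\tau(x)$ be the smallest $\tau\in S_d$ with $\frac1{\sqrt d}\big(\sum_i|f_i(x)-g_{\tau(i)}(x)|^2\big)^{1/2}=\mathbf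 d(f(x),g(x))$. At each $x$ where $f$ and $g$ are differentiable, set $\mathbf s_1(f,g)(x)=\max\frac1{\sqrt d}\big(\sum_i|Df_i(x)-Dg_{\tau(x)(i)}(x)|^2\big)^{1/2}$, the maximum being over all total orderings of $S_d$ (equivalently, over all permutations attaining the minimum defining $\mathbf d(f(x),g(x))$); this is independent of the parameterizations. Elsewhere (a null set) put $\mathbf s_1(f,g)=0$. Finally $\mathbf d^{1,q}_I(f,g):=\|\mathbf s_0(f,g)\|_{L^\infty(I)}+\|\mathbf s_1(f,g)\|_{L^q(I)}$. *)

theory Defs
  imports
    "HOL-Analysis.Analysis"
    "HOL-Probability.Essential_Supremum"
    "HOL-Combinatorics.Permutations"
    "HOL-Library.Multiset"
    "HOL-Library.Landau_Symbols"
begin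

section \<open>Unordered tuples of complex numbers\<close>

text \<open>
  An unordered \<open>d\<close>-tuple is a multiset of size \<open>d\<close>. Ordered \<open>d\<close>-tuples are functions
  \<^typ>\<open>nat \<Rightarrow> complex\<close> of which only the values at indices \<open>i < d\<close> matter.
\<close>

definition unord :: "nat \<Rightarrow> (nat \<Rightarrow> complex) \<Rightarrow> complex multiset" where
  "unord d z = image_mset z (mset_set {..<d})"

definition perm_dist :: "nat \<Rightarrow> (nat \<Rightarrow> complex) \<Rightarrow> (nat \<Rightarrow> complex) \<Rightarrow> (nat \<Rightarrow> nat) \<Rightarrow> real" where
  "perm_dist d z w \<sigma> = L2_set (\<lambda>i. cmod (z i - w (\<sigma> i))) {..<d} / sqrt (real d)"

text \<open>
  The minimum also ranges over the orderings of the two multisets, so that no ordering has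
  to be chosen; \<open>dist_A_unord\<close> below shows that any fixed pair of orderings gives the same value.
\<close>

definition dist_A :: "nat \<Rightarrow> complex multiset \<Rightarrow> complex multiset \<Rightarrow> real" where
  "dist_A d m m' =
     Min {perm_dist d z w \<sigma> | z w \<sigma>. unord d z = m \<and> unord d w = m' \<and> \<sigma> permutes {..<d}}"

lemma unord_eqD:
  assumes "unord d z = unord d z'"
  obtains p where "p permutes {..<d}" "\<And>i. i < d \<Longrightarrow> z i = z' (p i)"
proof -
  from assms have "image_mset z (mset_set {..<d}) = image_mset z' (mset_set {..<d})"
    by (simp add: unord_def)
  then obtain p where "p permutes {..<d}" "\<forall>i\<in>{..<d}. z i = z' (p i)"
    using image_mset_eq_implies_permutes[of "{..<d}" z z'] by auto
  then show thesis using that by auto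
qed

lemma dist_A_unord:
  "dist_A d (unord d z) (unord d w) = Min (perm_dist d z w ` {\<sigma>. \<sigma> permutes {..<d}})"
proof -
  have "perm_dist d z' w' \<sigma> \<in> perm_dist d z w ` {\<sigma>. \<sigma> permutes {..<d}}"
    if "unord d z' = unord d z" "unord d w' = unord d w" and \<sigma>: "\<sigma> permutes {..<d}" for z' w' \<sigma>
  proof -
    from that(1) obtain p where p: "p permutes {..<d}" "\<And>i. i < d \<Longrightarrow> z' i = z (p i)"
      using unord_eqD by blast
    from that(2) obtain r where r: "r permutes {..<d}" "\<And>i. i < d \<Longrightarrow> w' i = w (r i)"
      using unord_eqD by blast
    define \<rho> where "\<rho> = r \<circ> \<sigma> \<circ> inv p"
    have \<rho>: "\<rho> permutes {..<d}"
      unfolding \<rho>_def by (intro permutes_compose permutes_inv p r \<sigma>)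
    have "(\<Sum>i<d. (cmod (z' i - w' (\<sigma> i)))\<^sup>2) = (\<Sum>i<d. (cmod (z (p i) - w (\<rho> (p i))))\<^sup>2)"
    proof (rule sum.cong)
      fix i assume "i \<in> {..<d}"
      then have i: "i < d" by simp
      then have "\<sigma> i < d" using permutes_in_image[OF \<sigma>, of i] by simp
      with i show "(cmod (z' i - w' (\<sigma> i)))\<^sup>2 = (cmod (z (p i) - w (\<rho> (p i))))\<^sup>2"
        by (simp add: p(2) r(2) \<rho>_def permutes_inverses(2)[OF p(1)])
    qed simp
    also have "\<dots> = (\<Sum>i<d. (cmod (z i - w (\<rho> i)))\<^sup>2)"
      using sum.permute[OF p(1), of "\<lambda>i. (cmod (z i - w (\<rho> i)))\<^sup>2"] by (simp add: o_def)
    finally have "perm_dist d z' w' \<sigma> = perm_dist d z w \<rho>"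
      by (simp add: perm_dist_def L2_set_def)
    with \<rho> show ?thesis by blast
  qed
  then have "{perm_dist d z' w' \<sigma> | z' w' \<sigma>. unord d z' = unord d z \<and> unord d w' = unord d w
        \<and> \<sigma> permutes {..<d}} = perm_dist d z w ` {\<sigma>. \<sigma> permutes {..<d}}"
    by blast
  then show ?thesis by (simp add: dist_A_def)
qed

section \<open>Almgren embeddings\<close>

definition almgren_map :: "complex \<Rightarrow> complex multiset \<Rightarrow> real list" where
  "almgren_map \<theta> m = sorted_list_of_multiset (image_mset (\<lambda>z. Re (\<theta> * z)) m)"

definition almgren_forms :: "nat \<Rightarrow> nat \<Rightarrow> (nat \<Rightarrow> complex) \<Rightarrow> bool" where
  "almgren_forms d h \<theta> \<longleftrightarrow>
     (\<forall>l<h. cmod (\<theta> l) = 1) \<and>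
     (\<exists>\<alpha>>0. \<forall>z :: nat \<Rightarrow> complex. \<exists>l<h. \<forall>k\<in>{1..d\<^sup>2}. \<bar>Re (\<theta> l * z k)\<bar> \<ge> \<alpha> * cmod (z k))"

text \<open>
  Vectors in \<open>\<real>\<^sup>N\<close> are functions \<^typ>\<open>nat \<Rightarrow> real\<close> of which only the values at \<open>k < N\<close> matter.
  Here \<open>N = d * h\<close>, and coordinate \<open>k = l * d + i\<close> with \<open>i < d\<close> is entry \<open>i\<close> of the \<open>l\<close>-th array.
\<close>

definition almgren_emb ::
    "nat \<Rightarrow> nat \<Rightarrow> (nat \<Rightarrow> complex) \<Rightarrow> complex multiset \<Rightarrow> nat \<Rightarrow> real" where
  "almgren_emb d h \<theta> m k = (almgren_map (\<theta> (k div d)) m ! (k mod d)) / sqrt (real h)"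

section \<open>Sobolev functions on an open subset of the line\<close>

definition in_Lq :: "real \<Rightarrow> real set \<Rightarrow> (real \<Rightarrow> 'a::euclidean_space) \<Rightarrow> bool" where
  "in_Lq q I u \<longleftrightarrow> u \<in> borel_measurable (lebesgue_on I) \<and>
     integrable (lebesgue_on I) (\<lambda>x. norm (u x) powr q)"

text \<open>
  Norms take values in \<^typ>\<open>ennreal\<close>, so that a function that is not \<open>q\<close>-integrable
  has norm \<open>\<infinity>\<close> rather than \<open>0\<close>.
\<close>

definition Lq_norm :: "real \<Rightarrow> real set \<Rightarrow> (real \<Rightarrow> real) \<Rightarrow> ennreal" where
  "Lq_norm q I s =
     (let J = (\<integral>\<^sup>+ x. ennreal (\<bar>s x\<bar> powr q) \<partial>lebesgue_on I)
      in if J = \<infinity> then \<infinity> else ennreal (enn2real J powr (1 / q)))"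

definition test_function :: "real set \<Rightarrow> (real \<Rightarrow> real) \<Rightarrow> bool" where
  "test_function I \<phi> \<longleftrightarrow>
     (\<forall>k x. ((deriv ^^ k) \<phi>) field_differentiable (at x)) \<and>
     (\<exists>K. compact K \<and> K \<subseteq> I \<and> (\<forall>x. x \<notin> K \<longrightarrow> \<phi> x = 0))"

definition is_weak_deriv ::
    "real set \<Rightarrow> (real \<Rightarrow> 'a::euclidean_space) \<Rightarrow> (real \<Rightarrow> 'a) \<Rightarrow> bool" where
  "is_weak_deriv I u v \<longleftrightarrow>
     (\<forall>\<phi>. test_function I \<phi> \<longrightarrow>
        (LINT x|lebesgue_on I. deriv \<phi> x *\<^sub>R u x) = - (LINT x|lebesgue_on I. \<phi> x *\<^sub>R v x))"

definition W1 :: "real \<Rightarrow> real set \<Rightarrow> (real \<Rightarrow> 'a::euclidean_space) set" where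
  "W1 q I = {u. in_Lq q I u \<and> (\<exists>v. in_Lq q I v \<and> is_weak_deriv I u v)}"

definition weak_deriv ::
    "real \<Rightarrow> real set \<Rightarrow> (real \<Rightarrow> 'a::euclidean_space) \<Rightarrow> real \<Rightarrow> 'a" where
  "weak_deriv q I u = (SOME v. in_Lq q I v \<and> is_weak_deriv I u v)"

definition W1_vec :: "nat \<Rightarrow> real \<Rightarrow> real set \<Rightarrow> (real \<Rightarrow> nat \<Rightarrow> real) set" where
  "W1_vec N q I = {u. \<forall>k<N. (\<lambda>x. u x k) \<in> W1 q I}"

definition W1_vec_norm :: "nat \<Rightarrow> real \<Rightarrow> real set \<Rightarrow> (real \<Rightarrow> nat \<Rightarrow> real) \<Rightarrow> ennreal" where
  "W1_vec_norm N q I u =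
     Lq_norm q I (\<lambda>x. L2_set (u x) {..<N}) +
     Lq_norm q I (\<lambda>x. L2_set (\<lambda>k. weak_deriv q I (\<lambda>y. u y k) x) {..<N})"

section \<open>Sobolev curves of unordered tuples\<close>

text \<open>The last condition singles out the continuous representative.\<close>

definition W1_A ::
    "nat \<Rightarrow> nat \<Rightarrow> (nat \<Rightarrow> complex) \<Rightarrow> real \<Rightarrow> real set \<Rightarrow> (real \<Rightarrow> complex multiset) set" where
  "W1_A d h \<theta> q I =
     {f. (\<forall>x\<in>I. size (f x) = d) \<and>
         (\<lambda>x. almgren_emb d h \<theta> (f x)) \<in> W1_vec (d * h) q I \<and>
         (\<forall>x\<in>I. ((\<lambda>y. dist_A d (f y) (f x)) \<longlongrightarrow> 0) (at x within I))}"

definition is_param ::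
    "nat \<Rightarrow> real \<Rightarrow> real set \<Rightarrow> (real \<Rightarrow> complex multiset) \<Rightarrow> (nat \<Rightarrow> real \<Rightarrow> complex) \<Rightarrow> bool" where
  "is_param d q I f F \<longleftrightarrow>
     (\<forall>x\<in>I. f x = unord d (\<lambda>i. F i x)) \<and>
     (\<forall>i<d. continuous_on I (F i) \<and> F i \<in> W1 q I)"

definition param ::
    "nat \<Rightarrow> real \<Rightarrow> real set \<Rightarrow> (real \<Rightarrow> complex multiset) \<Rightarrow> nat \<Rightarrow> real \<Rightarrow> complex" where
  "param d q I f = (SOME F. is_param d q I f F)"

text \<open>
  The following notions concern the curve \<open>x \<mapsto> [F 0 x, \<dots>, F (d - 1) x]\<close>. The
  \<open>L i\<close>, \<open>i < d\<close>, of \<open>has_D\<close> are unique when they exist.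
\<close>

definition has_D ::
    "nat \<Rightarrow> (nat \<Rightarrow> real \<Rightarrow> complex) \<Rightarrow> real \<Rightarrow> (nat \<Rightarrow> complex) \<Rightarrow> bool" where
  "has_D d F x0 L \<longleftrightarrow>
     (\<lambda>x. dist_A d (unord d (\<lambda>i. F i x))
             (unord d (\<lambda>i. F i x0 + L i * complex_of_real (x - x0))))
       \<in> o[at x0](\<lambda>x. \<bar>x - x0\<bar>) \<and>
     (\<forall>i<d. \<forall>j<d. F i x0 = F j x0 \<longrightarrow> L i = L j)"

definition differentiable_A :: "nat \<Rightarrow> (nat \<Rightarrow> real \<Rightarrow> complex) \<Rightarrow> real \<Rightarrow> bool" where
  "differentiable_A d F x0 \<longleftrightarrow> (\<exists>L. has_D d F x0 L)"

definition D_A :: "nat \<Rightarrow> (nat \<Rightarrow> real \<Rightarrow> complex) \<Rightarrow> real \<Rightarrow> nat \<Rightarrow> complex" where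
  "D_A d F x0 = (SOME L. has_D d F x0 L)"

text \<open>\<open>r\<close> is a total ordering of the permutations of \<open>{..<d}\<close>, read as \<open>(\<tau>, \<sigma>) \<in> r\<close> iff \<open>\<tau> \<le> \<sigma>\<close>.\<close>

definition least_opt ::
    "nat \<Rightarrow> (nat \<Rightarrow> complex) \<Rightarrow> (nat \<Rightarrow> complex) \<Rightarrow> (nat \<Rightarrow> nat) rel \<Rightarrow> nat \<Rightarrow> nat" where
  "least_opt d z w r =
     (let T = {\<sigma>. \<sigma> permutes {..<d} \<and> perm_dist d z w \<sigma> = dist_A d (unord d z) (unord d w)}
      in THE \<tau>. \<tau> \<in> T \<and> (\<forall>\<sigma>\<in>T. (\<tau>, \<sigma>) \<in> r))"

definition s0 ::
    "nat \<Rightarrow> (real \<Rightarrow> complex multiset) \<Rightarrow> (real \<Rightarrow> complex multiset) \<Rightarrow> real \<Rightarrow> real" where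
  "s0 d f g x = dist_A d (f x) (g x)"

definition s1 ::
    "nat \<Rightarrow> (nat \<Rightarrow> real \<Rightarrow> complex) \<Rightarrow> (nat \<Rightarrow> real \<Rightarrow> complex) \<Rightarrow> real \<Rightarrow> real" where
  "s1 d F G x =
     (if differentiable_A d F x \<and> differentiable_A d G x
      then Max ((\<lambda>r. perm_dist d (D_A d F x) (D_A d G x)
                        (least_opt d (\<lambda>i. F i x) (\<lambda>i. G i x) r))
                ` {r. linear_order_on {\<sigma>. \<sigma> permutes {..<d}} r})
      else 0)"

definition dist_W1_A ::
    "nat \<Rightarrow> real \<Rightarrow> real set \<Rightarrow> (real \<Rightarrow> complex multiset) \<Rightarrow> (real \<Rightarrow> complex multiset) \<Rightarrow> ennreal" where
  "dist_W1_A d q I f g =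
     esssup (lebesgue_on I) (\<lambda>x. ennreal (s0 d f g x)) +
     Lq_norm q I (s1 d (param d q I f) (param d q I g))"

end

theory Submission
  imports Defs
begin

text \<open>
  Write \<open>\<eta>\<^sub>l(z) = Re (\<theta>\<^sub>l z)\<close>. The proof compares, at almost every point \<open>x\<close>, the two quantities that the
  theorem is about: \<open>s\<^sub>1(f, g)(x)\<close> and the speed of \<open>\<Delta> \<circ> f - \<Delta> \<circ> g\<close>.

  Let \<open>F\<^sub>i\<close> and \<open>G\<^sub>i\<close> parameterize \<open>f\<close> and \<open>g\<close>, with derivatives \<open>L\<^sub>i\<close> and \<open>M\<^sub>i\<close> at \<open>x\<close>. A zero of a real
  function at which its derivative is not zero is isolated. Applied to \<open>\<eta>\<^sub>l(F\<^sub>i) - \<eta>\<^sub>l(F\<^sub>j)\<close>, this shows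
  that at almost every \<open>x\<close> the equality \<open>\<eta>\<^sub>l(F\<^sub>i) = \<eta>\<^sub>l(F\<^sub>j)\<close> forces \<open>\<eta>\<^sub>l(L\<^sub>i) = \<eta>\<^sub>l(L\<^sub>j)\<close>
  (\<open>is_param_AE_regular\<close>). At such points the \<open>l\<close>-th array of the embedding is differentiable; its
  derivative lists the numbers \<open>\<eta>\<^sub>l(L\<^sub>i)\<close> in an order that sorts the values \<open>\<eta>\<^sub>l(F\<^sub>i)\<close>, and ties
  do not matter (\<open>almgren_map_has_derivative\<close>).

  Suppose that \<open>f(x)\<close> and \<open>g(x)\<close> are close compared with the smallest gap between different values
  \<open>\<eta>\<^sub>l(F\<^sub>i(x))\<close>. An optimal matching \<open>\<tau>\<close> then respects the clusters of equal values, and so does sorting.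
  Hence, up to a permutation of the indices, the differences \<open>\<eta>\<^sub>l(L\<^sub>i) - \<eta>\<^sub>l(M\<^sub>\<tau>\<^sub>(\<^sub>i\<^sub>))\<close> are exactly
  the coordinates of the derivative of \<open>H\<^sub>l \<circ> f - H\<^sub>l \<circ> g\<close> (\<open>sorted_derivative_matching\<close>). As the forms separate
  points, the two quantities are comparable at \<open>x\<close> (\<open>derivative_comparison\<close>). Where \<open>f(x)\<close> and \<open>g(x)\<close> are not
  close, each quantity is bounded by the other one plus the speed of \<open>f\<close>, which is a fixed
  function in \<open>L\<^sup>q\<close>. When the distances tend to 0, almost every point eventually lies in the
  good set, and dominated convergence removes the error. Each of the two kinds of convergence makes the
  distances tend to 0 uniformly, so each implies the other (\<open>convergence_equivalence\<close>).

  All this rests on two facts about Sobolev functions on an interval. A continuous function with weak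
  derivative \<open>v\<close> is an indefinite integral of \<open>v\<close> and has derivative \<open>v\<close> almost everywhere
  (\<open>weak_deriv_integral_representation\<close>, \<open>weak_deriv_AE_derivative\<close>): this combines Lebesgue's differentiation
  theorem, proved by Vitali coverings, with the lemma of du Bois-Reymond. Conversely, a function whose
  increments are dominated by integrals of a function in \<open>L\<^sup>q\<close> is a Sobolev function
  (\<open>dominated_increments_imp_W1\<close>); the density is obtained from the Radon-Nikodym theorem.
  The second fact yields Sobolev parameterizations (\<open>param_exists\<close>): the
  bi-Lipschitz property of the embedding provides matchings between the values of \<open>f\<close> at different
  points, and a compactness argument chooses the orderings consistently (\<open>selection\<close>).
\<close>


section \<open>Lebesgue's differentiation theorem on the line\<close>

text \<open>
  Where \<open>v < p\<close> the positive part of \<open>v - p\<close> vanishes, so by outer regularity its integral over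
  some open neighbourhood of this set is as small as desired. Vitali's theorem covers the
  exceptional set, up to a null set, by disjoint intervals inside that neighbourhood on which
  \<open>v\<close> has average above \<open>r\<close>. Each of them contributes at least \<open>r - p\<close> times its length
  to the small integral, so their total length is small.
\<close>

lemma negligible_large_averages:
  fixes v :: "real \<Rightarrow> real"
  assumes v: "integrable lborel v" and "p < r"
  shows "negligible {x \<in> {a<..<b}. v x < p \<and>
     (\<forall>\<delta>>0. \<exists>s t. s < t \<and> s \<le> x \<and> x \<le> t \<and> t - s < \<delta> \<and> r * (t - s) < (LBINT y:{s..t}. v y))}"
    (is "negligible ?E")
proof -
  define g where "g x = indicator {a<..<b} x * max (v x - p) 0" for x
  have [measurable]: "v \<in> borel_measurable borel" using v by auto
  have gm[measurable]: "g \<in> borel_measurable borel" unfolding g_def by measurable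
  have g0: "g x \<ge> 0" for x by (simp add: g_def)
  have gi: "integrable lborel g"
  proof (rule Bochner_Integration.integrable_bound[where f="\<lambda>x. \<bar>v x\<bar> + \<bar>p\<bar> * indicator {a<..<b} x"])
    have "integrable lborel (\<lambda>x. indicator {a<..<b} x :: real)"
      by (cases "a \<le> b") (auto)
    then show "integrable lborel (\<lambda>x. \<bar>v x\<bar> + \<bar>p\<bar> * indicator {a<..<b} x)"
      using v by auto
    show "AE x in lborel. norm (g x) \<le> norm (\<bar>v x\<bar> + \<bar>p\<bar> * indicator {a<..<b} x)"
      by (rule AE_I2) (auto simp: g_def indicator_def)
  qed auto
  define M where "M = density lborel (\<lambda>x. ennreal (g x))"
  have setsM: "sets M = sets borel" by (simp add: M_def)
  have eM: "emeasure M A = (\<integral>\<^sup>+x. ennreal (g x) * indicator A x \<partial>lborel)" if "A \<in> sets borel" for A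
    using that unfolding M_def by (subst emeasure_density) auto
  have finM: "emeasure M (space M) \<noteq> \<infinity>"
    using integrableD(2)[OF gi] g0 by (simp add: M_def emeasure_density)
  define B where "B = {x \<in> {a<..<b}. v x < p}"
  have Bm: "B \<in> sets borel" unfolding B_def by measurable
  have B0: "emeasure M B = 0"
  proof -
    have "(\<integral>\<^sup>+x. ennreal (g x) * indicator B x \<partial>lborel) = (\<integral>\<^sup>+(x::real). 0 \<partial>lborel)"
      by (intro nn_integral_cong) (auto simp: g_def B_def indicator_def)
    then show ?thesis by (simp add: eM Bm)
  qed
  show ?thesis unfolding negligible_outer_le
  proof (intro allI impI)
    fix e :: real assume "e > 0"
    define e' where "e' = e * (r - p)"
    have "e' > 0" using \<open>e > 0\<close> \<open>p < r\<close> by (simp add: e'_def)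
    have "(INF U\<in>{U. B \<subseteq> U \<and> open U}. emeasure M U) < ennreal e'"
      using outer_regular[OF setsM finM Bm] B0 \<open>e' > 0\<close> by simp
    then obtain U where U: "B \<subseteq> U" "open U" "emeasure M U < ennreal e'"
      by (auto simp: INF_less_iff)
    define G where "G = U \<inter> {a<..<b}"
    have G: "open G" "B \<subseteq> G" "G \<subseteq> {a<..<b}" using U by (auto simp: G_def B_def)
    have MG: "emeasure M G \<le> emeasure M U"
      by (rule emeasure_mono) (use U setsM in \<open>auto simp: G_def\<close>)
    define K where "K = {(s,t). s < t \<and> {s..t} \<subseteq> G \<and> r * (t - s) < (LBINT y:{s..t}. v y)}"
    define c where "c = (\<lambda>(s,t). (s+t)/2 :: real)"
    define \<rho> where "\<rho> = (\<lambda>(s,t). (t-s)/2 :: real)"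
    have cb: "cball (c i) (\<rho> i) = {fst i..snd i}" for i
      by (cases i) (auto simp: c_def \<rho>_def cball_eq_atLeastAtMost field_simps)
    obtain C where C: "countable C" "C \<subseteq> K"
     "pairwise (\<lambda>i j. disjnt (cball (c i) (\<rho> i)) (cball (c j) (\<rho> j))) C"
     "negligible(?E - (\<Union>i \<in> C. cball (c i) (\<rho> i)))"
    proof (rule Vitali_covering_theorem_cballs[of K \<rho> ?E c])
      show "0 < \<rho> i" if "i \<in> K" for i using that by (auto simp: K_def \<rho>_def)
      fix x d :: real assume x: "x \<in> ?E" and "0 < d"
      then have "x \<in> G" using G(2) by (auto simp: B_def)
      then obtain \<delta> where \<delta>: "\<delta> > 0" "ball x \<delta> \<subseteq> G" using G(1) openE by blast
      from x obtain s t where st: "s < t" "s \<le> x" "x \<le> t" "t - s < min \<delta> d" "r * (t - s) < (LBINT y:{s..t}. v y)"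
        using \<delta>(1) \<open>0 < d\<close> by (auto dest!: spec[of _ "min \<delta> d"])
      have "{s..t} \<subseteq> G" using st \<delta>(2) by (force simp: dist_real_def)
      then have "(s,t) \<in> K" using st by (simp add: K_def)
      moreover have "\<rho> (s,t) < d" using st by (simp add: \<rho>_def)
      ultimately show "\<exists>i. i \<in> K \<and> x \<in> cball (c i) (\<rho> i) \<and> \<rho> i < d"
        using st by (intro exI[of _ "(s,t)"]) (auto simp: cb)
    qed auto
    define W where "W = (\<Union>i \<in> C. {fst i..snd i})"
    have disj: "disjoint_family_on (\<lambda>i. {fst i..snd i}) C"
      using C(3) by (auto simp: disjoint_family_on_def pairwise_def disjnt_def cb)
    have Wm: "W \<in> sets borel" unfolding W_def using C(1) by auto
    have WG: "W \<subseteq> G" using C(2) by (force simp: W_def K_def)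
    have step: "ennreal (r - p) * emeasure lborel {fst i..snd i} \<le> emeasure M {fst i..snd i}" if i: "i \<in> C" for i
    proof -
      obtain s t where it: "i = (s,t)" by (cases i)
      have st: "s < t" "{s..t} \<subseteq> G" "r * (t - s) < (LBINT y:{s..t}. v y)"
        using i C(2) by (auto simp: K_def it)
      have vi: "set_integrable lborel {s..t} v"
        unfolding set_integrable_def using v by (intro integrable_mult_indicator) auto
      have pc: "set_integrable lborel {s..t} (\<lambda>_. p)" "(LBINT y:{s..t}. p) = p * (t - s)"
        using st by (auto simp: set_integrable_def set_lebesgue_integral_def)
      have "(r - p) * (t - s) \<le> (LBINT y:{s..t}. v y) - p * (t - s)"
        using st by (simp add: algebra_simps)
      also have "\<dots> = (LBINT y:{s..t}. v y - p)"
        using st set_integral_diff(2)[OF vi pc(1)] by (simp only: pc(2))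
      also have "\<dots> \<le> (LBINT y. indicator {s..t} y * g y)"
        unfolding set_lebesgue_integral_def
      proof (rule integral_mono)
        show "integrable lborel (\<lambda>x. indicat_real {s..t} x *\<^sub>R (v x - p))"
          using set_integral_diff(1)[OF vi pc(1)] by (auto simp: set_integrable_def)
        show "integrable lborel (\<lambda>y. indicat_real {s..t} y * g y)"
          using integrable_mult_indicator[OF _ gi, of "{s..t}"] by simp
        show "indicat_real {s..t} x *\<^sub>R (v x - p) \<le> indicat_real {s..t} x * g x" for x
        proof (cases "x \<in> {s..t}")
          case True
          then have "x \<in> {a<..<b}" using st(2) G(3) by blast
          with True show ?thesis by (simp add: g_def)
        qed simp
      qed
      finally have "ennreal ((r-p) * (t-s)) \<le> ennreal (LBINT y. indicator {s..t} y * g y)"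
        by (rule ennreal_leI)
      also have "\<dots> = (\<integral>\<^sup>+y. ennreal (indicator {s..t} y * g y) \<partial>lborel)"
        using integrable_mult_indicator[OF _ gi, of "{s..t}"] g0
        by (subst nn_integral_eq_integral) auto
      also have "\<dots> = emeasure M {s..t}"
        by (subst eM) (auto intro!: nn_integral_cong simp: indicator_def)
      finally show ?thesis using st \<open>p < r\<close> by (simp add: it ennreal_mult)
    qed
    have "ennreal (r - p) * emeasure lborel W = (\<integral>\<^sup>+i. ennreal (r - p) * emeasure lborel {fst i..snd i} \<partial>count_space C)"
      unfolding W_def using C(1) disj
      by (subst emeasure_UN_countable) (auto simp: nn_integral_cmult)
    also have "\<dots> \<le> (\<integral>\<^sup>+i. emeasure M {fst i..snd i} \<partial>count_space C)"
      by (rule nn_integral_mono) (use step in auto)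
    also have "\<dots> = emeasure M W"
      unfolding W_def using C(1) disj setsM by (subst emeasure_UN_countable) auto
    also have "\<dots> \<le> emeasure M G" by (rule emeasure_mono[OF WG]) (use setsM G in auto)
    also have "\<dots> < ennreal e'" using MG U(3) by simp
    also have "\<dots> = ennreal (r - p) * ennreal e" using \<open>p < r\<close> \<open>e>0\<close> by (simp add: e'_def ennreal_mult mult.commute)
    finally have Wle: "emeasure lborel W < ennreal e"
      by (meson mult_left_mono not_less zero_le)
    let ?N = "?E - W"
    have N: "negligible ?N" using C(4) by (simp add: W_def cb)
    have WL: "W \<in> lmeasurable" using Wm Wle 
      by (intro fmeasurableI) (auto simp: top.not_eq_extremum intro: less_trans)
    show "\<exists>T. ?E \<subseteq> T \<and> T \<in> lmeasurable \<and> measure lebesgue T \<le> e"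
    proof (intro exI conjI)
      show "?E \<subseteq> W \<union> ?N" by auto
      show "W \<union> ?N \<in> lmeasurable" using WL N negligible_imp_measurable by blast
      have "measure lebesgue (W \<union> ?N) = measure lebesgue W"
        using N WL by (intro measure_Un_null_set) (auto simp: negligible_iff_null_sets)
      also have "\<dots> = enn2real (emeasure lborel W)" using Wm by (simp add: measure_def)
      also have "\<dots> \<le> e" using Wle \<open>e>0\<close> by (intro enn2real_leI) auto
      finally show "measure lebesgue (W \<union> ?N) \<le> e" .
    qed
  qed
qed

lemma AE_lebesgue_on_iff_negligible:
  fixes P :: "'a::euclidean_space \<Rightarrow> bool"
  assumes "S \<in> sets lebesgue"
  shows "(AE x in lebesgue_on S. P x) \<longleftrightarrow> negligible {x\<in>S. \<not> P x}"
proof -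
  have "(AE x in lebesgue_on S. P x) \<longleftrightarrow> (AE x in lebesgue. x \<in> S \<longrightarrow> P x)"
    using assms by (subst AE_restrict_space_iff) auto
  also have "\<dots> \<longleftrightarrow> negligible {x\<in>S. \<not> P x}"
    by (auto simp: eventually_ae_filter negligible_iff_null_sets intro: null_sets_completion_subset)
  finally show ?thesis .
qed

lemma integral_diff_subinterval:
  fixes v :: "real \<Rightarrow> real"
  assumes "v integrable_on {a..b}" "a \<le> s" "s \<le> t" "t \<le> b"
  shows "integral {a..t} v - integral {a..s} v = integral {s..t} v"
proof -
  have "v integrable_on {a..t}" using assms by (auto intro: integrable_on_subinterval)
  then show ?thesis using Henstock_Kurzweil_Integration.integral_combine[of a s t v] assms by simp
qed

text \<open>
  Outside the exceptional sets of \<open>negligible_large_averages\<close> for all rational \<open>p < r\<close>, taken for \<open>v\<close> and for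
  \<open>- v\<close>, the averages of \<open>v\<close> over short intervals that contain \<open>x\<close> are squeezed towards \<open>v x\<close>.
\<close>

lemma lebesgue_differentiation_borel:
  fixes v :: "real \<Rightarrow> real"
  assumes v: "integrable lborel v"
  shows "AE x in lebesgue_on {a<..<b}. ((\<lambda>y. integral {a..y} v) has_field_derivative v x) (at x)"
proof -
  define E where "E w p r = {x \<in> {a<..<b}. w x < p \<and>
     (\<forall>\<delta>>0. \<exists>s t. s < t \<and> s \<le> x \<and> x \<le> t \<and> t - s < \<delta> \<and> r * (t - s) < (LBINT y:{s..t}. w y))}"
    for w :: "real \<Rightarrow> real" and p r
  define N where "N w = (\<Union>(p,r)\<in>{(p,r)\<in>\<rat>\<times>\<rat>. p < r}. E w p r)" for w
  have cnt: "countable {(p,r)\<in>\<rat>\<times>\<rat>. p < (r::real)}"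
    by (rule countable_subset[of _ "\<rat>\<times>\<rat>"]) (auto intro: countable_rat)
  have Nneg: "negligible (N w)" if "integrable lborel w" for w
    unfolding N_def
  proof (rule negligible_countable_Union)
    show "countable ((\<lambda>(p,r). E w p r) ` {(p,r)\<in>\<rat>\<times>\<rat>. p < r})"
      using cnt by (rule countable_image)
    show "negligible S" if "S \<in> (\<lambda>(p,r). E w p r) ` {(p,r)\<in>\<rat>\<times>\<rat>. p < r}" for S
      using that negligible_large_averages[OF \<open>integrable lborel w\<close>] by (auto simp: E_def)
  qed
  have upper: "\<exists>\<delta>>0. \<forall>s t. s < t \<and> s \<le> x \<and> x \<le> t \<and> t - s < \<delta> \<longrightarrow> (LBINT y:{s..t}. w y) \<le> (w x + e) * (t - s)"
    if "x \<in> {a<..<b}" "x \<notin> N w" "e > 0" for w x e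
  proof -
    obtain p where p: "p \<in> \<rat>" "w x < p" "p < w x + e" 
      using Rats_dense_in_real[of "w x" "w x + e"] \<open>e > 0\<close> by auto
    obtain r where r: "r \<in> \<rat>" "p < r" "r < w x + e" 
      using Rats_dense_in_real[of p "w x + e"] p by auto
    have "x \<notin> E w p r" using that p r by (auto simp: N_def)
    then have "\<exists>\<delta>>0. \<forall>s t. \<not> (s < t \<and> s \<le> x \<and> x \<le> t \<and> t - s < \<delta> \<and> r * (t - s) < (LBINT y:{s..t}. w y))"
      using that(1) p(2) unfolding E_def by simp
    then obtain \<delta> where \<delta>: "\<delta> > 0" "\<And>s t. s < t \<Longrightarrow> s \<le> x \<Longrightarrow> x \<le> t \<Longrightarrow> t - s < \<delta> \<Longrightarrow> (LBINT y:{s..t}. w y) \<le> r * (t - s)"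
      by (metis not_less)
    have "r * (t - s) \<le> (w x + e) * (t - s)" if "s < t" for s t using that r by (intro mult_right_mono) auto
    with \<delta> show ?thesis by (meson order_trans)
  qed
  have vs: "set_integrable lborel {s..t} v" for s t
    unfolding set_integrable_def using v by (intro integrable_mult_indicator) auto
  have LB: "(LBINT y:{s..t}. v y) = integral {s..t} v" for s t
    using set_borel_integral_eq_integral(2)[OF vs] .
  have LBm: "(LBINT y:{s..t}. - v y) = - integral {s..t} v" for s t
    using LB[of s t] by (simp add: set_lebesgue_integral_def)
  have vi: "v integrable_on {s..t}" for s t using set_borel_integral_eq_integral(1)[OF vs] .
  have der: "((\<lambda>y. integral {a..y} v) has_field_derivative v x) (at x)"
    if x: "x \<in> {a<..<b}" "x \<notin> N v" "x \<notin> N (\<lambda>x. - v x)" for x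
    unfolding has_field_derivative_iff LIM_eq
  proof (intro allI impI)
    fix e :: real assume "e > 0"
    then have e2: "e/2 > 0" by simp
    obtain d1 where d1: "d1 > 0" "\<And>s t. s < t \<Longrightarrow> s \<le> x \<Longrightarrow> x \<le> t \<Longrightarrow> t - s < d1 \<Longrightarrow> integral {s..t} v \<le> (v x + e/2) * (t - s)"
      using upper[OF x(1,2) e2] by (auto simp: LB)
    obtain d2 where d2: "d2 > 0" "\<And>s t. s < t \<Longrightarrow> s \<le> x \<Longrightarrow> x \<le> t \<Longrightarrow> t - s < d2 \<Longrightarrow> - integral {s..t} v \<le> (- v x + e/2) * (t - s)"
      using upper[OF x(1,3) e2] by (auto simp: LBm)
    define d where "d = min (min d1 d2) (x - a)"
    have "d > 0" using d1 d2 x by (auto simp: d_def)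
    moreover have "norm ((integral {a..y} v - integral {a..x} v) / (y - x) - v x) < e"
      if y: "y \<noteq> x" "norm (y - x) < d" for y
    proof -
      have *: "\<bar>integral {s..t} v - v x * (t - s)\<bar> \<le> e / 2 * (t - s)" 
        if "s < t" "s \<le> x" "x \<le> t" "t - s < d" for s t
      proof -
        have "integral {s..t} v \<le> (v x + e/2) * (t - s)" "- integral {s..t} v \<le> (- v x + e/2) * (t - s)"
          using d1(2)[of s t] d2(2)[of s t] that by (auto simp: d_def)
        then show ?thesis unfolding abs_le_iff by (simp only: distrib_right) linarith
      qed
      have "\<bar>(integral {a..y} v - integral {a..x} v) - v x * (y - x)\<bar> \<le> e / 2 * \<bar>y - x\<bar>"
      proof (cases "x < y")
        case True
        then have "integral {a..y} v - integral {a..x} v = integral {x..y} v"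
          using x by (intro integral_diff_subinterval[OF vi]) auto
        with *[of x y] True y show ?thesis by auto
      next
        case False
        then have "integral {a..x} v - integral {a..y} v = integral {y..x} v"
          using x y by (intro integral_diff_subinterval[OF vi]) (auto simp: d_def)
        then have "(integral {a..y} v - integral {a..x} v) - v x * (y - x) = - (integral {y..x} v - v x * (x - y))"
          by (simp add: algebra_simps)
        moreover have "\<bar>integral {y..x} v - v x * (x - y)\<bar> \<le> e / 2 * (x - y)"
          using False y by (intro *) auto
        ultimately show ?thesis using False y by (simp only: abs_minus_cancel) auto
      qed
      moreover have "((integral {a..y} v - integral {a..x} v) / (y - x) - v x) * (y - x)
          = (integral {a..y} v - integral {a..x} v) - v x * (y - x)"
        using y by (subst left_diff_distrib) simp
      ultimately have "\<bar>((integral {a..y} v - integral {a..x} v) / (y - x) - v x)\<bar> * \<bar>y - x\<bar> \<le> e / 2 * \<bar>y - x\<bar>"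
        by (simp only: abs_mult[symmetric])
      then have "\<bar>((integral {a..y} v - integral {a..x} v) / (y - x) - v x)\<bar> \<le> e / 2"
        by (rule mult_right_le_imp_le) (use y in simp)
      then show ?thesis using \<open>e > 0\<close> by simp
    qed
    ultimately show "\<exists>s>0. \<forall>xa. xa \<noteq> x \<and> norm (xa - x) < s \<longrightarrow>
        norm ((integral {a..xa} v - integral {a..x} v) / (xa - x) - v x) < e" by blast
  qed
  show ?thesis
  proof (subst AE_lebesgue_on_iff_negligible)
    have "negligible (N v \<union> N (\<lambda>x. - v x))" using v by (intro negligible_Un Nneg) auto
    then show "negligible {x \<in> {a<..<b}. \<not> ((\<lambda>y. integral {a..y} v) has_real_derivative v x) (at x)}"
      by (rule negligible_subset) (use der in auto)
  qed auto
qed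

text \<open>
  Outer regularity and the Radon-Nikodym theorem are about Borel functions; this lemma and the next
  one carry their consequences over to Lebesgue measurable functions.
\<close>

lemma lebesgue_integrable_borel_version:
  fixes v :: "real \<Rightarrow> real"
  assumes "set_integrable lebesgue S v"
  obtains w where "integrable lborel w" "AE x in lebesgue. indicator S x * v x = w x"
proof -
  let ?u = "\<lambda>x. indicator S x * v x"
  have u: "integrable lebesgue ?u" using assms by (simp add: set_integrable_def)
  then have "?u \<in> borel_measurable (completion lborel)" by auto
  then obtain w where w: "w \<in> borel_measurable lborel" "AE x in lborel. ?u x = w x"
    using completion_ex_borel_measurable_real by blast
  have ae: "AE x in lebesgue. ?u x = w x" using w(2) by (rule AE_completion)
  have "w \<in> borel_measurable lebesgue" using w(1) by (rule measurable_completion)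
  then have "integrable lebesgue w" using integrable_cong_AE[of ?u lebesgue w] u ae by auto
  then have "integrable lborel w" using w(1) integrable_completion by blast
  with ae that show ?thesis by blast
qed

lemma integral_borel_version:
  fixes v :: "real \<Rightarrow> real"
  assumes "AE x in lebesgue. indicator S x * v x = w x" "T \<subseteq> S"
  shows "integral T v = integral T w"
proof -
  have "negligible {x. indicator S x * v x \<noteq> w x}"
    using assms(1) AE_lebesgue_on_iff_negligible[of UNIV "\<lambda>x. indicator S x * v x = w x"]
    unfolding lebesgue_on_UNIV_eq by simp
  then show ?thesis
    by (rule integral_spike) (use assms(2) in \<open>auto simp: indicator_def split: if_splits\<close>)
qed

theorem lebesgue_differentiation:
  fixes v :: "real \<Rightarrow> real"
  assumes "v absolutely_integrable_on {a..b}"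
  shows "AE x in lebesgue_on {a<..<b}. ((\<lambda>y. integral {a..y} v) has_field_derivative v x) (at x)"
proof -
  obtain w where w: "integrable lborel w" "AE x in lebesgue. indicator {a..b} x * v x = w x"
    using lebesgue_integrable_borel_version[OF assms] .
  have eq: "integral {a..y} v = integral {a..y} w" if "y \<le> b" for y
    using w(2) by (rule integral_borel_version) (use that in auto)
  have "AE x in lebesgue_on {a<..<b}. indicator {a..b} x * v x = w x"
    using w(2) by (subst AE_restrict_space_iff) (auto elim: eventually_mono)
  then show ?thesis using lebesgue_differentiation_borel[OF w(1), of a b] AE_space
  proof eventually_elim
    case (elim x)
    then have x: "x \<in> {a<..<b}" "v x = w x" by (auto simp: indicator_def)
    have "((\<lambda>y. integral {a..y} w) has_field_derivative v x) (at x)" using elim x by simp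
    then show ?case
      by (rule DERIV_cong_ev[THEN iffD1, rotated -1])
         (use x eq eventually_nhds_in_open[of "{a<..<b}" x] in \<open>auto elim!: eventually_mono\<close>)
  qed
qed

section \<open>Functions with dominated increments\<close>

lemma sets_borel_Ioc: "sets borel = sigma_sets UNIV (range (\<lambda>(a, b). {a<..b::real}))"
  by (subst borel_sigma_sets_Ioc) (rule sets_measure_of, simp)

text \<open>
  The two sides agree on half-open intervals, which generate the Borel sets.
\<close>

lemma interval_measure_add:
  fixes F1 F2 :: "real \<Rightarrow> real"
  assumes mono: "mono F1" "mono F2" and cont: "continuous_on UNIV F1" "continuous_on UNIV F2"
    and A: "A \<in> sets borel"
  shows "emeasure (interval_measure (\<lambda>x. F1 x + F2 x)) A = emeasure (interval_measure F1) A + emeasure (interval_measure F2) A"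
proof -
  let ?m = "\<lambda>A. emeasure (interval_measure F1) A + emeasure (interval_measure F2) A"
  define S where "S = measure_of UNIV (sets borel) ?m"
  have eS: "emeasure S A = ?m A" if "A \<in> sets borel" for A
    unfolding S_def
  proof (rule emeasure_measure_of_sigma[OF _ _ _ that])
    show "sigma_algebra UNIV (sets (borel :: real measure))" using sets.sigma_algebra_axioms[of "borel :: real measure"] by simp
    show "positive (sets borel) ?m" by (simp add: positive_def)
    show "countably_additive (sets borel) ?m"
      unfolding countably_additive_def
    proof (intro allI impI)
      fix B :: "nat \<Rightarrow> real set" assume B: "range B \<subseteq> sets borel" "disjoint_family B"
      have "(\<Sum>i. ?m (B i)) = (\<Sum>i. emeasure (interval_measure F1) (B i)) + (\<Sum>i. emeasure (interval_measure F2) (B i))"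
        by (subst suminf_add) auto
      also have "\<dots> = ?m (\<Union>i. B i)" using B by (subst (1 2) suminf_emeasure) auto
      finally show "(\<Sum>i. ?m (B i)) = ?m (\<Union>i. B i)" .
    qed
  qed
  have sS: "sets S = sets borel" unfolding S_def
    using sets.sigma_sets_eq[of "borel :: real measure"] by (subst sets_measure_of) auto
  have rc: "continuous (at_right x) F" if "continuous_on UNIV F" for x and F :: "real \<Rightarrow> real"
    using that by (auto simp: continuous_on_eq_continuous_at intro: continuous_at_imp_continuous_within)
  have Ioc: "emeasure (interval_measure F) {s<..t} = ennreal (F t - F s)"
    if "s \<le> t" "mono F" "continuous_on UNIV F" for s t F
    using that rc by (intro emeasure_interval_measure_Ioc) (auto dest: monoD)
  let ?E = "range (\<lambda>(a, b). {a<..b::real})"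
  have m12: "mono (\<lambda>x. F1 x + F2 x)" using mono by (intro monoI add_mono) (auto dest: monoD)
  have c12: "continuous_on UNIV (\<lambda>x. F1 x + F2 x)" using cont by (intro continuous_intros)
  have sb: "sets borel = sigma_sets UNIV ?E" by (rule sets_borel_Ioc)
  have "interval_measure (\<lambda>x. F1 x + F2 x) = S"
  proof (rule measure_eqI_generator_eq[where E="?E" and \<Omega>=UNIV and A="\<lambda>n. {- real n<..real n}"])
    show "Int_stable ?E" by (force simp: Int_stable_def)
    show "emeasure (interval_measure (\<lambda>x. F1 x + F2 x)) X = emeasure S X" if X: "X \<in> ?E" for X
    proof -
      obtain s t where st: "X = {s<..t}" using X by auto
      show ?thesis
      proof (cases "s \<le> t")
        case True
        then have "0 \<le> F1 t - F1 s" "0 \<le> F2 t - F2 s" using mono by (auto dest: monoD)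
        then show ?thesis using True mono cont m12 c12
          by (simp add: st eS Ioc ennreal_plus[symmetric] algebra_simps del: ennreal_plus)
      qed (simp add: st)
    qed
    show "(\<Union>i. {- real i<..real i}) = UNIV"
    proof (intro set_eqI iffI UNIV_I)
      fix x :: real 
      obtain n where "real n > \<bar>x\<bar>" using reals_Archimedean2 by blast
      then show "x \<in> (\<Union>i. {- real i<..real i})" by (intro UN_I[of n]) auto
    qed
    show "emeasure (interval_measure (\<lambda>x. F1 x + F2 x)) {- real i<..real i} \<noteq> \<infinity>" for i
      using m12 c12 by (subst Ioc) auto
  qed (use sb sS in auto)
  then show ?thesis using eS A by simp
qed

lemma integral_eq_emeasure_density:
  fixes w :: "real \<Rightarrow> real"
  assumes "integrable lborel w" "\<And>x. w x \<ge> 0"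
  shows "emeasure (density lborel (\<lambda>x. ennreal (w x))) {s<..t} = ennreal (integral {s..t} w)"
proof -
  have [measurable]: "w \<in> borel_measurable borel" using assms by auto
  have i: "integrable lborel (\<lambda>x. indicator {s<..t} x *\<^sub>R w x)" using assms by (intro integrable_mult_indicator) auto
  have "emeasure (density lborel (\<lambda>x. ennreal (w x))) {s<..t} = (\<integral>\<^sup>+x. ennreal (indicator {s<..t} x *\<^sub>R w x) \<partial>lborel)"
    by (subst emeasure_density) (auto intro!: nn_integral_cong simp: indicator_def)
  also have "\<dots> = ennreal (LBINT x:{s<..t}. w x)"
    unfolding set_lebesgue_integral_def using i assms(2) by (intro nn_integral_eq_integral) auto
  also have "(LBINT x:{s<..t}. w x) = integral {s<..t} w"
    using i by (intro set_borel_integral_eq_integral(2)) (simp add: set_integrable_def)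
  also have "\<dots> = integral {s..t} w"
    by (rule integral_subset_negligible) (auto intro: negligible_subset[OF negligible_sing[of s]])
  finally show ?thesis .
qed

lemma nonneg_mono_integral:
  fixes w :: "real \<Rightarrow> real"
  assumes "integrable lborel w" "\<And>x. w x \<ge> 0"
  shows "w integrable_on {s..t}" "integral {s..t} w \<ge> 0"
proof -
  have "set_integrable lborel {s..t} w" 
    unfolding set_integrable_def using assms by (intro integrable_mult_indicator) auto
  then show "w integrable_on {s..t}" by (rule set_borel_integral_eq_integral(1))
  then show "integral {s..t} w \<ge> 0" using assms by (intro Henstock_Kurzweil_Integration.integral_nonneg) auto
qed

text \<open>
  Let \<open>G\<close> be the indefinite integral of \<open>w\<close>. Both \<open>H\<close> and \<open>G - H\<close> are nondecreasing, and their
  Stieltjes measures add up to the measure with density \<open>w\<close>. So the Stieltjes measure of \<open>H\<close> is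
  absolutely continuous, and its Radon-Nikodym density is the required \<open>\<psi>\<close>.
\<close>

lemma monotone_dominated_increments_density:
  fixes H w :: "real \<Rightarrow> real"
  assumes w: "integrable lborel w" "\<And>x. w x \<ge> 0" and "a \<le> b"
    and incr: "\<And>x y. a \<le> x \<Longrightarrow> x \<le> y \<Longrightarrow> y \<le> b \<Longrightarrow> 0 \<le> H y - H x \<and> H y - H x \<le> integral {x..y} w"
  obtains \<psi> where "\<psi> absolutely_integrable_on {a..b}" "\<And>x. x \<in> {a..b} \<Longrightarrow> H x = H a + integral {a..x} \<psi>"
proof -
  (* Clamping to [a, b] extends the functions to the line, as Stieltjes measures require. *)
  define c where "c x = min (max x a) b" for x :: real
  have cab: "c x \<in> {a..b}" for x using \<open>a \<le> b\<close> by (auto simp: c_def)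
  have cm: "c x \<le> c y" if "x \<le> y" for x y using that by (auto simp: c_def)
  have cc: "continuous_on UNIV c" unfolding c_def by (intro continuous_intros)
  define G where "G x = integral {a..x} w" for x
  define F1 where "F1 x = H (c x)" for x
  define F2 where "F2 x = G (c x) - H (c x)" for x
  note wi = nonneg_mono_integral[OF w]
  have Gd: "G y - G x = integral {x..y} w" if "a \<le> x" "x \<le> y" for x y
    unfolding G_def using that by (intro integral_diff_subinterval[OF wi(1)[of a y]]) auto
  have contG: "continuous_on {a..b} G" unfolding G_def using wi by (intro indefinite_integral_continuous_1) auto
  have contH: "continuous_on {a..b} H"
  proof (rule continuous_on_iff[THEN iffD2], intro ballI allI impI)
    fix x e :: real assume x: "x \<in> {a..b}" "e > 0"
    obtain d where d: "d > 0" "\<And>y. y \<in> {a..b} \<Longrightarrow> dist y x < d \<Longrightarrow> dist (G y) (G x) < e"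
      using contG x unfolding continuous_on_iff by blast
    have "dist (H y) (H x) \<le> dist (G y) (G x)" if "y \<in> {a..b}" for y
      using incr[of x y] incr[of y x] Gd[of x y] Gd[of y x] that x unfolding dist_real_def by (cases "x \<le> y") simp_all
    with d(1) show "\<exists>d>0. \<forall>x'\<in>{a..b}. dist x' x < d \<longrightarrow> dist (H x') (H x) < e"
      using order_le_less_trans[OF _ d(2)] by blast
  qed
  have comp: "continuous_on UNIV (\<lambda>x. h (c x))" if "continuous_on {a..b} h" for h :: "real \<Rightarrow> real"
    by (rule continuous_on_compose2[OF that cc]) (use cab in auto)
  have F: "mono F1" "mono F2" "continuous_on UNIV F1" "continuous_on UNIV F2"
  proof -
    have "F1 x \<le> F1 y \<and> F2 x \<le> F2 y" if "x \<le> y" for x y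
    proof -
      have "a \<le> c x" "c x \<le> c y" "c y \<le> b" using cab cm[OF that] by auto
      with incr[of "c x" "c y"] Gd[of "c x" "c y"] show ?thesis by (simp add: F1_def F2_def)
    qed
    then show "mono F1" "mono F2" by (auto intro!: monoI)
    show "continuous_on UNIV F1" unfolding F1_def by (rule comp[OF contH])
    show "continuous_on UNIV F2" unfolding F2_def by (intro continuous_intros comp contH contG)
  qed
  let ?w = "\<lambda>x. indicator {a..b} x * w x"
  let ?\<nu> = "density lborel (\<lambda>x. ennreal (?w x))"
  have w': "integrable lborel ?w" "\<And>x. ?w x \<ge> 0"
    using integrable_mult_indicator[OF _ w(1), of "{a..b}"] w(2) by auto
  have "interval_measure (\<lambda>x. F1 x + F2 x) = ?\<nu>"
  proof (rule measure_eqI_generator_eq[where E="range (\<lambda>(a, b). {a<..b::real})" and \<Omega>=UNIV and A="\<lambda>n. {- real n<..real n}"])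
    show "Int_stable (range (\<lambda>(a, b). {a<..b::real}))" by (force simp: Int_stable_def)
    have F12: "F1 x + F2 x = G (c x)" for x by (simp add: F1_def F2_def)
    have Gm: "G (c x) \<le> G (c y)" if "x \<le> y" for x y
      using Gd[of "c x" "c y"] cab cm[OF that] wi(2)[of "c x" "c y"] by auto
    have rc: "continuous (at_right x) (\<lambda>x. G (c x))" for x
      using comp[OF contG] by (auto simp: continuous_on_eq_continuous_at intro: continuous_at_imp_continuous_within)
    have Ioc: "emeasure (interval_measure (\<lambda>x. F1 x + F2 x)) {s<..t} = emeasure ?\<nu> {s<..t}" for s t
    proof (cases "s \<le> t")
      case True
      have "emeasure (interval_measure (\<lambda>x. F1 x + F2 x)) {s<..t} = ennreal (G (c t) - G (c s))"
        unfolding F12 using True Gm rc by (intro emeasure_interval_measure_Ioc) auto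
      also have "G (c t) - G (c s) = integral {c s..c t} w" using cab cm[OF True] by (intro Gd) auto
      also have "\<dots> = integral {s..t} ?w"
      proof -
        have "integral {s..t} ?w = integral {s..t} (\<lambda>x. if x \<in> {a..b} then w x else 0)"
          by (intro Henstock_Kurzweil_Integration.integral_cong) (auto simp: indicator_def)
        also have "\<dots> = integral ({s..t} \<inter> {a..b}) w" by (subst Int_commute) (rule Henstock_Kurzweil_Integration.integral_restrict_Int)
        also have "\<dots> = integral {c s..c t} w"
        proof (cases "{s..t} \<inter> {a..b} = {}")
          case True
          then have "c s = c t" using \<open>s \<le> t\<close> \<open>a \<le> b\<close> by (auto simp: c_def)
          then show ?thesis by (simp only: True) simp
        next
          case False
          then have "max s a \<le> min t b" by auto
          then have "c s = max s a" "c t = min t b" by (auto simp: c_def)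
          then have "{s..t} \<inter> {a..b} = {c s..c t}" by auto
          then show ?thesis by (simp only:)
        qed
        finally show ?thesis by simp
      qed
      also have "ennreal \<dots> = emeasure ?\<nu> {s<..t}"
        using integral_eq_emeasure_density[OF w'] by simp
      finally show ?thesis .
    qed simp
    then show "emeasure (interval_measure (\<lambda>x. F1 x + F2 x)) X = emeasure ?\<nu> X" if "X \<in> range (\<lambda>(a, b). {a<..b::real})" for X
      using that by auto
    show "(\<Union>i. {- real i<..real i}) = UNIV"
    proof (intro set_eqI iffI UNIV_I)
      fix x :: real 
      obtain n where "real n > \<bar>x\<bar>" using reals_Archimedean2 by blast
      then show "x \<in> (\<Union>i. {- real i<..real i})" by (intro UN_I[of n]) auto
    qed
    show "emeasure (interval_measure (\<lambda>x. F1 x + F2 x)) {- real i<..real i} \<noteq> \<infinity>" for i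
      using Ioc integral_eq_emeasure_density[OF w'] by simp
  qed (use sets_borel_Ioc in auto)
  then have \<nu>: "emeasure ?\<nu> A = emeasure (interval_measure F1) A + emeasure (interval_measure F2) A"
    if "A \<in> sets borel" for A using interval_measure_add[OF F that] by simp
  have "absolutely_continuous lborel (interval_measure F1)"
    unfolding absolutely_continuous_def
  proof
    fix A :: "real set" assume A: "A \<in> null_sets lborel"
    then have "A \<in> null_sets ?\<nu>" using w' by (subst null_sets_density_iff) (auto dest: AE_not_in elim: eventually_mono)
    then have "emeasure ?\<nu> A = 0" by (rule null_setsD1)
    moreover have "A \<in> sets borel" using A by auto
    ultimately have "emeasure (interval_measure F1) A = 0" using \<nu>[of A] by simp
    then show "A \<in> null_sets (interval_measure F1)" using A by (auto simp: null_sets_def)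
  qed
  then obtain \<phi> where \<phi>: "\<phi> \<in> borel_measurable lborel" "density lborel \<phi> = interval_measure F1"
    using sigma_finite_measure.Radon_Nikodym[OF lborel.sigma_finite_measure_axioms, of "interval_measure F1"]
    by auto
  have [measurable]: "\<phi> \<in> borel_measurable borel" using \<phi>(1) by simp
  have rcF1: "continuous (at_right x) F1" for x
    using F(3) by (auto simp: continuous_on_eq_continuous_at intro: continuous_at_imp_continuous_within)
  have I\<phi>: "(\<integral>\<^sup>+y. \<phi> y * indicator {a<..x} y \<partial>lborel) = ennreal (H x - H a)" if "x \<in> {a..b}" for x
  proof -
    have "(\<integral>\<^sup>+y. \<phi> y * indicator {a<..x} y \<partial>lborel) = emeasure (interval_measure F1) {a<..x}"
      unfolding \<phi>(2)[symmetric] by (subst emeasure_density) auto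
    also have "\<dots> = ennreal (F1 x - F1 a)"
      using that F rcF1 by (intro emeasure_interval_measure_Ioc) (auto dest: monoD)
    also have "F1 x - F1 a = H x - H a" using that by (simp add: F1_def c_def)
    finally show ?thesis .
  qed
  define \<psi> where "\<psi> y = enn2real (\<phi> y * indicator {a<..b} y)" for y
  have fin: "AE y in lborel. \<phi> y * indicator {a<..b} y \<noteq> \<infinity>"
    using I\<phi>[of b] \<open>a \<le> b\<close> by (intro nn_integral_PInf_AE) auto
  have \<psi>m[measurable]: "\<psi> \<in> borel_measurable borel" unfolding \<psi>_def by measurable
  have nn: "(\<integral>\<^sup>+y. ennreal (\<psi> y * indicator {a<..x} y) \<partial>lborel) = ennreal (H x - H a)" if "x \<in> {a..b}" for x
  proof -
    have "(\<integral>\<^sup>+y. ennreal (\<psi> y * indicator {a<..x} y) \<partial>lborel) = (\<integral>\<^sup>+y. \<phi> y * indicator {a<..x} y \<partial>lborel)"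
      by (rule nn_integral_cong_AE, use fin in eventually_elim)
         (use that in \<open>auto simp: \<psi>_def indicator_def top.not_eq_extremum split: if_splits\<close>)
    then show ?thesis using I\<phi>[OF that] by simp
  qed
  have int: "has_bochner_integral lborel (\<lambda>y. \<psi> y * indicator {a<..x} y) (H x - H a)" if "x \<in> {a..b}" for x
    using nn[OF that] incr[of a x] that by (intro has_bochner_integral_nn_integral) (auto simp: \<psi>_def)
  have \<psi>i: "integrable lborel \<psi>"
  proof -
    have "(\<lambda>y. \<psi> y * indicator {a<..b} y) = \<psi>" by (auto simp: \<psi>_def indicator_def)
    then show ?thesis using int[of b] \<open>a \<le> b\<close> by (simp add: has_bochner_integral_iff)
  qed
  show ?thesis
  proof (rule that)
    show "\<psi> absolutely_integrable_on {a..b}"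
      using integrable_mult_indicator[of "{a..b}" lebesgue \<psi>] \<psi>i integrable_completion[of \<psi> lborel]
      by (simp add: set_integrable_def)
    fix x assume x: "x \<in> {a..b}"
    have "integral {a..x} \<psi> = H x - H a"
    proof -
      have "set_integrable lborel {a<..x} \<psi>" 
        unfolding set_integrable_def using \<psi>i by (intro integrable_mult_indicator) auto
      then have "integral {a<..x} \<psi> = (LBINT y:{a<..x}. \<psi> y)" by (rule set_borel_integral_eq_integral(2)[symmetric])
      also have "\<dots> = H x - H a" using int[OF x] by (simp add: has_bochner_integral_iff set_lebesgue_integral_def mult.commute)
      also have "integral {a<..x} \<psi> = integral {a..x} \<psi>"
        by (rule integral_subset_negligible) (auto intro: negligible_subset[OF negligible_sing[of a]])
      finally show ?thesis .
    qed
    then show "H x = H a + integral {a..x} \<psi>" by simp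
  qed
qed

text \<open>
  Adding to \<open>F\<close> the indefinite integral of \<open>\<bar>g\<bar>\<close> makes it nondecreasing, with increments at most
  those of twice that integral; this reduces the claim to the monotone case.
\<close>

theorem dominated_increments_imp_integral:
  fixes F g :: "real \<Rightarrow> real"
  assumes "a \<le> b" and g: "g absolutely_integrable_on {a..b}"
    and incr: "\<And>x y. a \<le> x \<Longrightarrow> x \<le> y \<Longrightarrow> y \<le> b \<Longrightarrow> \<bar>F y - F x\<bar> \<le> integral {x..y} g"
  obtains v where "v absolutely_integrable_on {a..b}" "\<And>x. x \<in> {a..b} \<Longrightarrow> F x = F a + integral {a..x} v"
proof -
  obtain w where w: "integrable lborel w" "AE x in lebesgue. indicator {a..b} x * g x = w x"
    using lebesgue_integrable_borel_version[OF g] .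
  define u where "u x = \<bar>w x\<bar>" for x
  have u: "integrable lborel u" "\<And>x. u x \<ge> 0" using w(1) by (simp_all add: u_def[abs_def])
  have gu: "integral {x..y} g \<le> integral {x..y} u" if "a \<le> x" "y \<le> b" for x y
  proof -
    have "integral {x..y} g = integral {x..y} w" 
      using w(2) by (rule integral_borel_version) (use that in auto)
    also have "\<dots> \<le> integral {x..y} u"
    proof (rule integral_le)
      show "w integrable_on {x..y}"
        by (rule set_borel_integral_eq_integral(1))
           (unfold set_integrable_def, intro integrable_mult_indicator w, auto)
      show "u integrable_on {x..y}" by (rule nonneg_mono_integral[OF u])
    qed (simp add: u_def)
    finally show ?thesis .
  qed
  define G where "G x = integral {a..x} u" for x
  note ui = nonneg_mono_integral[OF u]
  have G: "G y - G x = integral {x..y} u" if "a \<le> x" "x \<le> y" for x y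
    unfolding G_def using that by (intro integral_diff_subinterval[OF ui(1)[of a y]]) auto
  have "integrable lborel (\<lambda>x. 2 * u x)" "\<And>x. 2 * u x \<ge> 0" using u by auto
  moreover have "0 \<le> (F y + G y) - (F x + G x) \<and> (F y + G y) - (F x + G x) \<le> integral {x..y} (\<lambda>x. 2 * u x)"
    if "a \<le> x" "x \<le> y" "y \<le> b" for x y
    using incr[OF that] gu[of x y] G[of x y] that by auto
  ultimately obtain \<psi> where \<psi>: "\<psi> absolutely_integrable_on {a..b}" 
    "\<And>x. x \<in> {a..b} \<Longrightarrow> F x + G x = F a + G a + integral {a..x} \<psi>"
    using \<open>a \<le> b\<close> by (elim monotone_dominated_increments_density[where H="\<lambda>x. F x + G x"]) auto
  have ua: "u absolutely_integrable_on {a..b}"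
    unfolding set_integrable_def
    using u integrable_completion[of u lborel] by (intro integrable_mult_indicator) auto
  show ?thesis
  proof (rule that)
    show "(\<lambda>x. \<psi> x - u x) absolutely_integrable_on {a..b}" using \<psi>(1) ua by (rule set_integral_diff(1))
    fix x assume x: "x \<in> {a..b}"
    have "\<psi> integrable_on {a..x}"
      using \<psi>(1) x by (auto dest!: set_lebesgue_integral_eq_integral(1) intro: integrable_on_subinterval)
    then have "integral {a..x} (\<lambda>x. \<psi> x - u x) = integral {a..x} \<psi> - integral {a..x} u"
      using ui by (intro Henstock_Kurzweil_Integration.integral_diff)
    then show "F x = F a + integral {a..x} (\<lambda>x. \<psi> x - u x)"
      using \<psi>(2)[OF x] x by (simp add: G_def)
  qed
qed

lemma integral_abs_cont_continuous:
  fixes v :: "real \<Rightarrow> real"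
  assumes "v absolutely_integrable_on {a..b}"
  shows "continuous_on {a..b} (\<lambda>x. integral {a..x} v)"
  using set_lebesgue_integral_eq_integral(1)[OF assms] by (rule indefinite_integral_continuous_1)

text \<open>
  The dominated increments make \<open>F\<close> uniformly continuous, so it extends to the closed interval
  with the same bound. The bound on the density comes from differentiating the bound on the
  increments at a point where both indefinite integrals are differentiable.
\<close>

theorem dominated_increments_imp_integral_open:
  fixes F g :: "real \<Rightarrow> real"
  assumes "a < b" and g: "g absolutely_integrable_on {a..b}"
    and incr: "\<And>x y. a < x \<Longrightarrow> x \<le> y \<Longrightarrow> y < b \<Longrightarrow> \<bar>F y - F x\<bar> \<le> integral {x..y} g"
  obtains c v where "v absolutely_integrable_on {a..b}" "\<And>x. x \<in> {a<..<b} \<Longrightarrow> F x = c + integral {a..x} v"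
    "AE x in lebesgue_on {a<..<b}. \<bar>v x\<bar> \<le> g x"
proof -
  define G where "G x = integral {a..x} g" for x
  have gi: "g integrable_on {a..b}" using g by (rule set_lebesgue_integral_eq_integral(1))
  have G: "G y - G x = integral {x..y} g" if "a \<le> x" "x \<le> y" "y \<le> b" for x y
    unfolding G_def using that by (intro integral_diff_subinterval[OF gi]) auto
  have contG: "continuous_on {a..b} G" unfolding G_def by (rule integral_abs_cont_continuous[OF g])
  have FG: "\<bar>F y - F x\<bar> \<le> \<bar>G y - G x\<bar>" if "x \<in> {a<..<b}" "y \<in> {a<..<b}" for x y
    using incr[of x y] incr[of y x] G[of x y] G[of y x] that by (cases "x \<le> y") auto
  have "uniformly_continuous_on {a..b} G" using contG by (rule compact_uniformly_continuous) simp
  then have "uniformly_continuous_on {a<..<b} F"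
    unfolding uniformly_continuous_on_def
  proof (intro allI impI)
    fix e :: real
    assume U: "\<forall>e>0. \<exists>d>0. \<forall>x\<in>{a..b}. \<forall>x'\<in>{a..b}. dist x' x < d \<longrightarrow> dist (G x') (G x) < e" and "e > 0"
    then obtain d where d: "d > 0" "\<And>x x'. x \<in> {a..b} \<Longrightarrow> x' \<in> {a..b} \<Longrightarrow> dist x' x < d \<Longrightarrow> dist (G x') (G x) < e"
      by blast
    have "dist (F x') (F x) < e" if "x \<in> {a<..<b}" "x' \<in> {a<..<b}" "dist x' x < d" for x x'
      using FG[OF that(1,2)] d(2)[of x x'] that unfolding dist_real_def by simp
    with d(1) show "\<exists>d>0. \<forall>x\<in>{a<..<b}. \<forall>x'\<in>{a<..<b}. dist x' x < d \<longrightarrow> dist (F x') (F x) < e" by blast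
  qed
  then obtain E where E: "uniformly_continuous_on (closure {a<..<b}) E"
     "\<And>x. x \<in> {a<..<b} \<Longrightarrow> F x = E x"
    by (rule uniformly_continuous_on_extension_on_closure) (rule that, auto)
  have contE: "continuous_on {a..b} E"
    using uniformly_continuous_imp_continuous[OF E(1)] \<open>a < b\<close> by simp
  have "\<bar>E y - E x\<bar> \<le> integral {x..y} g" if xy: "a \<le> x" "x \<le> y" "y \<le> b" for x y
  proof -
    (* Moving both points towards the midpoint brings them into the open interval,
       where the bound holds; continuity gives the limit s = 0. *)
    define m where "m = (a + b) / 2"
    define p where "p z s = z + s * (m - z)" for z s :: real
    have pin: "p z s \<in> {a<..<b}" if "z \<in> {a..b}" "0 < s" "s < 1" for z s
    proof -
      have "p z s - a = (1 - s) * (z - a) + s * (m - a)" "b - p z s = (1 - s) * (b - z) + s * (b - m)"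
        by (auto simp: p_def algebra_simps)
      moreover have "s * (m - a) > 0" "s * (b - m) > 0" using that \<open>a < b\<close> by (auto simp: m_def)
      moreover have "(1 - s) * (z - a) \<ge> 0" "(1 - s) * (b - z) \<ge> 0" using that by auto
      ultimately show ?thesis by (simp add: algebra_simps)
    qed
    have lim: "((\<lambda>s. h (p z s)) \<longlongrightarrow> h z) (at_right 0)" if "continuous_on {a..b} h" "z \<in> {a..b}" for h :: "real \<Rightarrow> real" and z
    proof (rule continuous_on_tendsto_compose[OF that(1) _ that(2)])
      have "((\<lambda>s. z + s * (m - z)) \<longlongrightarrow> z + 0 * (m - z)) (at_right 0)" by (intro tendsto_intros)
      then show "(p z \<longlongrightarrow> z) (at_right 0)" by (simp add: p_def[abs_def])
      show "\<forall>\<^sub>F s in at_right 0. p z s \<in> {a..b}"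
        using pin[OF that(2)] by (intro eventually_at_right_less[THEN eventually_mono] eventually_at_rightI[of 0 1]) (auto simp: less_imp_le)
    qed
    have "\<bar>E y - E x\<bar> \<le> G y - G x"
    proof (rule tendsto_le)
      show "((\<lambda>s. G (p y s) - G (p x s)) \<longlongrightarrow> G y - G x) (at_right 0)"
        using xy by (intro tendsto_intros lim contG) auto
      show "((\<lambda>s. \<bar>E (p y s) - E (p x s)\<bar>) \<longlongrightarrow> \<bar>E y - E x\<bar>) (at_right 0)"
        using xy by (intro tendsto_intros lim contE) auto
      show "\<forall>\<^sub>F s in at_right 0. \<bar>E (p y s) - E (p x s)\<bar> \<le> G (p y s) - G (p x s)"
      proof (rule eventually_at_rightI[of 0 1])
        fix s :: real assume "s \<in> {0<..<1}"
        then have "p x s \<in> {a<..<b}" "p y s \<in> {a<..<b}" using xy pin[of x s] pin[of y s] by auto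
        moreover have "p x s \<le> p y s"
        proof -
          have "p y s - p x s = (1 - s) * (y - x)" by (simp add: p_def algebra_simps)
          also have "\<dots> \<ge> 0" using \<open>s \<in> _\<close> xy by simp
          finally show ?thesis by simp
        qed
        ultimately show "\<bar>E (p y s) - E (p x s)\<bar> \<le> G (p y s) - G (p x s)"
          using incr[of "p x s" "p y s"] G[of "p x s" "p y s"] E(2) by auto
      qed simp
    qed simp
    with G[OF xy] show ?thesis by simp
  qed
  then obtain v where v: "v absolutely_integrable_on {a..b}" "\<And>x. x \<in> {a..b} \<Longrightarrow> E x = E a + integral {a..x} v"
    using dominated_increments_imp_integral[OF less_imp_le[OF \<open>a < b\<close>] g, of E] by blast
  define V where "V x = integral {a..x} v" for x
  have Fv: "F x = E a + V x" if "x \<in> {a<..<b}" for x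
    using E(2)[OF that] v(2)[of x] that by (simp add: V_def)
  have "AE x in lebesgue_on {a<..<b}. \<bar>v x\<bar> \<le> g x"
    using lebesgue_differentiation[OF v(1)] lebesgue_differentiation[OF g] AE_space
  proof eventually_elim
    case (elim x)
    then have x: "x \<in> {a<..<b}" and V': "(V has_field_derivative v x) (at x)" and G': "(G has_field_derivative g x) (at x)"
      by (auto simp: V_def[abs_def] G_def[abs_def])
    show ?case
    proof (rule tendsto_le)
      show "((\<lambda>y. (G y - G x) / (y - x)) \<longlongrightarrow> g x) (at x)" using G' by (simp add: has_field_derivative_iff)
      show "((\<lambda>y. \<bar>(V y - V x) / (y - x)\<bar>) \<longlongrightarrow> \<bar>v x\<bar>) (at x)"
        using V' by (intro tendsto_intros) (simp add: has_field_derivative_iff)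
      have "\<forall>\<^sub>F y in at x. y \<in> {a<..<b}" using x by (intro eventually_at_in_open') auto
      moreover have "\<forall>\<^sub>F y in at x. y \<noteq> x" by (simp add: eventually_at_filter)
      ultimately show "\<forall>\<^sub>F y in at x. \<bar>(V y - V x) / (y - x)\<bar> \<le> (G y - G x) / (y - x)"
      proof eventually_elim
        case (elim y)
        have "\<bar>V y - V x\<bar> = \<bar>F y - F x\<bar>" using Fv[OF x] Fv[of y] elim by simp
        also have "\<dots> \<le> (if x < y then G y - G x else G x - G y)"
          using incr[of x y] incr[of y x] G[of x y] G[of y x] x elim by auto
        finally have *: "\<bar>V y - V x\<bar> \<le> (if x < y then G y - G x else G x - G y)" .
        show ?case
        proof (cases "x < y")
          case True
          then show ?thesis using * by (simp add: divide_right_mono)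
        next
          case False
          then have "y < x" using elim by auto
          then have "\<bar>(V y - V x) / (y - x)\<bar> \<le> (G x - G y) / (x - y)"
            using * by (simp add: divide_right_mono)
          also have "\<dots> = (G y - G x) / (y - x)" by (metis minus_diff_eq minus_divide_divide)
          finally show ?thesis .
        qed
      qed
    qed simp
  qed
  with that[OF v(1), of "E a"] Fv show ?thesis by (simp add: V_def)
qed

section \<open>Smooth functions with compact support\<close>

text \<open>
  For \<open>p = 1\<close> and \<open>m = 0\<close> this is the standard smooth function supported on \<open>[s, t]\<close>. With the
  factors \<open>p\<close> and \<open>m\<close> the family is closed under differentiation, which is how smoothness is proved.
\<close>

definition bump :: "real \<Rightarrow> real \<Rightarrow> real \<Rightarrow> real poly \<Rightarrow> nat \<Rightarrow> real \<Rightarrow> real" where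
  "bump c s t p m x =
     (if s < x \<and> x < t
      then poly p x * inverse ((x - s) * (t - x)) ^ m * exp (- c * inverse ((x - s) * (t - x))) else 0)"

lemma exp_minus_inverse_le_power:
  fixes c :: real
  assumes "c > 0"
  obtains C where "\<And>y. y > 0 \<Longrightarrow> exp (- c * inverse y) \<le> C * y ^ k"
proof (cases "k = 0")
  case True
  then show ?thesis using assms by (intro that[of 1]) auto
next
  case False
  have "exp (- c * inverse y) \<le> (real k / c) ^ k * y ^ k" if "y > 0" for y
  proof -
    have pos: "c * inverse y > 0" using assms that by simp
    have "0 \<le> c * inverse y / real k" using pos by (intro divide_nonneg_nonneg) auto
    then have "(c * inverse y / real k) ^ k \<le> (1 + c * inverse y / real k) ^ k"
      by (intro power_mono) auto
    also have "\<dots> \<le> exp (c * inverse y)"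
      using pos False by (intro exp_ge_one_plus_x_over_n_power_n) (auto intro: order_trans[of _ 0])
    finally have "inverse (exp (c * inverse y)) \<le> inverse ((c * inverse y / real k) ^ k)"
      using pos False by (intro le_imp_inverse_le) auto
    also have "\<dots> = inverse (c * inverse y / real k) ^ k" by (rule power_inverse[symmetric])
    also have "inverse (c * inverse y / real k) = real k / c * y"
      using that assms False by (simp add: field_simps)
    also have "(real k / c * y) ^ k = (real k / c) ^ k * y ^ k" by (rule power_mult_distrib)
    finally show ?thesis by (simp add: exp_minus)
  qed
  then show ?thesis by (rule that)
qed

text \<open>
  The exponential factor decays faster than any power of \<open>(x - s) * (t - x)\<close>. Second order
  vanishing at the end points is what makes the derivative there exist and be zero.
\<close>

lemma bump_flat:
  assumes "c > 0"
  obtains C where "\<And>x. \<bar>bump c s t p m x\<bar> \<le> C * (x - s)\<^sup>2" "\<And>x. \<bar>bump c s t p m x\<bar> \<le> C * (x - t)\<^sup>2"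
proof -
  obtain C0 where C0: "\<And>y. y > 0 \<Longrightarrow> exp (- c * inverse y) \<le> C0 * y ^ (m + 2)"
    using exp_minus_inverse_le_power[OF assms] by blast
  have "bounded (poly p ` {s..t})"
    by (intro compact_imp_bounded compact_continuous_image continuous_intros) auto
  then obtain P where "\<forall>x\<in>{s..t}. \<bar>poly p x\<bar> \<le> P" by (auto simp: bounded_iff)
  then have P: "\<And>x. x \<in> {s..t} \<Longrightarrow> \<bar>poly p x\<bar> \<le> P" by blast
  have C0_pos: "C0 \<ge> 0" using order_trans[OF exp_ge_zero C0[of 1]] by simp
  have main: "\<bar>bump c s t p m x\<bar> \<le> P * C0 * ((x - s) * (t - x))\<^sup>2 \<and> P \<ge> 0" if "s < x" "x < t" for x
  proof -
    define g where "g = (x - s) * (t - x)"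
    have g: "g > 0" using that by (simp add: g_def)
    have "\<bar>bump c s t p m x\<bar> = \<bar>poly p x\<bar> * (inverse g ^ m * exp (- c * inverse g))"
      using that g by (simp add: bump_def g_def[symmetric] abs_mult)
    also have "\<dots> \<le> P * (inverse g ^ m * (C0 * g ^ (m + 2)))"
      using P[of x] that g C0[OF g] by (intro mult_mono) auto
    also have "\<dots> = P * C0 * g\<^sup>2 * (inverse g * g) ^ m" by (simp only: power_add power_mult_distrib mult_ac)
    also have "\<dots> = P * C0 * g\<^sup>2" using g by simp
    finally show ?thesis using P[of x] that by (auto simp: g_def)
  qed
  define D where "D = \<bar>P\<bar> * C0 * (t - s)\<^sup>2"
  have D0: "D \<ge> 0" using C0_pos by (simp add: D_def)
  have "\<bar>bump c s t p m x\<bar> \<le> D * (x - s)\<^sup>2 \<and> \<bar>bump c s t p m x\<bar> \<le> D * (x - t)\<^sup>2" for x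
  proof (cases "s < x \<and> x < t")
    case True
    have *: "((x - s) * (t - x))\<^sup>2 \<le> (t - s)\<^sup>2 * (x - s)\<^sup>2" "((x - s) * (t - x))\<^sup>2 \<le> (t - s)\<^sup>2 * (x - t)\<^sup>2"
    proof -
      have "(x - s) * (t - x) \<le> (t - s) * (x - s)"
        using True mult_right_mono[of "t - x" "t - s" "x - s"] by (simp add: mult.commute)
      then have "((x - s) * (t - x))\<^sup>2 \<le> ((t - s) * (x - s))\<^sup>2" using True by (intro power_mono) auto
      then show "((x - s) * (t - x))\<^sup>2 \<le> (t - s)\<^sup>2 * (x - s)\<^sup>2" by (simp only: power_mult_distrib)
      have "(x - s) * (t - x) \<le> (t - s) * (t - x)"
        using True by (intro mult_right_mono) auto
      then have "((x - s) * (t - x))\<^sup>2 \<le> ((t - s) * (t - x))\<^sup>2" using True by (intro power_mono) auto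
      then show "((x - s) * (t - x))\<^sup>2 \<le> (t - s)\<^sup>2 * (x - t)\<^sup>2"
        by (simp only: power_mult_distrib power2_commute[of x t])
    qed
    have "P \<ge> 0" using main True by blast
    then have "P * C0 \<ge> 0" using C0_pos by simp
    then show ?thesis
      using main[of x] True * mult_left_mono[OF *(1), of "P * C0"] mult_left_mono[OF *(2), of "P * C0"] \<open>P \<ge> 0\<close>
      by (auto simp: D_def mult.assoc)
  qed (use D0 in \<open>auto simp: bump_def\<close>)
  then show ?thesis using that by blast
qed

lemma has_derivative_0_if_quadratic:
  fixes f :: "real \<Rightarrow> real"
  assumes "\<And>y. \<bar>f y\<bar> \<le> C * (y - x)\<^sup>2"
  shows "(f has_field_derivative 0) (at x)"
proof -
  have fx: "f x = 0" using assms[of x] by simp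
  have "((\<lambda>y. (f y - f x) / (y - x)) \<longlongrightarrow> 0) (at x)"
  proof (rule Lim_null_comparison)
    show "((\<lambda>y. \<bar>C\<bar> * \<bar>y - x\<bar>) \<longlongrightarrow> 0) (at x)" by (auto intro!: tendsto_eq_intros)
    show "\<forall>\<^sub>F y in at x. norm ((f y - f x) / (y - x)) \<le> \<bar>C\<bar> * \<bar>y - x\<bar>"
    proof (rule eventually_at_filter[THEN iffD2], rule always_eventually, intro allI impI)
      fix y assume "y \<noteq> x"
      have "\<bar>f y\<bar> \<le> \<bar>C\<bar> * (y - x)\<^sup>2" 
        using assms[of y] by (rule order_trans) (auto intro: mult_right_mono)
      then have "\<bar>f y\<bar> \<le> \<bar>C\<bar> * \<bar>y - x\<bar> * \<bar>y - x\<bar>" by (simp add: power2_eq_square mult.assoc)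
      then show "norm ((f y - f x) / (y - x)) \<le> \<bar>C\<bar> * \<bar>y - x\<bar>"
        using \<open>y \<noteq> x\<close> fx by (simp add: abs_divide pos_divide_le_eq)
    qed
  qed
  then show ?thesis by (simp add: has_field_derivative_iff)
qed

lemma bump_has_derivative:
  fixes c s t :: real
  assumes "c > 0"
  defines "g \<equiv> [:-s, 1:] * [:t, -1:]"
  shows "(bump c s t p m has_field_derivative
     bump c s t (pderiv p * g ^ 2 - smult (of_nat m) (p * pderiv g * g) + smult c (p * pderiv g)) (m + 2) x) (at x)"
    (is "(_ has_field_derivative bump c s t ?q _ x) _")
proof -
  obtain C where C: "\<And>x. \<bar>bump c s t p m x\<bar> \<le> C * (x - s)\<^sup>2" "\<And>x. \<bar>bump c s t p m x\<bar> \<le> C * (x - t)\<^sup>2"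
    using bump_flat[OF assms(1)] by blast
  have ev: "(bump c s t p m has_field_derivative D) (at x)"
    if "((\<lambda>y. f y) has_field_derivative D) (at x)" "open S" "x \<in> S" "\<And>y. y \<in> S \<Longrightarrow> f y = bump c s t p m y" for f D S
    using has_field_derivative_transform_within_open[OF that] .
  consider "x < s" | "x > t" | "x = s" | "x = t" | "s < x" "x < t" by linarith
  then show ?thesis
  proof cases
    case 1
    then show ?thesis by (intro ev[of "\<lambda>_. 0" _ "{..<s}"]) (auto simp: bump_def)
  next
    case 2
    then show ?thesis by (intro ev[of "\<lambda>_. 0" _ "{t<..}"]) (auto simp: bump_def)
  next
    case 3
    have z: "bump c s t ?q (m + 2) s = 0" by (simp add: bump_def)
    show ?thesis unfolding 3 z by (rule has_derivative_0_if_quadratic[OF C(1)])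
  next
    case 4
    have z: "bump c s t ?q (m + 2) t = 0" by (simp add: bump_def)
    show ?thesis unfolding 4 z by (rule has_derivative_0_if_quadratic[OF C(2)])
  next
    case 5
    have gy: "poly g y = (y - s) * (t - y)" for y by (simp add: g_def algebra_simps)
    define u where "u = inverse (poly g x)"
    have g0: "poly g x \<noteq> 0" using 5 by (simp add: gy)
    define G G' where "G = poly g x" and "G' = poly (pderiv g) x"
    have uG: "u * G = 1" using g0 by (simp add: u_def G_def)
    have um1: "u ^ (m + 2) * G\<^sup>2 = u ^ m"
    proof -
      have "u ^ (m + 2) * G\<^sup>2 = u ^ m * (u * G)\<^sup>2" by (simp only: power_add power_mult_distrib mult.assoc)
      then show ?thesis using uG by simp
    qed
    have um2: "u ^ (m + 2) * G = u ^ (m + 1)"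
    proof -
      have "u ^ (m + 2) * G = u ^ (m + 1) * (u * G)" by simp
      then show ?thesis using uG by simp
    qed
    have um3: "of_nat m * u ^ (m - 1) * u\<^sup>2 = of_nat m * u ^ (m + 1)"
      by (cases m) (simp_all add: power2_eq_square)
    let ?e = "exp (- c * u)"
    have Du: "((\<lambda>y. inverse (poly g y)) has_field_derivative - (u * G' * u)) (at x)"
      unfolding u_def G'_def by (rule DERIV_inverse'[OF poly_DERIV g0])
    have Dm: "((\<lambda>y. inverse (poly g y) ^ m) has_field_derivative of_nat m * (- (u * G' * u) * u ^ (m - Suc 0))) (at x)"
      unfolding u_def by (rule DERIV_power) (rule Du[unfolded u_def])
    have De: "((\<lambda>y. exp (- c * inverse (poly g y))) has_field_derivative ?e * (- c * - (u * G' * u))) (at x)"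
      unfolding u_def by (intro DERIV_fun_exp DERIV_cmult) (rule Du[unfolded u_def])
    have "((\<lambda>y. poly p y * inverse (poly g y) ^ m * exp (- c * inverse (poly g y))) has_field_derivative
       (poly (pderiv p) x * u ^ m + of_nat m * (- (u * G' * u) * u ^ (m - Suc 0)) * poly p x) * ?e
        + ?e * (- c * - (u * G' * u)) * (poly p x * u ^ m)) (at x)"
      using DERIV_mult[OF DERIV_mult[OF poly_DERIV[of p x] Dm] De] unfolding u_def[symmetric] .
    also have "(poly (pderiv p) x * u ^ m + of_nat m * (- (u * G' * u) * u ^ (m - Suc 0)) * poly p x) * ?e
        + ?e * (- c * - (u * G' * u)) * (poly p x * u ^ m)
        = (poly (pderiv p) x * u ^ m - poly p x * G' * (of_nat m * u ^ (m - 1) * u\<^sup>2)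
           + c * poly p x * G' * u ^ (m + 2)) * ?e"
      by (simp add: algebra_simps power2_eq_square power_add)
    also have "\<dots> = poly ?q x * u ^ (m + 2) * ?e"
      unfolding um3 um1[symmetric] um2[symmetric] by (simp add: algebra_simps G_def G'_def)
    also have "\<dots> = bump c s t ?q (m + 2) x" using 5 by (simp add: bump_def u_def gy)
    finally show ?thesis
      by (rule ev[of _ _ "{s<..<t}"]) (use 5 in \<open>auto simp: bump_def gy\<close>)
  qed
qed

lemma higher_deriv_bump:
  assumes "c > 0"
  obtains p' m' where "(deriv ^^ k) (bump c s t p m) = bump c s t p' m'"
proof -
  have "\<exists>p' m'. (deriv ^^ k) (bump c s t p m) = bump c s t p' m'"
  proof (induction k)
    case (Suc k)
    then obtain p' m' where *: "(deriv ^^ k) (bump c s t p m) = bump c s t p' m'" by blast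
    obtain r where "\<And>x. (bump c s t p' m' has_field_derivative bump c s t r (m' + 2) x) (at x)"
      using bump_has_derivative[OF assms] by blast
    then have "deriv (bump c s t p' m') = bump c s t r (m' + 2)"
      by (intro ext DERIV_imp_deriv)
    then have "(deriv ^^ Suc k) (bump c s t p m) = bump c s t r (m' + 2)" by (simp add: *)
    then show ?case by blast
  qed auto
  then show ?thesis using that by blast
qed

lemma bump_smooth: "c > 0 \<Longrightarrow> ((deriv ^^ k) (bump c s t p m)) field_differentiable (at x)"
proof -
  assume c: "c > 0"
  obtain p' m' where "(deriv ^^ k) (bump c s t p m) = bump c s t p' m'" using higher_deriv_bump[OF c] .
  then show ?thesis unfolding field_differentiable_def using bump_has_derivative[OF c] by metis
qed

lemma bump_shift: "bump c s t 1 0 (x - \<delta>) = bump c (s + \<delta>) (t + \<delta>) 1 0 x"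
  by (auto simp: bump_def algebra_simps)


lemma smooth_diff:
  fixes f g :: "real \<Rightarrow> real"
  assumes "\<And>k x. ((deriv ^^ k) f) field_differentiable (at x)" "\<And>k x. ((deriv ^^ k) g) field_differentiable (at x)"
  shows "((deriv ^^ k) (\<lambda>x. f x - g x)) field_differentiable (at x)"
proof -
  have "(deriv ^^ k) (\<lambda>x. f x - g x) = (\<lambda>x. (deriv ^^ k) f x - (deriv ^^ k) g x)"
  proof (induction k)
    case (Suc k)
    have "(deriv ^^ Suc k) (\<lambda>x. f x - g x) = deriv (\<lambda>x. (deriv ^^ k) f x - (deriv ^^ k) g x)" by (simp add: Suc)
    also have "\<dots> = (\<lambda>x. deriv ((deriv ^^ k) f) x - deriv ((deriv ^^ k) g) x)"
      by (rule ext) (rule deriv_diff[OF assms])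
    finally show ?case by simp
  qed simp
  then show ?thesis using assms by (auto intro: field_differentiable_diff)
qed

text \<open>
  A bump and its translate have the same integral, so their difference has an antiderivative of
  compact support. For \<open>c\<close> tending to 0 the derivative of this test function approximates the
  difference of the indicator functions of an interval and of its translate.
\<close>

lemma bump_difference_test_function:
  assumes "c > 0" "a < s" "s < t" "0 \<le> \<delta>" "t + \<delta> < b"
  obtains \<phi> where "test_function {a<..<b} \<phi>" 
    "deriv \<phi> = (\<lambda>x. bump c s t 1 0 x - bump c (s + \<delta>) (t + \<delta>) 1 0 x)"
proof -
  let ?b = "bump c s t 1 0"
  have cont: "isCont ?b x" for x using bump_has_derivative[OF assms(1)] DERIV_isCont by blast
  obtain B where "\<forall>x. (B has_vector_derivative ?b x) (at x)"
    using einterval_antiderivative[of "-\<infinity>" "\<infinity>" ?b] cont by auto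
  then have B: "(B has_field_derivative ?b x) (at x)" for x
    by (simp add: has_real_derivative_iff_has_vector_derivative)
  have Bs: "B x = B s" if "x \<le> s" for x
  proof (cases "x = s")
    case False
    then have "x < s" using that by simp
    then show ?thesis
    proof (rule DERIV_isconst_end[symmetric])
      show "(B has_real_derivative 0) (at y)" if "x < y" "y < s" for y
        using B[of y] that by (simp add: bump_def)
    qed (intro continuous_at_imp_continuous_on ballI DERIV_isCont[OF B])
  qed simp
  have Bt: "B x = B t" if "x \<ge> t" for x
  proof (cases "x = t")
    case False
    then have "t < x" using that by simp
    then show ?thesis
    proof (rule DERIV_isconst_end)
      show "(B has_real_derivative 0) (at y)" if "t < y" "y < x" for y
        using B[of y] that by (simp add: bump_def)
    qed (intro continuous_at_imp_continuous_on ballI DERIV_isCont[OF B])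
  qed simp
  define \<phi> where "\<phi> x = B x - B (x - \<delta>)" for x
  define b' where "b' = (\<lambda>x. ?b x - bump c (s + \<delta>) (t + \<delta>) 1 0 x)"
  have D: "(\<phi> has_field_derivative b' x) (at x)" for x
  proof -
    have "((\<lambda>x. B (x - \<delta>)) has_field_derivative ?b (x - \<delta>)) (at x)"
      using DERIV_shift[of B "?b (x - \<delta>)" x "- \<delta>"] B by simp
    then show ?thesis unfolding \<phi>_def[abs_def] b'_def bump_shift[symmetric] by (intro derivative_intros B)
  qed
  have d: "deriv \<phi> = b'" using D by (intro ext DERIV_imp_deriv)
  have "test_function {a<..<b} \<phi>" unfolding test_function_def
  proof (intro conjI allI)
    show "(deriv ^^ k) \<phi> field_differentiable at x" for k x
    proof (cases k)
      case 0
      then show ?thesis using D by (auto simp: field_differentiable_def)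
    next
      case (Suc j)
      then have *: "(deriv ^^ k) \<phi> = (deriv ^^ j) b'" by (simp only: funpow_Suc_right o_apply d)
      show ?thesis unfolding * b'_def by (rule smooth_diff; rule bump_smooth[OF assms(1)])
    qed
    show "\<exists>K. compact K \<and> K \<subseteq> {a<..<b} \<and> (\<forall>x. x \<notin> K \<longrightarrow> \<phi> x = 0)"
    proof (intro exI[of _ "{s..t + \<delta>}"] conjI allI impI)
      fix x assume "x \<notin> {s..t + \<delta>}"
      then consider "x < s" | "x > t + \<delta>" by fastforce
      then show "\<phi> x = 0"
      proof cases
        case 1
        then show ?thesis using Bs[of x] Bs[of "x - \<delta>"] assms by (simp add: \<phi>_def)
      next
        case 2
        then show ?thesis using Bt[of x] Bt[of "x - \<delta>"] assms by (simp add: \<phi>_def)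
      qed
    qed (use assms in auto)
  qed
  with that d show ?thesis by (simp add: b'_def)
qed

lemma bump_tendsto_indicator:
  "(\<lambda>n. bump (1 / real (Suc n)) s t 1 0 x) \<longlonglongrightarrow> indicator {s<..<t} x"
proof (cases "s < x \<and> x < t")
  case True
  define y where "y = inverse ((x - s) * (t - x))"
  have "(\<lambda>n. exp (- (1 / real (Suc n)) * y)) \<longlonglongrightarrow> exp (- 0 * y)"
    using LIMSEQ_Suc[OF lim_1_over_n] by (intro tendsto_intros)
  then show ?thesis using True by (simp add: bump_def y_def indicator_def)
qed (auto simp: bump_def indicator_def)

lemma bump_le_1: "c > 0 \<Longrightarrow> \<bar>bump c s t 1 0 x\<bar> \<le> 1"
  by (auto simp: bump_def)

section \<open>Weak derivatives on an interval\<close>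

lemma integrable_lebesgue_on_Ioo_iff:
  fixes f :: "real \<Rightarrow> 'a::euclidean_space"
  shows "integrable (lebesgue_on {a<..<b}) f \<longleftrightarrow> f absolutely_integrable_on {a..b}"
  unfolding absolutely_integrable_on_Icc_iff_Ioo by (simp add: integrable_restrict_space set_integrable_def)

lemma LINT_lebesgue_on_Ioo:
  fixes f :: "real \<Rightarrow> real"
  assumes "f absolutely_integrable_on {a..b}"
  shows "(LINT x|lebesgue_on {a<..<b}. f x) = integral {a..b} f"
  using assms by (simp add: lebesgue_integral_eq_integral integrable_lebesgue_on_Ioo_iff integral_open_interval_real)

lemma integrable_bounded_mult:
  fixes h :: "real \<Rightarrow> real" and v :: "real \<Rightarrow> 'a::euclidean_space"
  assumes "integrable (lebesgue_on S) v" "h \<in> borel_measurable (lebesgue_on S)" "\<And>x. x \<in> S \<Longrightarrow> \<bar>h x\<bar> \<le> B"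
    "S \<in> sets lebesgue"
  shows "integrable (lebesgue_on S) (\<lambda>x. h x *\<^sub>R v x)"
proof (rule Bochner_Integration.integrable_bound)
  show "integrable (lebesgue_on S) (\<lambda>x. B *\<^sub>R v x)" using assms by simp
  show "(\<lambda>x. h x *\<^sub>R v x) \<in> borel_measurable (lebesgue_on S)" using assms by (auto intro: borel_measurable_scaleR)
  show "AE x in lebesgue_on S. norm (h x *\<^sub>R v x) \<le> norm (B *\<^sub>R v x)"
  proof (rule AE_I2)
    fix x assume "x \<in> space (lebesgue_on S)"
    then have "\<bar>h x\<bar> \<le> \<bar>B\<bar>" using assms(3)[of x] by (simp add: space_restrict_space)
    then show "norm (h x *\<^sub>R v x) \<le> norm (B *\<^sub>R v x)" by (simp add: mult_right_mono)
  qed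
qed

text \<open>
  Test \<open>w\<close> against the functions of \<open>bump_difference_test_function\<close> and let \<open>c\<close> tend to 0.
\<close>

lemma integral_translate_eq_if_weak_deriv_0:
  assumes w: "integrable (lebesgue_on {a<..<b}) w"
    and 0: "\<And>\<phi>. test_function {a<..<b} \<phi> \<Longrightarrow> (LINT x|lebesgue_on {a<..<b}. deriv \<phi> x * w x) = 0"
    and st: "a < s" "s < t" "0 \<le> \<delta>" "t + \<delta> < b"
  shows "integral {s..t} w = integral {s + \<delta>..t + \<delta>} w"
proof -
  let ?M = "lebesgue_on {a<..<b}"
  let ?i = "\<lambda>x. indicat_real {s<..<t} x - indicat_real {s + \<delta><..<t + \<delta>} x"
  let ?B = "\<lambda>n x. bump (1 / real (Suc n)) s t 1 0 x - bump (1 / real (Suc n)) (s + \<delta>) (t + \<delta>) 1 0 x"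
  have meas: "bump c s t p m \<in> borel_measurable ?M" if "c > 0" for c s t p m
    by (intro continuous_imp_measurable_on_sets_lebesgue continuous_at_imp_continuous_on ballI DERIV_isCont[OF bump_has_derivative] that) auto
  have wm: "w \<in> borel_measurable ?M" using w by auto
  have lim: "(\<lambda>n. LINT x|?M. ?B n x * w x) \<longlonglongrightarrow> (LINT x|?M. ?i x * w x)"
  proof (rule integral_dominated_convergence[where w="\<lambda>x. 2 * \<bar>w x\<bar>"])
    show "AE x in ?M. (\<lambda>n. ?B n x * w x) \<longlonglongrightarrow> ?i x * w x"
      by (intro AE_I2 tendsto_intros bump_tendsto_indicator)
    show "AE x in ?M. norm (?B n x * w x) \<le> 2 * \<bar>w x\<bar>" for n
    proof (rule AE_I2)
      fix x
      have "\<bar>?B n x\<bar> \<le> 2" using bump_le_1[of "1 / real (Suc n)" s t x] bump_le_1[of "1 / real (Suc n)" "s + \<delta>" "t + \<delta>" x]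
        by simp
      then show "norm (?B n x * w x) \<le> 2 * \<bar>w x\<bar>" by (simp add: abs_mult mult_right_mono del: of_nat_Suc)
    qed
    show "(\<lambda>x. ?B n x * w x) \<in> borel_measurable ?M" for n
      by (intro borel_measurable_times borel_measurable_diff meas wm) auto
    show "(\<lambda>x. ?i x * w x) \<in> borel_measurable ?M"
      by (intro borel_measurable_times borel_measurable_diff wm measurable_restrict_space1 borel_measurable_indicator) auto
    show "integrable ?M (\<lambda>x. 2 * \<bar>w x\<bar>)" using w by simp
  qed
  have "(LINT x|?M. ?B n x * w x) = 0" for n
  proof -
    obtain \<phi> where "test_function {a<..<b} \<phi>" "deriv \<phi> = ?B n"
      using bump_difference_test_function[of "1 / real (Suc n)" a s t \<delta> b] st by (auto simp del: of_nat_Suc)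
    then show ?thesis using 0[of \<phi>] by simp
  qed
  with lim have z: "(LINT x|?M. ?i x * w x) = 0" by (simp add: LIMSEQ_const_iff)
  have I: "integrable ?M (\<lambda>x. indicat_real {p<..<q} x * w x) \<and> (LINT x|?M. indicat_real {p<..<q} x * w x) = integral {p..q} w"
    if "a < p" "q < b" for p q
  proof -
    have eq: "(\<lambda>x. indicat_real {a<..<b} x * (indicat_real {p<..<q} x * w x)) = (\<lambda>x. indicat_real {p<..<q} x * w x)"
      using that by (auto simp: indicator_def fun_eq_iff)
    have "w absolutely_integrable_on {p..q}" using w that unfolding integrable_lebesgue_on_Ioo_iff
      by (rule_tac absolutely_integrable_on_subinterval) auto
    then have si: "set_integrable lebesgue {p<..<q} w" by (simp add: absolutely_integrable_on_Icc_iff_Ioo)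
    then have "integrable ?M (\<lambda>x. indicat_real {p<..<q} x * w x)"
      by (subst integrable_restrict_space) (simp_all add: eq set_integrable_def)
    moreover have "(LINT x|?M. indicat_real {p<..<q} x * w x) = integral {p..q} w"
      using set_lebesgue_integral_eq_integral(2)[OF si]
      by (subst integral_restrict_space) (simp_all add: eq set_lebesgue_integral_def integral_open_interval_real)
    ultimately show ?thesis by blast
  qed
  have "(LINT x|?M. ?i x * w x) = integral {s..t} w - integral {s + \<delta>..t + \<delta>} w"
    using I[of s t] I[of "s + \<delta>" "t + \<delta>"] st by (simp add: left_diff_distrib)
  then show ?thesis using z by simp
qed

text \<open>
  The increments of the indefinite integral \<open>W\<close> of \<open>w\<close> are invariant under translation, so \<open>W\<close> has the
  same derivative at any two points of differentiability; by Lebesgue's theorem this derivative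
  is \<open>w\<close> almost everywhere.
\<close>

lemma du_bois_reymond:
  assumes w: "integrable (lebesgue_on {a<..<b}) w"
    and 0: "\<And>\<phi>. test_function {a<..<b} \<phi> \<Longrightarrow> (LINT x|lebesgue_on {a<..<b}. deriv \<phi> x * w x) = 0"
  obtains c where "AE x in lebesgue_on {a<..<b}. w x = c"
proof -
  have wi: "w absolutely_integrable_on {a..b}" using w by (simp add: integrable_lebesgue_on_Ioo_iff)
  define W where "W x = integral {a..x} w" for x
  define good where "good x \<longleftrightarrow> x \<in> {a<..<b} \<and> (W has_field_derivative w x) (at x)" for x
  have ae: "AE x in lebesgue_on {a<..<b}. good x"
    using lebesgue_differentiation[OF wi] AE_space by eventually_elim (auto simp: good_def W_def[abs_def])
  have less: "w x = w y" if "good x" "good y" "x < y" for x y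
  proof -
    have x: "x \<in> {a<..<b}" "y \<in> {a<..<b}" using that by (auto simp: good_def)
    have lim: "((\<lambda>h. (W (z + h) - W z) / h) \<longlongrightarrow> w z) (at_right 0)" if "good z" for z
    proof -
      have "((\<lambda>h. (W (z + h) - W z) / h) \<longlongrightarrow> w z) (at 0)" using that by (auto simp: good_def dest: DERIV_D)
      then show ?thesis by (rule filterlim_mono) (auto intro: at_le)
    qed
    have "\<forall>\<^sub>F h in at_right 0. (W (x + h) - W x) / h = (W (y + h) - W y) / h"
    proof (rule eventually_at_rightI[of 0 "b - y"])
      fix h assume h: "h \<in> {0<..<b - y}"
      have wi': "w integrable_on {a..b}" using wi by (rule set_lebesgue_integral_eq_integral(1))
      have "W (x + h) - W x = integral {x..x + h} w" "W (y + h) - W y = integral {y..y + h} w"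
        unfolding W_def using x h \<open>x < y\<close> by (auto intro!: integral_diff_subinterval[OF wi'])
      moreover have "integral {x..x + h} w = integral {x + (y - x)..x + h + (y - x)} w"
        using x h \<open>x < y\<close> by (intro integral_translate_eq_if_weak_deriv_0[OF w 0]) auto
      ultimately show "(W (x + h) - W x) / h = (W (y + h) - W y) / h" by (simp add: add.commute)
    qed (use x in auto)
    then have "((\<lambda>h. (W (x + h) - W x) / h) \<longlongrightarrow> w y) (at_right 0)"
      by (intro Lim_transform_eventually[OF lim[OF that(2)]]) (auto elim: eventually_mono)
    with lim[OF that(1)] show ?thesis by (intro tendsto_unique[OF trivial_limit_at_right_real]) auto
  qed
  show ?thesis
  proof (cases "\<exists>x. good x")
    case True
    then obtain x where "good x" ..
    then have "w y = w x" if "good y" for y using less that by (metis linorder_neqE)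
    with ae have "AE y in lebesgue_on {a<..<b}. w y = w x" by (auto elim: eventually_mono)
    then show ?thesis by (rule that)
  next
    case False
    with ae have "AE y in lebesgue_on {a<..<b}. w y = 0" by (auto elim: eventually_mono)
    then show ?thesis by (rule that)
  qed
qed

lemma test_functionD:
  assumes "test_function {a<..<b} \<phi>"
  shows "(\<phi> has_field_derivative deriv \<phi> x) (at x)" "continuous_on UNIV (deriv \<phi>)" "continuous_on UNIV \<phi>"
    "\<phi> a = 0" "\<phi> b = 0"
proof -
  have "((deriv ^^ 0) \<phi>) field_differentiable (at x)" for x using assms unfolding test_function_def by blast
  then show D: "(\<phi> has_field_derivative deriv \<phi> x) (at x)" for x by (simp add: field_differentiable_derivI)
  have "((deriv ^^ 1) \<phi>) field_differentiable (at x)" for x using assms unfolding test_function_def by blast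
  then have "isCont (deriv \<phi>) x" for x by (auto intro: field_differentiable_imp_continuous_at)
  then show "continuous_on UNIV (deriv \<phi>)" by (simp add: continuous_on_eq_continuous_at)
  show "continuous_on UNIV \<phi>" using DERIV_isCont[OF D] by (simp add: continuous_on_eq_continuous_at)
  obtain K where "K \<subseteq> {a<..<b}" "\<forall>x. x \<notin> K \<longrightarrow> \<phi> x = 0" using assms unfolding test_function_def by blast
  then show "\<phi> a = 0" "\<phi> b = 0" by auto
qed

text \<open>
  Integration by parts. With \<open>U\<close> the given indefinite integral, the increments of \<open>\<phi> U\<close> are dominated
  by an integral, so \<open>\<phi> U\<close> is itself the indefinite integral of its almost everywhere derivative
  \<open>\<phi>' U + \<phi> v\<close>. It vanishes at both end points.
\<close>

lemma integral_is_weak_deriv: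
  fixes F v :: "real \<Rightarrow> real"
  assumes "a < b" and v: "v absolutely_integrable_on {a..b}"
    and F: "\<And>x. x \<in> {a<..<b} \<Longrightarrow> F x = c + integral {a..x} v"
  shows "is_weak_deriv {a<..<b} F v"
  unfolding is_weak_deriv_def
proof (intro allI impI)
  fix \<phi> assume \<phi>: "test_function {a<..<b} \<phi>"
  note \<phi>D = test_functionD[OF \<phi>]
  let ?M = "lebesgue_on {a<..<b}"
  define U where "U x = c + integral {a..x} v" for x
  have contU: "continuous_on {a..b} U" unfolding U_def by (intro continuous_intros integral_abs_cont_continuous v)
  have bd: "\<exists>B. \<forall>x\<in>{a..b}. \<bar>h x\<bar> \<le> B" if "continuous_on {a..b} h" for h :: "real \<Rightarrow> real"
    using compact_imp_bounded[OF compact_continuous_image[OF that]] by (auto simp: bounded_iff)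
  obtain B1 where B1: "\<And>x. x \<in> {a..b} \<Longrightarrow> \<bar>U x\<bar> \<le> B1" using bd[OF contU] by blast
  obtain B2 where B2: "\<And>x. x \<in> {a..b} \<Longrightarrow> \<bar>deriv \<phi> x\<bar> \<le> B2"
    using bd[OF continuous_on_subset[OF \<phi>D(2)]] by blast
  obtain B3 where B3: "\<And>x. x \<in> {a..b} \<Longrightarrow> \<bar>\<phi> x\<bar> \<le> B3"
    using bd[OF continuous_on_subset[OF \<phi>D(3)]] by blast
  have vi: "v integrable_on {a..b}" "(\<lambda>x. \<bar>v x\<bar>) integrable_on {a..b}"
    using v by (auto simp: absolutely_integrable_on_def)
  have sub: "h integrable_on {x..y}" if "h integrable_on {a..b}" "a \<le> x" "y \<le> b" for h :: "real \<Rightarrow> real" and x y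
    using that by (auto intro: integrable_on_subinterval)
  define g where "g x = B3 * \<bar>v x\<bar> + B1 * B2" for x
  define P where "P x = \<phi> x * U x" for x
  have gi: "g absolutely_integrable_on {a..b}" unfolding g_def using v
    by (intro set_integral_add(1) set_integrable_mult_right set_integrable_abs) auto
  have incr: "\<bar>P y - P x\<bar> \<le> integral {x..y} g" if xy: "a \<le> x" "x \<le> y" "y \<le> b" for x y
  proof -
    have "U y - U x = integral {x..y} v" unfolding U_def
      using integral_diff_subinterval[OF vi(1) xy] by simp
    moreover have "\<bar>integral {x..y} v\<bar> \<le> integral {x..y} (\<lambda>x. \<bar>v x\<bar>)"
      using integral_norm_bound_integral[of v "{x..y}" "\<lambda>x. \<bar>v x\<bar>"] sub vi xy by auto
    ultimately have U: "\<bar>U y - U x\<bar> \<le> integral {x..y} (\<lambda>x. \<bar>v x\<bar>)" by simp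
    have \<phi>: "\<bar>\<phi> y - \<phi> x\<bar> \<le> B2 * (y - x)"
    proof (cases "x = y")
      case False
      then have "x < y" using xy by simp
      then obtain z where z: "x < z" "z < y" "\<phi> y - \<phi> x = (y - x) * deriv \<phi> z" using MVT2[of x y \<phi> "deriv \<phi>"] \<phi>D(1) by blast
      then show ?thesis using B2[of z] xy by (simp add: abs_mult mult.commute mult_right_mono)
    qed simp
    have "P y - P x = \<phi> y * (U y - U x) + U x * (\<phi> y - \<phi> x)" by (simp add: P_def algebra_simps)
    then have "\<bar>P y - P x\<bar> \<le> \<bar>\<phi> y\<bar> * \<bar>U y - U x\<bar> + \<bar>U x\<bar> * \<bar>\<phi> y - \<phi> x\<bar>"
      by (simp add: abs_mult[symmetric] abs_triangle_ineq)
    also have "\<dots> \<le> B3 * integral {x..y} (\<lambda>x. \<bar>v x\<bar>) + B1 * (B2 * (y - x))"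
      using B3[of y] B1[of x] U \<phi> xy by (intro add_mono mult_mono) auto
    also have "\<dots> = integral {x..y} g" unfolding g_def
    proof (subst Henstock_Kurzweil_Integration.integral_add)
      show "(\<lambda>x. B3 * \<bar>v x\<bar>) integrable_on {x..y}"
        using integrable_cmul[OF sub[OF vi(2), of x y], of B3] xy by simp
    qed (use xy in auto)
    finally show ?thesis .
  qed
  obtain p where p: "p absolutely_integrable_on {a..b}" "\<And>x. x \<in> {a..b} \<Longrightarrow> P x = P a + integral {a..x} p"
    using dominated_increments_imp_integral[OF less_imp_le[OF \<open>a < b\<close>] gi incr] by blast
  have ae: "AE x in ?M. p x = deriv \<phi> x * U x + \<phi> x * v x"
    using lebesgue_differentiation[OF v] lebesgue_differentiation[OF p(1)] AE_space
  proof eventually_elim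
    case (elim x)
    then have x: "x \<in> {a<..<b}" by simp
    have "(U has_field_derivative v x) (at x)" unfolding U_def[abs_def] using DERIV_add[OF DERIV_const elim(1), of c] by simp
    then have 1: "(P has_field_derivative deriv \<phi> x * U x + v x * \<phi> x) (at x)"
      unfolding P_def[abs_def] by (rule DERIV_mult[OF \<phi>D(1)])
    have "((\<lambda>y. P a + integral {a..y} p) has_field_derivative p x) (at x)" using DERIV_add[OF DERIV_const elim(2), of "P a"] by simp
    then have "(P has_field_derivative p x) (at x)"
    proof (rule has_field_derivative_transform_within_open[of _ _ _ "{a<..<b}"])
      show "P a + integral {a..y} p = P y" if "y \<in> {a<..<b}" for y
        using p(2)[of y] that by simp
    qed (use x in auto)
    with 1 have "p x = deriv \<phi> x * U x + v x * \<phi> x" using DERIV_unique by blast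
    then show ?case by (simp add: mult.commute)
  qed
  have pM: "integrable ?M p" using p(1) by (simp add: integrable_lebesgue_on_Ioo_iff)
  have vM: "integrable ?M v" using v by (simp add: integrable_lebesgue_on_Ioo_iff)
  have m: "h \<in> borel_measurable ?M" if "continuous_on UNIV h" for h :: "real \<Rightarrow> real"
    using continuous_on_subset[OF that] by (intro continuous_imp_measurable_on_sets_lebesgue) auto
  have UM: "integrable ?M U"
    unfolding integrable_lebesgue_on_Ioo_iff by (rule absolutely_integrable_continuous_real[OF contU])
  have i1: "integrable ?M (\<lambda>x. deriv \<phi> x *\<^sub>R U x)"
    by (rule integrable_bounded_mult[OF UM m[OF \<phi>D(2)] B2]) auto
  have i2: "integrable ?M (\<lambda>x. \<phi> x *\<^sub>R v x)"
    by (rule integrable_bounded_mult[OF vM m[OF \<phi>D(3)] B3]) auto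
  have "(LINT x|?M. p x) = (LINT x|?M. deriv \<phi> x * U x + \<phi> x * v x)"
    using ae pM i1 i2 by (intro integral_cong_AE) auto
  moreover have "(LINT x|?M. p x) = 0"
    using p(2)[of b] \<open>a < b\<close> \<phi>D(4,5) by (simp add: LINT_lebesgue_on_Ioo[OF p(1)] P_def)
  ultimately have "(LINT x|?M. deriv \<phi> x *\<^sub>R U x) = - (LINT x|?M. \<phi> x *\<^sub>R v x)"
    using i1 i2 by simp
  moreover have "(LINT x|?M. deriv \<phi> x *\<^sub>R F x) = (LINT x|?M. deriv \<phi> x *\<^sub>R U x)"
    by (intro Bochner_Integration.integral_cong) (auto simp: F U_def)
  ultimately show "(LINT x|?M. deriv \<phi> x *\<^sub>R F x) = - (LINT x|?M. \<phi> x *\<^sub>R v x)" by simp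
qed

section \<open>Sobolev functions on an interval\<close>

lemma in_Lq_measurable: "in_Lq q I u \<Longrightarrow> u \<in> borel_measurable (lebesgue_on I)"
  by (simp add: in_Lq_def)

lemma in_Lq_dominated:
  assumes "0 \<le> q" "in_Lq q I g" "u \<in> borel_measurable (lebesgue_on I)"
    and "AE x in lebesgue_on I. norm (u x) \<le> C * norm (g x)"
  shows "in_Lq q I u"
  unfolding in_Lq_def
proof (intro conjI assms)
  show "integrable (lebesgue_on I) (\<lambda>x. norm (u x) powr q)"
  proof (rule Bochner_Integration.integrable_bound[where f="\<lambda>x. \<bar>C\<bar> powr q * norm (g x) powr q"])
    show "integrable (lebesgue_on I) (\<lambda>x. \<bar>C\<bar> powr q * norm (g x) powr q)" using assms(2) by (simp add: in_Lq_def)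
    show "(\<lambda>x. norm (u x) powr q) \<in> borel_measurable (lebesgue_on I)" using assms(3) by measurable
    show "AE x in lebesgue_on I. norm (norm (u x) powr q) \<le> norm (\<bar>C\<bar> powr q * norm (g x) powr q)"
      using assms(4)
    proof eventually_elim
      case (elim x)
      also have "C * norm (g x) \<le> \<bar>C\<bar> * norm (g x)" by (intro mult_right_mono) auto
      finally have "norm (u x) powr q \<le> (\<bar>C\<bar> * norm (g x)) powr q" using assms(1) by (intro powr_mono2) auto
      then show ?case by (simp add: powr_mult)
    qed
  qed
qed

lemma add_powr_le:
  fixes x y :: real
  assumes "x \<ge> 0" "y \<ge> 0" "q \<ge> 0"
  shows "(x + y) powr q \<le> 2 powr q * (x powr q + y powr q)"
proof -
  have "(x + y) powr q \<le> (2 * max x y) powr q" using assms by (intro powr_mono2) auto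
  also have "\<dots> = 2 powr q * max x y powr q" using assms by (simp add: powr_mult)
  also have "max x y powr q \<le> x powr q + y powr q" by (simp add: max_def)
  finally show ?thesis by simp
qed

lemma in_Lq_add:
  assumes "0 \<le> q" "in_Lq q I u" "in_Lq q I v"
  shows "in_Lq q I (\<lambda>x. u x + v x)"
  unfolding in_Lq_def
proof (intro conjI)
  show m: "(\<lambda>x. u x + v x) \<in> borel_measurable (lebesgue_on I)" using assms by (auto simp: in_Lq_def)
  show "integrable (lebesgue_on I) (\<lambda>x. norm (u x + v x) powr q)"
  proof (rule Bochner_Integration.integrable_bound[where f="\<lambda>x. 2 powr q * (norm (u x) powr q + norm (v x) powr q)"])
    show "integrable (lebesgue_on I) (\<lambda>x. 2 powr q * (norm (u x) powr q + norm (v x) powr q))"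
      using assms by (simp add: in_Lq_def)
    show "(\<lambda>x. norm (u x + v x) powr q) \<in> borel_measurable (lebesgue_on I)" using m by measurable
    show "AE x in lebesgue_on I. norm (norm (u x + v x) powr q) \<le> norm (2 powr q * (norm (u x) powr q + norm (v x) powr q))"
    proof (rule AE_I2)
      fix x
      have "norm (u x + v x) powr q \<le> (norm (u x) + norm (v x)) powr q"
        using assms(1) by (intro powr_mono2 norm_triangle_ineq) auto
      also have "\<dots> \<le> 2 powr q * (norm (u x) powr q + norm (v x) powr q)" by (rule add_powr_le) (use assms in auto)
      finally show "norm (norm (u x + v x) powr q) \<le> norm (2 powr q * (norm (u x) powr q + norm (v x) powr q))" by simp
    qed
  qed
qed

lemma in_Lq_bounded_linear:
  assumes "0 \<le> q" "in_Lq q I u" "bounded_linear T"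
  shows "in_Lq q I (\<lambda>x. T (u x))"
proof -
  interpret T: bounded_linear T by fact
  obtain K where K: "\<And>x. norm (T x) \<le> norm x * K" using T.bounded by blast
  show ?thesis
  proof (rule in_Lq_dominated[OF assms(1,2)])
    show "(\<lambda>x. T (u x)) \<in> borel_measurable (lebesgue_on I)"
      using assms(2,3) by (auto simp: in_Lq_def intro: borel_measurable_continuous_onI[THEN measurable_compose_rev] linear_continuous_on)
    show "AE x in lebesgue_on I. norm (T (u x)) \<le> K * norm (u x)" using K by (auto simp: mult.commute)
  qed
qed

lemma in_Lq_diff:
  assumes "0 \<le> q" "in_Lq q I u" "in_Lq q I v"
  shows "in_Lq q I (\<lambda>x. u x - v x)"
  using in_Lq_add[OF assms(1,2) in_Lq_bounded_linear[OF assms(1,3) bounded_linear_minus[OF bounded_linear_ident]]] by simp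

lemma finite_measure_lebesgue_on_Ioo: "finite_measure (lebesgue_on {a<..<b::real})"
  by (rule finite_measureI, cases "a \<le> b") (simp_all add: emeasure_restrict_space)

lemma in_Lq_const: "in_Lq q {a<..<b} (\<lambda>_. c)"
proof -
  interpret finite_measure "lebesgue_on {a<..<b}" by (rule finite_measure_lebesgue_on_Ioo)
  show ?thesis by (simp add: in_Lq_def)
qed

lemma in_Lq_integrable:
  assumes "1 \<le> q" "in_Lq q {a<..<b} u"
  shows "integrable (lebesgue_on {a<..<b}) u"
proof (rule Bochner_Integration.integrable_bound)
  interpret finite_measure "lebesgue_on {a<..<b}" by (rule finite_measure_lebesgue_on_Ioo)
  show "integrable (lebesgue_on {a<..<b}) (\<lambda>x. 1 + norm (u x) powr q)" using assms by (simp add: in_Lq_def)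
  show "u \<in> borel_measurable (lebesgue_on {a<..<b})" using assms by (simp add: in_Lq_def)
  have *: "r \<le> 1 + r powr q" if "r \<ge> 0" for r :: real
  proof (cases "r \<le> 1")
    case True
    then show ?thesis by (simp add: add_increasing2)
  next
    case False
    then have "r powr 1 \<le> r powr q" using assms(1) by (intro powr_mono) auto
    then show ?thesis using False by simp
  qed
  show "AE x in lebesgue_on {a<..<b}. norm (u x) \<le> norm (1 + norm (u x) powr q)"
    using * by (intro AE_I2) (auto simp: abs_of_nonneg)
qed

lemma test_function_bounded:
  assumes "test_function {a<..<b} \<phi>"
  obtains B where "\<And>x. x \<in> {a<..<b} \<Longrightarrow> \<bar>\<phi> x\<bar> \<le> B" "\<And>x. x \<in> {a<..<b} \<Longrightarrow> \<bar>deriv \<phi> x\<bar> \<le> B"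
proof -
  have bd: "\<exists>B. \<forall>x\<in>{a..b}. \<bar>h x\<bar> \<le> B" if "continuous_on {a..b} h" for h :: "real \<Rightarrow> real"
    using compact_imp_bounded[OF compact_continuous_image[OF that]] by (auto simp: bounded_iff)
  obtain B1 where B1: "\<And>x. x \<in> {a..b} \<Longrightarrow> \<bar>\<phi> x\<bar> \<le> B1"
    using bd[OF continuous_on_subset[OF test_functionD(3)[OF assms]]] by blast
  obtain B2 where B2: "\<And>x. x \<in> {a..b} \<Longrightarrow> \<bar>deriv \<phi> x\<bar> \<le> B2"
    using bd[OF continuous_on_subset[OF test_functionD(2)[OF assms]]] by blast
  show ?thesis by (rule that[of "max B1 B2"]) (use B1 B2 in \<open>auto simp: le_max_iff_disj\<close>)
qed

lemma test_function_integrable: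
  fixes u :: "real \<Rightarrow> 'a::euclidean_space"
  assumes "test_function {a<..<b} \<phi>" "integrable (lebesgue_on {a<..<b}) u"
  shows "integrable (lebesgue_on {a<..<b}) (\<lambda>x. \<phi> x *\<^sub>R u x)" "integrable (lebesgue_on {a<..<b}) (\<lambda>x. deriv \<phi> x *\<^sub>R u x)"
proof -
  obtain B where B: "\<And>x. x \<in> {a<..<b} \<Longrightarrow> \<bar>\<phi> x\<bar> \<le> B" "\<And>x. x \<in> {a<..<b} \<Longrightarrow> \<bar>deriv \<phi> x\<bar> \<le> B"
    using test_function_bounded[OF assms(1)] by blast
  have m: "h \<in> borel_measurable (lebesgue_on {a<..<b})" if "continuous_on UNIV h" for h :: "real \<Rightarrow> real"
    using continuous_on_subset[OF that] by (intro continuous_imp_measurable_on_sets_lebesgue) auto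
  show "integrable (lebesgue_on {a<..<b}) (\<lambda>x. \<phi> x *\<^sub>R u x)"
    by (rule integrable_bounded_mult[OF assms(2) m[OF test_functionD(3)[OF assms(1)]] B(1)]) auto
  show "integrable (lebesgue_on {a<..<b}) (\<lambda>x. deriv \<phi> x *\<^sub>R u x)"
    by (rule integrable_bounded_mult[OF assms(2) m[OF test_functionD(2)[OF assms(1)]] B(2)]) auto
qed

lemma is_weak_deriv_bounded_linear:
  assumes "integrable (lebesgue_on {a<..<b}) u" "integrable (lebesgue_on {a<..<b}) v" "bounded_linear T"
    and "is_weak_deriv {a<..<b} u v"
  shows "is_weak_deriv {a<..<b} (\<lambda>x. T (u x)) (\<lambda>x. T (v x))"
  unfolding is_weak_deriv_def
proof (intro allI impI)
  interpret T: bounded_linear T by fact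
  fix \<phi> assume \<phi>: "test_function {a<..<b} \<phi>"
  have "(LINT x|lebesgue_on {a<..<b}. deriv \<phi> x *\<^sub>R T (u x)) = T (LINT x|lebesgue_on {a<..<b}. deriv \<phi> x *\<^sub>R u x)"
    using integral_bounded_linear[OF assms(3) test_function_integrable(2)[OF \<phi> assms(1)]] by (simp add: T.scaleR)
  also have "(LINT x|lebesgue_on {a<..<b}. deriv \<phi> x *\<^sub>R u x) = - (LINT x|lebesgue_on {a<..<b}. \<phi> x *\<^sub>R v x)"
    using assms(4) \<phi> by (simp add: is_weak_deriv_def)
  also have "T (- (LINT x|lebesgue_on {a<..<b}. \<phi> x *\<^sub>R v x)) = - (LINT x|lebesgue_on {a<..<b}. \<phi> x *\<^sub>R T (v x))"
    using integral_bounded_linear[OF assms(3) test_function_integrable(1)[OF \<phi> assms(2)]] by (simp add: T.scaleR linear_neg[OF T.linear_axioms])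
  finally show "(LINT x|lebesgue_on {a<..<b}. deriv \<phi> x *\<^sub>R T (u x)) = - (LINT x|lebesgue_on {a<..<b}. \<phi> x *\<^sub>R T (v x))" .
qed

lemma is_weak_deriv_diff:
  assumes "integrable (lebesgue_on {a<..<b}) u" "integrable (lebesgue_on {a<..<b}) v"
    "integrable (lebesgue_on {a<..<b}) u'" "integrable (lebesgue_on {a<..<b}) v'"
    and "is_weak_deriv {a<..<b} u v" "is_weak_deriv {a<..<b} u' v'"
  shows "is_weak_deriv {a<..<b} (\<lambda>x. u x - u' x) (\<lambda>x. v x - v' x)"
  using assms(5,6) unfolding is_weak_deriv_def
  by (auto simp: scaleR_diff_right test_function_integrable assms)

lemma is_weak_deriv_complexI:
  fixes u v :: "real \<Rightarrow> complex"
  assumes int: "integrable (lebesgue_on {a<..<b}) u" "integrable (lebesgue_on {a<..<b}) v"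
    and Re: "is_weak_deriv {a<..<b} (\<lambda>x. Re (u x)) (\<lambda>x. Re (v x))"
    and Im: "is_weak_deriv {a<..<b} (\<lambda>x. Im (u x)) (\<lambda>x. Im (v x))"
  shows "is_weak_deriv {a<..<b} u v"
  unfolding is_weak_deriv_def
proof (intro allI impI)
  fix \<phi> assume \<phi>: "test_function {a<..<b} \<phi>"
  note i = test_function_integrable[OF \<phi>]
  have "T (LINT x|lebesgue_on {a<..<b}. deriv \<phi> x *\<^sub>R u x) = T (- (LINT x|lebesgue_on {a<..<b}. \<phi> x *\<^sub>R v x))"
    if T: "bounded_linear T" and w: "is_weak_deriv {a<..<b} (\<lambda>x. T (u x)) (\<lambda>x. T (v x))" for T :: "complex \<Rightarrow> real"
  proof -
    interpret T: bounded_linear T by fact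
    have "T (LINT x|lebesgue_on {a<..<b}. deriv \<phi> x *\<^sub>R u x) = (LINT x|lebesgue_on {a<..<b}. deriv \<phi> x *\<^sub>R T (u x))"
      using integral_bounded_linear[OF T i(2)[OF int(1)]] by (simp add: T.scaleR)
    also have "\<dots> = - (LINT x|lebesgue_on {a<..<b}. \<phi> x *\<^sub>R T (v x))" using w \<phi> by (simp add: is_weak_deriv_def)
    also have "\<dots> = T (- (LINT x|lebesgue_on {a<..<b}. \<phi> x *\<^sub>R v x))"
      using integral_bounded_linear[OF T i(1)[OF int(2)]] by (simp add: T.scaleR linear_neg[OF T.linear_axioms])
    finally show ?thesis .
  qed
  from this[OF bounded_linear_Re Re] this[OF bounded_linear_Im Im]
  show "(LINT x|lebesgue_on {a<..<b}. deriv \<phi> x *\<^sub>R u x) = - (LINT x|lebesgue_on {a<..<b}. \<phi> x *\<^sub>R v x)"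
    by (rule complex_eqI)
qed

text \<open>
  The function \<open>u\<close> and the indefinite integral of \<open>v\<close> have the same weak derivative, so they differ
  by a constant almost everywhere, and by continuity everywhere.
\<close>

theorem weak_deriv_integral_representation:
  fixes u v :: "real \<Rightarrow> real"
  assumes "a < b" and u: "continuous_on {a<..<b} u" "integrable (lebesgue_on {a<..<b}) u"
    and v: "integrable (lebesgue_on {a<..<b}) v" and w: "is_weak_deriv {a<..<b} u v"
  obtains c where "\<And>x. x \<in> {a<..<b} \<Longrightarrow> u x = c + integral {a..x} v"
proof -
  let ?M = "lebesgue_on {a<..<b}"
  define V where "V x = integral {a..x} v" for x
  have va: "v absolutely_integrable_on {a..b}" using v by (simp add: integrable_lebesgue_on_Ioo_iff)
  have contV: "continuous_on {a..b} V" unfolding V_def by (rule integral_abs_cont_continuous[OF va])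
  have VM: "integrable ?M V"
    unfolding integrable_lebesgue_on_Ioo_iff by (rule absolutely_integrable_continuous_real[OF contV])
  have wV: "is_weak_deriv {a<..<b} V v"
    by (rule integral_is_weak_deriv[OF assms(1) va, of _ 0]) (simp add: V_def)
  have "is_weak_deriv {a<..<b} (\<lambda>x. u x - V x) (\<lambda>x. v x - v x)"
    by (rule is_weak_deriv_diff[OF u(2) v VM v w wV])
  then have "(LINT x|?M. deriv \<phi> x * (u x - V x)) = 0" if "test_function {a<..<b} \<phi>" for \<phi>
    using that by (simp add: is_weak_deriv_def)
  moreover have "integrable ?M (\<lambda>x. u x - V x)" using u VM by simp
  ultimately obtain c where c: "AE x in ?M. u x - V x = c" using du_bois_reymond[of a b "\<lambda>x. u x - V x"] by blast
  define N where "N = {x \<in> {a<..<b}. u x - V x \<noteq> c}"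
  have "continuous_on {a<..<b} (\<lambda>x. u x - V x)"
    by (intro continuous_intros u continuous_on_subset[OF contV]) auto
  then have "open ({a<..<b} \<inter> (\<lambda>x. u x - V x) -` (- {c}))"
    by (rule continuous_open_preimage) auto
  moreover have "{a<..<b} \<inter> (\<lambda>x. u x - V x) -` (- {c}) = N" by (auto simp: N_def)
  moreover have "negligible N" using c by (subst (asm) AE_lebesgue_on_iff_negligible) (auto simp: N_def)
  ultimately have "N = {}" using open_not_negligible by metis
  then show ?thesis by (intro that[of c]) (auto simp: N_def V_def algebra_simps)
qed

theorem weak_deriv_AE_derivative:
  fixes u v :: "real \<Rightarrow> real"
  assumes "a < b" "continuous_on {a<..<b} u" "integrable (lebesgue_on {a<..<b}) u"
    "integrable (lebesgue_on {a<..<b}) v" "is_weak_deriv {a<..<b} u v"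
  shows "AE x in lebesgue_on {a<..<b}. (u has_field_derivative v x) (at x)"
proof -
  obtain c where c: "\<And>x. x \<in> {a<..<b} \<Longrightarrow> u x = c + integral {a..x} v"
    using weak_deriv_integral_representation[OF assms] by blast
  have va: "v absolutely_integrable_on {a..b}" using assms(4) by (simp add: integrable_lebesgue_on_Ioo_iff)
  show ?thesis using lebesgue_differentiation[OF va] AE_space
  proof eventually_elim
    case (elim x)
    have "((\<lambda>y. c + integral {a..y} v) has_field_derivative v x) (at x)" using DERIV_add[OF DERIV_const elim(1), of c] by simp
    then show ?case
      by (rule has_field_derivative_transform_within_open[of _ _ _ "{a<..<b}"]) (use elim(2) c in auto)
  qed
qed

theorem weak_deriv_AE_derivative_complex:
  fixes u v :: "real \<Rightarrow> complex"
  assumes "a < b" "continuous_on {a<..<b} u" "integrable (lebesgue_on {a<..<b}) u"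
    "integrable (lebesgue_on {a<..<b}) v" "is_weak_deriv {a<..<b} u v"
  shows "AE x in lebesgue_on {a<..<b}. (u has_vector_derivative v x) (at x)"
proof -
  have "AE x in lebesgue_on {a<..<b}. ((\<lambda>x. Re (u x)) has_field_derivative Re (v x)) (at x)"
    using assms by (intro weak_deriv_AE_derivative is_weak_deriv_bounded_linear[OF _ _ bounded_linear_Re] continuous_intros) auto
  moreover have "AE x in lebesgue_on {a<..<b}. ((\<lambda>x. Im (u x)) has_field_derivative Im (v x)) (at x)"
    using assms by (intro weak_deriv_AE_derivative is_weak_deriv_bounded_linear[OF _ _ bounded_linear_Im] continuous_intros) auto
  ultimately show ?thesis by eventually_elim (simp add: has_vector_derivative_complex_iff)
qed

text \<open>
  The criterion by which the branches of a parameterization are recognized as Sobolev functions.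
\<close>

theorem dominated_increments_imp_W1:
  fixes F :: "real \<Rightarrow> complex"
  assumes "a < b" "1 \<le> q" and g: "in_Lq q {a<..<b} g"
    and incr: "\<And>x y. a < x \<Longrightarrow> x \<le> y \<Longrightarrow> y < b \<Longrightarrow> norm (F y - F x) \<le> integral {x..y} g"
  shows "continuous_on {a<..<b} F" "F \<in> W1 q {a<..<b}"
proof -
  let ?M = "lebesgue_on {a<..<b}"
  have q0: "0 \<le> q" using assms by simp
  have gM: "integrable ?M g" using in_Lq_integrable[OF assms(2) g] .
  then have ga: "g absolutely_integrable_on {a..b}" by (simp add: integrable_lebesgue_on_Ioo_iff)
  have *: "\<exists>v. continuous_on {a<..<b} h \<and> in_Lq q {a<..<b} h \<and> in_Lq q {a<..<b} v \<and> is_weak_deriv {a<..<b} h v"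
    if h: "\<And>x y. a < x \<Longrightarrow> x \<le> y \<Longrightarrow> y < b \<Longrightarrow> \<bar>h y - h x\<bar> \<le> integral {x..y} g" for h :: "real \<Rightarrow> real"
  proof -
    obtain c v where v: "v absolutely_integrable_on {a..b}" "\<And>x. x \<in> {a<..<b} \<Longrightarrow> h x = c + integral {a..x} v"
      "AE x in ?M. \<bar>v x\<bar> \<le> g x"
      using dominated_increments_imp_integral_open[OF assms(1) ga h] by blast
    have contV: "continuous_on {a..b} (\<lambda>x. c + integral {a..x} v)"
      by (intro continuous_intros integral_abs_cont_continuous[OF v(1)])
    have cont: "continuous_on {a<..<b} h"
      by (rule continuous_on_eq[OF continuous_on_subset[OF contV]]) (auto simp: v(2))
    obtain B where B: "\<And>x. x \<in> {a..b} \<Longrightarrow> \<bar>c + integral {a..x} v\<bar> \<le> B"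
    proof -
      have "bounded ((\<lambda>x. c + integral {a..x} v) ` {a..b})"
        by (rule compact_imp_bounded[OF compact_continuous_image[OF contV]]) simp
      then obtain B where "\<forall>x\<in>{a..b}. \<bar>c + integral {a..x} v\<bar> \<le> B" by (auto simp: bounded_iff)
      then show ?thesis by (intro that[of B]) blast
    qed
    have "in_Lq q {a<..<b} h"
    proof (rule in_Lq_dominated[OF q0 in_Lq_const[where c="1::real"]])
      show "h \<in> borel_measurable ?M" using cont by (rule continuous_imp_measurable_on_sets_lebesgue) auto
      show "AE x in ?M. norm (h x) \<le> B * norm (1::real)"
        using B v(2) by (intro AE_I2) (auto simp: space_restrict_space)
    qed
    moreover have "in_Lq q {a<..<b} v"
    proof (rule in_Lq_dominated[OF q0 g, of _ 1])
      show "v \<in> borel_measurable ?M" using v(1) by (auto simp: integrable_lebesgue_on_Ioo_iff[symmetric])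
      show "AE x in ?M. norm (v x) \<le> 1 * norm (g x)" using v(3) by eventually_elim auto
    qed
    moreover have "is_weak_deriv {a<..<b} h v" by (rule integral_is_weak_deriv[OF assms(1) v(1,2)])
    ultimately show ?thesis using cont by blast
  qed
  have "\<bar>Re (F y) - Re (F x)\<bar> \<le> norm (F y - F x)" "\<bar>Im (F y) - Im (F x)\<bar> \<le> norm (F y - F x)" for x y
    using abs_Re_le_cmod[of "F y - F x"] abs_Im_le_cmod[of "F y - F x"] by auto
  note le = order_trans[OF this(1) incr] order_trans[OF this(2) incr]
  obtain vr where r: "continuous_on {a<..<b} (\<lambda>x. Re (F x))" "in_Lq q {a<..<b} (\<lambda>x. Re (F x))" "in_Lq q {a<..<b} vr" 
      "is_weak_deriv {a<..<b} (\<lambda>x. Re (F x)) vr"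
    using *[of "\<lambda>x. Re (F x)"] le(1) by blast
  obtain vi where i: "continuous_on {a<..<b} (\<lambda>x. Im (F x))" "in_Lq q {a<..<b} (\<lambda>x. Im (F x))" "in_Lq q {a<..<b} vi" 
      "is_weak_deriv {a<..<b} (\<lambda>x. Im (F x)) vi"
    using *[of "\<lambda>x. Im (F x)"] le(2) by blast
  have mk: "in_Lq q {a<..<b} (\<lambda>x. Complex (h x) (k x))" if "in_Lq q {a<..<b} h" "in_Lq q {a<..<b} k" for h k
  proof -
    have "in_Lq q {a<..<b} (\<lambda>x. complex_of_real (h x) + complex_of_real (k x) * \<i>)"
      using that by (intro in_Lq_add q0 in_Lq_bounded_linear[of _ _ _ complex_of_real] bounded_linear_of_real
        in_Lq_bounded_linear[of _ _ _ "\<lambda>x. complex_of_real x * \<i>"] bounded_linear_mult_const)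
    then show ?thesis by (simp add: Complex_eq mult.commute)
  qed
  have "continuous_on {a<..<b} (\<lambda>x. Complex (Re (F x)) (Im (F x)))" by (intro continuous_intros r i)
  then show "continuous_on {a<..<b} F" by simp
  have FL: "in_Lq q {a<..<b} F" using mk[OF r(2) i(2)] by simp
  have vL: "in_Lq q {a<..<b} (\<lambda>x. Complex (vr x) (vi x))" by (rule mk[OF r(3) i(3)])
  have "is_weak_deriv {a<..<b} F (\<lambda>x. Complex (vr x) (vi x))"
    using in_Lq_integrable[OF assms(2) FL] in_Lq_integrable[OF assms(2) vL] r(4) i(4)
    by (intro is_weak_deriv_complexI) auto
  with FL vL show "F \<in> W1 q {a<..<b}" unfolding W1_def by blast
qed

section \<open>Unordered tuples and the Almgren map\<close>

lemma unord_surj: "size m = d \<Longrightarrow> \<exists>z. unord d z = m"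
proof -
  assume "size m = d"
  moreover obtain xs where xs: "mset xs = m" using ex_mset by blast
  ultimately have len: "length xs = d" by auto
  have "unord d (\<lambda>i. xs ! i) = mset (map (\<lambda>i. xs ! i) [0..<d])"
    by (simp add: unord_def mset_upt atLeast0LessThan)
  also have "\<dots> = m" using xs len map_nth[of xs] by simp
  finally show ?thesis by blast
qed

lemma almgren_map_unord:
  "\<exists>p. p permutes {..<d} \<and> (\<forall>k<d. almgren_map \<theta> (unord d z) ! k = Re (\<theta> * z (p k))) \<and>
     (\<forall>j k. j \<le> k \<longrightarrow> k < d \<longrightarrow> Re (\<theta> * z (p j)) \<le> Re (\<theta> * z (p k)))"
proof -
  let ?xs = "almgren_map \<theta> (unord d z)"
  have mset: "mset ?xs = image_mset (\<lambda>i. Re (\<theta> * z i)) (mset_set {..<d})"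
    by (simp add: almgren_map_def unord_def multiset.map_comp o_def)
  have len: "length ?xs = d" using arg_cong[OF mset, of size] by simp
  have "image_mset (\<lambda>i. ?xs ! i) (mset_set {..<d}) = mset (map (\<lambda>i. ?xs ! i) [0..<d])"
    by (simp add: mset_upt atLeast0LessThan)
  also have "map (\<lambda>i. ?xs ! i) [0..<d] = ?xs" using map_nth[of ?xs] len by simp
  finally obtain p where p: "p permutes {..<d}" "\<forall>i\<in>{..<d}. ?xs ! i = Re (\<theta> * z (p i))"
    using image_mset_eq_implies_permutes[of "{..<d}" "\<lambda>i. ?xs ! i" "\<lambda>i. Re (\<theta> * z i)"] mset by auto
  have "sorted ?xs" by (simp add: almgren_map_def)
  then have "?xs ! j \<le> ?xs ! k" if "j \<le> k" "k < d" for j k using that len by (simp add: sorted_nth_mono)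
  with p show ?thesis by (intro exI[of _ p]) auto
qed

text \<open>
  A pigeonhole argument: if the inequality failed, the \<open>k + 1\<close> indices that \<open>\<tau>\<close> matches with the
  \<open>k + 1\<close> smallest values of \<open>Y\<close> would all be among those that carry the \<open>k\<close> smallest values of \<open>X\<close>.
\<close>

lemma sorted_le_sorted:
  fixes X Y :: "nat \<Rightarrow> real"
  assumes perm: "p permutes {..<d}" "p' permutes {..<d}" "\<tau> permutes {..<d}"
    and X: "\<And>j k. j \<le> k \<Longrightarrow> k < d \<Longrightarrow> X (p j) \<le> X (p k)"
    and Y: "\<And>j k. j \<le> k \<Longrightarrow> k < d \<Longrightarrow> Y (p' j) \<le> Y (p' k)"
    and le: "\<And>i. i < d \<Longrightarrow> X i \<le> Y (\<tau> i) + \<epsilon>" and "k < d"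
  shows "X (p k) \<le> Y (p' k) + \<epsilon>"
proof (rule ccontr)
  assume "\<not> ?thesis"
  then have gt: "Y (p' k) + \<epsilon> < X (p k)" by simp
  define m where "m = inv p \<circ> inv \<tau> \<circ> p'"
  have m: "m permutes {..<d}" unfolding m_def by (intro permutes_compose permutes_inv perm)
  have "m ` {..k} \<subseteq> {..<k}"
  proof
    fix x assume "x \<in> m ` {..k}"
    then obtain j where j: "j \<le> k" "x = m j" by auto
    define i where "i = inv \<tau> (p' j)"
    have "j < d" using j \<open>k < d\<close> by simp
    then have "p' j < d" using permutes_in_image[OF perm(2), of j] by simp
    then have i: "i < d" "\<tau> i = p' j"
      using permutes_in_image[OF permutes_inv[OF perm(3)], of "p' j"] permutes_inverses(1)[OF perm(3)] by (auto simp: i_def)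
    have x: "x = inv p i" by (simp add: j m_def i_def)
    have xd: "x < d" "p x = i"
      using permutes_in_image[OF permutes_inv[OF perm(1)], of i] i permutes_inverses(1)[OF perm(1)] by (auto simp: x)
    have "X (p x) \<le> Y (p' j) + \<epsilon>" using le[OF i(1)] i xd by simp
    also have "\<dots> \<le> Y (p' k) + \<epsilon>" using Y[OF j(1) \<open>k < d\<close>] by simp
    also have "\<dots> < X (p k)" by (rule gt)
    finally have "\<not> k \<le> x" using X[of k x] xd by auto
    then show "x \<in> {..<k}" by simp
  qed
  then have "card (m ` {..k}) \<le> card {..<k}" by (intro card_mono) auto
  moreover have "card (m ` {..k}) = card {..k}"
    by (rule card_image) (rule inj_on_subset[OF permutes_inj[OF m]], simp)
  ultimately show False by simp
qed

lemma almgren_map_sup_Lipschitz: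
  assumes "\<tau> permutes {..<d}" and le: "\<And>i. i < d \<Longrightarrow> \<bar>Re (\<theta> * z i) - Re (\<theta> * w (\<tau> i))\<bar> \<le> \<epsilon>" and "k < d"
  shows "\<bar>almgren_map \<theta> (unord d z) ! k - almgren_map \<theta> (unord d w) ! k\<bar> \<le> \<epsilon>"
proof -
  obtain p where p: "p permutes {..<d}" "\<And>k. k < d \<Longrightarrow> almgren_map \<theta> (unord d z) ! k = Re (\<theta> * z (p k))"
    "\<And>j k. j \<le> k \<Longrightarrow> k < d \<Longrightarrow> Re (\<theta> * z (p j)) \<le> Re (\<theta> * z (p k))" using almgren_map_unord[of d \<theta> z] by blast
  obtain p' where p': "p' permutes {..<d}" "\<And>k. k < d \<Longrightarrow> almgren_map \<theta> (unord d w) ! k = Re (\<theta> * w (p' k))"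
    "\<And>j k. j \<le> k \<Longrightarrow> k < d \<Longrightarrow> Re (\<theta> * w (p' j)) \<le> Re (\<theta> * w (p' k))" using almgren_map_unord[of d \<theta> w] by blast
  have "Re (\<theta> * z (p k)) \<le> Re (\<theta> * w (p' k)) + \<epsilon>"
  proof (rule sorted_le_sorted[where X="\<lambda>i. Re (\<theta> * z i)" and Y="\<lambda>i. Re (\<theta> * w i)", OF p(1) p'(1) assms(1) p(3) p'(3) _ \<open>k < d\<close>])
    show "Re (\<theta> * z i) \<le> Re (\<theta> * w (\<tau> i)) + \<epsilon>" if "i < d" for i using le[OF that] by simp
  qed
  moreover have "Re (\<theta> * w (p' k)) \<le> Re (\<theta> * z (p k)) + \<epsilon>"
  proof (rule sorted_le_sorted[where X="\<lambda>i. Re (\<theta> * w i)" and Y="\<lambda>i. Re (\<theta> * z i)", OF p'(1) p(1) permutes_inv[OF assms(1)] p'(3) p(3) _ \<open>k < d\<close>])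
    fix i assume "i < d"
    then have "inv \<tau> i < d" using permutes_in_image[OF permutes_inv[OF assms(1)], of i] by simp
    then show "Re (\<theta> * w i) \<le> Re (\<theta> * z (inv \<tau> i)) + \<epsilon>"
      using le[of "inv \<tau> i"] permutes_inverses(1)[OF assms(1)] by simp
  qed
  ultimately show ?thesis using p(2) p'(2) \<open>k < d\<close> by (simp add: abs_le_iff)
qed

lemma perm_dist_nonneg: "0 \<le> perm_dist d z w \<sigma>"
  by (simp add: perm_dist_def L2_set_nonneg)

lemma norm_le_perm_dist:
  assumes "d \<ge> 1" "i < d"
  shows "cmod (z i - w (\<sigma> i)) \<le> sqrt d * perm_dist d z w \<sigma>"
  using assms member_le_L2_set[of "{..<d}" i "\<lambda>i. cmod (z i - w (\<sigma> i))"] by (simp add: perm_dist_def)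

lemma perm_dist_le:
  assumes "d \<ge> 1" "\<And>i. i < d \<Longrightarrow> cmod (z i - w (\<sigma> i)) \<le> \<epsilon>"
  shows "perm_dist d z w \<sigma> \<le> \<epsilon>"
proof -
  have e: "\<epsilon> \<ge> 0" using order_trans[OF norm_ge_zero assms(2)[of 0]] assms(1) by simp
  have "L2_set (\<lambda>i. cmod (z i - w (\<sigma> i))) {..<d} \<le> L2_set (\<lambda>i. \<epsilon>) {..<d}"
    using assms(2) by (intro L2_set_mono) auto
  also have "\<dots> = sqrt d * \<epsilon>" using e by (simp add: L2_set_def real_sqrt_mult)
  finally show ?thesis using assms(1) by (simp add: perm_dist_def divide_le_eq mult.commute)
qed

lemma finite_permutes [simp]: "finite {\<sigma>. \<sigma> permutes {..<d::nat}}"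
  by (rule finite_permutations) simp

lemma dist_A_le: "\<sigma> permutes {..<d} \<Longrightarrow> dist_A d (unord d z) (unord d w) \<le> perm_dist d z w \<sigma>"
  unfolding dist_A_unord by (rule Min_le) auto

lemma dist_A_attained:
  obtains \<tau> where "\<tau> permutes {..<d}" "perm_dist d z w \<tau> = dist_A d (unord d z) (unord d w)"
proof -
  have "Min (perm_dist d z w ` {\<sigma>. \<sigma> permutes {..<d}}) \<in> perm_dist d z w ` {\<sigma>. \<sigma> permutes {..<d}}"
    by (rule Min_in) (auto intro: permutes_id)
  then show ?thesis using that by (auto simp: dist_A_unord)
qed

lemma dist_A_nonneg: "0 \<le> dist_A d (unord d z) (unord d w)"
  by (metis dist_A_attained perm_dist_nonneg)

text \<open>
  The property of \<^const>\<open>almgren_forms\<close> with its constant made explicit, and with the vectors indexed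
  by pairs, as the differences \<open>z i - w j\<close> of the entries of two tuples are.
\<close>

definition separating :: "nat \<Rightarrow> nat \<Rightarrow> (nat \<Rightarrow> complex) \<Rightarrow> real \<Rightarrow> bool" where
  "separating d h \<theta> \<alpha> \<longleftrightarrow> \<alpha> > 0 \<and> (\<forall>l<h. cmod (\<theta> l) = 1) \<and>
     (\<forall>Z :: nat \<Rightarrow> nat \<Rightarrow> complex. \<exists>l<h. \<forall>i<d. \<forall>j<d. \<alpha> * cmod (Z i j) \<le> \<bar>Re (\<theta> l * Z i j)\<bar>)"

lemma almgren_forms_separating:
  assumes "almgren_forms d h \<theta>"
  obtains \<alpha> where "separating d h \<theta> \<alpha>"
proof -
  obtain \<alpha> where \<alpha>: "\<alpha> > 0" "\<And>z :: nat \<Rightarrow> complex. \<exists>l<h. \<forall>k\<in>{1..d\<^sup>2}. \<bar>Re (\<theta> l * z k)\<bar> \<ge> \<alpha> * cmod (z k)"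
    using assms unfolding almgren_forms_def by blast
  have "\<exists>l<h. \<forall>i<d. \<forall>j<d. \<alpha> * cmod (Z i j) \<le> \<bar>Re (\<theta> l * Z i j)\<bar>" for Z
  proof -
    (* Enumeration of the pairs (i, j) by 1, ..., d^2. *)
    define z where "z k = Z ((k - 1) div d) ((k - 1) mod d)" for k
    obtain l where l: "l < h" "\<forall>k\<in>{1..d\<^sup>2}. \<bar>Re (\<theta> l * z k)\<bar> \<ge> \<alpha> * cmod (z k)" using \<alpha>(2)[of z] by blast
    have "\<alpha> * cmod (Z i j) \<le> \<bar>Re (\<theta> l * Z i j)\<bar>" if "i < d" "j < d" for i j
    proof -
      have "i * d + j + 1 \<le> i * d + d" using that by simp
      also have "\<dots> = Suc i * d" by simp
      also have "\<dots> \<le> d * d" using that by (intro mult_right_mono) auto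
      finally have "i * d + j + 1 \<in> {1..d\<^sup>2}" by (simp add: power2_eq_square)
      moreover have "z (i * d + j + 1) = Z i j" using that by (simp add: z_def)
      ultimately show ?thesis using l(2) by metis
    qed
    with l(1) show ?thesis by blast
  qed
  with \<alpha>(1) assms show ?thesis using that by (auto simp: separating_def almgren_forms_def)
qed

lemma separating_ex_form:
  assumes "separating d h \<theta> \<alpha>" "d \<ge> 1"
  obtains l where "l < h" "\<alpha> * cmod \<zeta> \<le> \<bar>Re (\<theta> l * \<zeta>)\<bar>"
proof -
  obtain l where "l < h" "\<forall>i<d. \<forall>j<d. \<alpha> * cmod \<zeta> \<le> \<bar>Re (\<theta> l * \<zeta>)\<bar>"
    using assms unfolding separating_def by (auto dest!: spec[of _ "\<lambda>_ _. \<zeta>"])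
  with assms(2) that show ?thesis by (metis less_eq_Suc_le One_nat_def)
qed

text \<open>
  The lower Lipschitz bound of the embedding. One of the forms detects all differences \<open>z i - w j\<close>
  at once; sorting both tuples by the values of this form gives the matching.
\<close>

lemma separating_matching:
  assumes "separating d h \<theta> \<alpha>"
    and le: "\<And>l k. l < h \<Longrightarrow> k < d \<Longrightarrow> \<bar>almgren_map (\<theta> l) (unord d z) ! k - almgren_map (\<theta> l) (unord d w) ! k\<bar> \<le> \<epsilon>"
  obtains \<tau> where "\<tau> permutes {..<d}" "\<And>i. i < d \<Longrightarrow> cmod (z i - w (\<tau> i)) \<le> \<epsilon> / \<alpha>"
proof -
  obtain l where l: "l < h" "\<And>i j. i < d \<Longrightarrow> j < d \<Longrightarrow> \<alpha> * cmod (z i - w j) \<le> \<bar>Re (\<theta> l * (z i - w j))\<bar>"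
    using assms(1) unfolding separating_def by (auto dest!: spec[of _ "\<lambda>i j. z i - w j"])
  have "\<alpha> > 0" using assms(1) by (simp add: separating_def)
  obtain p where p: "p permutes {..<d}" "\<And>k. k < d \<Longrightarrow> almgren_map (\<theta> l) (unord d z) ! k = Re (\<theta> l * z (p k))"
    using almgren_map_unord[of d "\<theta> l" z] by metis
  obtain p' where p': "p' permutes {..<d}" "\<And>k. k < d \<Longrightarrow> almgren_map (\<theta> l) (unord d w) ! k = Re (\<theta> l * w (p' k))"
    using almgren_map_unord[of d "\<theta> l" w] by metis
  show ?thesis
  proof (rule that)
    show "(p' \<circ> inv p) permutes {..<d}" by (intro permutes_compose permutes_inv p p')
    fix i assume "i < d"
    define k where "k = inv p i"
    have k: "k < d" "p k = i"
      using permutes_in_image[OF permutes_inv[OF p(1)], of i] \<open>i < d\<close> permutes_inverses(1)[OF p(1)] by (auto simp: k_def)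
    have "p' k < d" using permutes_in_image[OF p'(1), of k] k by simp
    then have "\<alpha> * cmod (z i - w (p' k)) \<le> \<bar>Re (\<theta> l * (z i - w (p' k)))\<bar>" using l(2) \<open>i < d\<close> by blast
    also have "\<dots> \<le> \<epsilon>" using le[OF l(1) k(1)] p(2)[OF k(1)] p'(2)[OF k(1)] k by (simp add: algebra_simps)
    finally show "cmod (z i - w ((p' \<circ> inv p) i)) \<le> \<epsilon> / \<alpha>"
      using \<open>\<alpha> > 0\<close> by (simp add: k_def pos_le_divide_eq mult.commute)
  qed
qed

text \<open>
  Entries of \<open>X\<close> closer than the gap coincide. The entry of \<open>X\<close> in position \<open>k\<close> is close to the one in
  position \<open>k\<close> of \<open>Y\<close>, and that one is close to the entry \<open>m k\<close> of \<open>X\<close> matched with it by \<open>\<tau>\<close>. So these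
  two entries of \<open>X\<close> coincide and carry the same \<open>L\<close>: up to a permutation, comparing the derivatives
  in sorted order is the same as comparing them along \<open>\<tau>\<close>.
\<close>

lemma sorted_derivative_matching:
  fixes X L Y M :: "nat \<Rightarrow> real"
  assumes perm: "p permutes {..<d}" "p' permutes {..<d}" "\<tau> permutes {..<d}"
    and coincide: "\<And>i j. i < d \<Longrightarrow> j < d \<Longrightarrow> X i = X j \<Longrightarrow> L i = L j"
    and gap: "\<And>i j. i < d \<Longrightarrow> j < d \<Longrightarrow> X i \<noteq> X j \<Longrightarrow> 2 * \<epsilon> < \<bar>X i - X j\<bar>"
    and close: "\<And>i. i < d \<Longrightarrow> \<bar>X i - Y (\<tau> i)\<bar> \<le> \<epsilon>" "\<And>k. k < d \<Longrightarrow> \<bar>X (p k) - Y (p' k)\<bar> \<le> \<epsilon>"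
  shows "(\<Sum>k<d. (L (p k) - M (p' k))\<^sup>2) = (\<Sum>i<d. (L i - M (\<tau> i))\<^sup>2)"
proof -
  define m where "m = inv \<tau> \<circ> p'"
  have m: "m permutes {..<d}" unfolding m_def by (intro permutes_compose permutes_inv perm)
  have "(L (p k) - M (p' k))\<^sup>2 = (L (m k) - M (\<tau> (m k)))\<^sup>2" if "k < d" for k
  proof -
    have tm: "\<tau> (m k) = p' k" using permutes_inverses(1)[OF perm(3)] by (simp add: m_def)
    have mk: "m k < d" "p k < d" using permutes_in_image[OF m, of k] permutes_in_image[OF perm(1), of k] that by auto
    have "\<bar>X (p k) - X (m k)\<bar> \<le> 2 * \<epsilon>" using close(1)[OF mk(1)] close(2)[OF that] by (simp add: tm)
    then have "X (p k) = X (m k)" using gap[OF mk(2,1)] by force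
    then have "L (p k) = L (m k)" using coincide[OF mk(2,1)] by simp
    then show ?thesis by (simp add: tm)
  qed
  then have "(\<Sum>k<d. (L (p k) - M (p' k))\<^sup>2) = (\<Sum>k<d. (L (m k) - M (\<tau> (m k)))\<^sup>2)" by (intro sum.cong) auto
  also have "\<dots> = (\<Sum>i<d. (L i - M (\<tau> i))\<^sup>2)"
    using sum.permute[OF m, of "\<lambda>i. (L i - M (\<tau> i))\<^sup>2"] by (simp add: o_def)
  finally show ?thesis .
qed

definition optimal :: "nat \<Rightarrow> (nat \<Rightarrow> complex) \<Rightarrow> (nat \<Rightarrow> complex) \<Rightarrow> (nat \<Rightarrow> nat) set" where
  "optimal d z w = {\<sigma>. \<sigma> permutes {..<d} \<and> perm_dist d z w \<sigma> = dist_A d (unord d z) (unord d w)}"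

lemma linear_order_on_ex_least:
  assumes r: "linear_order_on P r" and "finite T" "T \<noteq> {}" "T \<subseteq> P"
  shows "\<exists>\<tau>\<in>T. \<forall>\<sigma>\<in>T. (\<tau>, \<sigma>) \<in> r"
  using assms(2,3,4)
proof (induction T rule: finite_ne_induct)
  case (singleton x)
  then show ?case using r by (auto simp: linear_order_on_def partial_order_on_def preorder_on_def refl_on_def)
next
  case (insert x F)
  then obtain \<tau> where \<tau>: "\<tau> \<in> F" "\<forall>\<sigma>\<in>F. (\<tau>, \<sigma>) \<in> r" by auto
  have r': "(x, x) \<in> r" "trans r" "x \<noteq> \<tau> \<Longrightarrow> (x, \<tau>) \<in> r \<or> (\<tau>, x) \<in> r"
    using r \<tau> insert.prems
    by (auto simp: linear_order_on_def partial_order_on_def preorder_on_def refl_on_def total_on_def)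
  show ?case
  proof (cases "(\<tau>, x) \<in> r")
    case True
    then show ?thesis using \<tau> by auto
  next
    case False
    then have "(x, \<tau>) \<in> r" using r' by auto
    then have "\<forall>\<sigma>\<in>F. (x, \<sigma>) \<in> r" using \<tau> r'(2) by (meson transE)
    then show ?thesis using r'(1) by auto
  qed
qed

lemma ex_linear_order_on_with_least:
  assumes "finite P" "\<tau> \<in> P"
  obtains r where "linear_order_on P r" "\<And>\<sigma>. \<sigma> \<in> P \<Longrightarrow> (\<tau>, \<sigma>) \<in> r"
proof -
  obtain f :: "'a \<Rightarrow> nat" where f: "inj_on f P" using finite_imp_inj_to_nat_seg[OF assms(1)] by blast
  define g where "g x = (if x = \<tau> then 0 else Suc (f x))" for x
  have g: "inj_on g P" using f by (auto simp: inj_on_def g_def)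
  define r where "r = {(x, y). x \<in> P \<and> y \<in> P \<and> g x \<le> g y}"
  have "linear_order_on P r"
    unfolding linear_order_on_def partial_order_on_def preorder_on_def
  proof (intro conjI)
    show "antisym r" using g by (auto simp: antisym_def r_def inj_on_def)
  qed (auto simp: r_def refl_on_def trans_def total_on_def)
  moreover have "(\<tau>, \<sigma>) \<in> r" if "\<sigma> \<in> P" for \<sigma> using that assms by (auto simp: r_def g_def)
  ultimately show ?thesis using that by blast
qed

text \<open>
  Any total order selects an optimal permutation, and an optimal permutation is selected by the
  orders in which it comes first. So the maximum in \<^const>\<open>s1\<close> ranges over all optimal permutations.
\<close>

lemma least_opt_range:
  "least_opt d z w ` {r. linear_order_on {\<sigma>. \<sigma> permutes {..<d}} r} = optimal d z w"
proof (intro equalityI subsetI)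
  have fin: "finite (optimal d z w)" by (rule finite_subset[of _ "{\<sigma>. \<sigma> permutes {..<d}}"]) (auto simp: optimal_def)
  have lo: "least_opt d z w r = \<tau>" if r: "linear_order_on {\<sigma>. \<sigma> permutes {..<d}} r"
    and \<tau>: "\<tau> \<in> optimal d z w" "\<forall>\<sigma>\<in>optimal d z w. (\<tau>, \<sigma>) \<in> r" for r \<tau>
    unfolding least_opt_def Let_def optimal_def[symmetric]
  proof (rule the_equality)
    show "\<tau> \<in> optimal d z w \<and> (\<forall>\<sigma>\<in>optimal d z w. (\<tau>, \<sigma>) \<in> r)" using \<tau> by blast
    show "\<tau>' = \<tau>" if "\<tau>' \<in> optimal d z w \<and> (\<forall>\<sigma>\<in>optimal d z w. (\<tau>', \<sigma>) \<in> r)" for \<tau>'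
      using that \<tau> r by (auto simp: linear_order_on_def partial_order_on_def antisym_def)
  qed
  show "\<tau> \<in> optimal d z w" if \<tau>: "\<tau> \<in> least_opt d z w ` {r. linear_order_on {\<sigma>. \<sigma> permutes {..<d}} r}" for \<tau>
  proof -
    from \<tau> obtain r where r: "linear_order_on {\<sigma>. \<sigma> permutes {..<d}} r" "\<tau> = least_opt d z w r" by auto
    have "optimal d z w \<noteq> {}" using dist_A_attained[of d z w] by (auto simp: optimal_def)
    then obtain \<tau>' where "\<tau>' \<in> optimal d z w" "\<forall>\<sigma>\<in>optimal d z w. (\<tau>', \<sigma>) \<in> r"
      using linear_order_on_ex_least[OF r(1) fin] by (auto simp: optimal_def)
    then show ?thesis using lo[OF r(1)] r(2) by blast
  qed
  show "\<tau> \<in> least_opt d z w ` {r. linear_order_on {\<sigma>. \<sigma> permutes {..<d}} r}" if \<tau>: "\<tau> \<in> optimal d z w" for \<tau>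
  proof -
    obtain r where r: "linear_order_on {\<sigma>. \<sigma> permutes {..<d}} r" "\<And>\<sigma>. \<sigma> \<in> {\<sigma>. \<sigma> permutes {..<d}} \<Longrightarrow> (\<tau>, \<sigma>) \<in> r"
      using ex_linear_order_on_with_least[OF finite_permutes, of \<tau> d] \<tau> by (auto simp: optimal_def)
    have "least_opt d z w r = \<tau>" using lo[OF r(1) \<tau>] r(2) by (auto simp: optimal_def)
    then show ?thesis using r(1) by blast
  qed
qed

lemma s1_eq_Max:
  assumes "differentiable_A d F x" "differentiable_A d G x"
  shows "s1 d F G x = Max (perm_dist d (D_A d F x) (D_A d G x) ` optimal d (\<lambda>i. F i x) (\<lambda>i. G i x))"
  using assms least_opt_range[of d "\<lambda>i. F i x" "\<lambda>i. G i x"] by (simp add: s1_def image_image[symmetric])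

section \<open>Differentiability of curves of unordered tuples\<close>

lemma has_vector_derivative_iff_norm_le:
  fixes f :: "real \<Rightarrow> 'a::real_normed_vector"
  shows "(f has_vector_derivative D) (at x) \<longleftrightarrow>
    (\<forall>c>0. \<forall>\<^sub>F y in at x. norm (f y - f x - (y - x) *\<^sub>R D) \<le> c * \<bar>y - x\<bar>)" (is "?L \<longleftrightarrow> ?R")
proof -
  have ne: "\<forall>\<^sub>F y in at x. y \<noteq> x" by (simp add: eventually_at_filter)
  have "?L \<longleftrightarrow> ((\<lambda>y. norm (f y - f x - (y - x) *\<^sub>R D) / norm (y - x)) \<longlongrightarrow> 0) (at x)"
    unfolding has_vector_derivative_def has_derivative_iff_norm by (auto intro: bounded_linear_scaleR_left)
  also have "\<dots> \<longleftrightarrow> (\<forall>c>0. \<forall>\<^sub>F y in at x. norm (f y - f x - (y - x) *\<^sub>R D) / norm (y - x) < c)"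
    by (simp add: tendsto_iff dist_real_def)
  also have "\<dots> \<longleftrightarrow> ?R"
  proof (intro iffI allI impI)
    fix c :: real assume *: "\<forall>c>0. \<forall>\<^sub>F y in at x. norm (f y - f x - (y - x) *\<^sub>R D) / norm (y - x) < c" and "c > 0"
    then have "\<forall>\<^sub>F y in at x. norm (f y - f x - (y - x) *\<^sub>R D) / norm (y - x) < c" by blast
    with ne show "\<forall>\<^sub>F y in at x. norm (f y - f x - (y - x) *\<^sub>R D) \<le> c * \<bar>y - x\<bar>"
      by eventually_elim (simp add: pos_divide_less_eq)
  next
    fix c :: real assume *: ?R and "c > 0"
    then have "\<forall>\<^sub>F y in at x. norm (f y - f x - (y - x) *\<^sub>R D) \<le> c / 2 * \<bar>y - x\<bar>" by (meson half_gt_zero)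
    with ne show "\<forall>\<^sub>F y in at x. norm (f y - f x - (y - x) *\<^sub>R D) / norm (y - x) < c"
    proof eventually_elim
      case (elim y)
      then have "c / 2 * \<bar>y - x\<bar> < c * \<bar>y - x\<bar>" using \<open>c > 0\<close> by simp
      with elim show ?case by (simp add: pos_divide_less_eq)
    qed
  qed
  finally show ?thesis .
qed

lemma finite_gap:
  fixes X :: "nat \<Rightarrow> 'a::real_normed_vector"
  obtains \<gamma> where "\<gamma> > 0" "\<And>i j. i < d \<Longrightarrow> j < d \<Longrightarrow> X i \<noteq> X j \<Longrightarrow> \<gamma> \<le> norm (X i - X j)"
proof -
  define S where "S = insert 1 {norm (X i - X j) | i j. i < d \<and> j < d \<and> X i \<noteq> X j}"
  have "S \<subseteq> insert 1 ((\<lambda>(i, j). norm (X i - X j)) ` ({..<d} \<times> {..<d}))" by (auto simp: S_def)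
  then have fin: "finite S" by (rule finite_subset) auto
  have "Min S \<in> S" using fin by (intro Min_in) (auto simp: S_def)
  then have "Min S > 0" by (auto simp: S_def)
  moreover have "Min S \<le> norm (X i - X j)" if "i < d" "j < d" "X i \<noteq> X j" for i j
    using that fin by (intro Min_le) (auto simp: S_def)
  ultimately show ?thesis using that by blast
qed

text \<open>
  The identity permutation bounds the distance by the errors of the branches.
\<close>

lemma has_D_of_vector_derivatives:
  assumes "d \<ge> 1" and D: "\<And>i. i < d \<Longrightarrow> (F i has_vector_derivative L i) (at x0)"
    and co: "\<And>i j. i < d \<Longrightarrow> j < d \<Longrightarrow> F i x0 = F j x0 \<Longrightarrow> L i = L j"
  shows "has_D d F x0 L"
  unfolding has_D_def
proof (intro conjI allI impI landau_o.smallI)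
  fix c :: real assume "c > 0"
  have "\<forall>\<^sub>F x in at x0. \<forall>i\<in>{..<d}. norm (F i x - F i x0 - (x - x0) *\<^sub>R L i) \<le> c * \<bar>x - x0\<bar>"
    using D \<open>c > 0\<close> by (intro eventually_ball_finite) (auto simp: has_vector_derivative_iff_norm_le)
  then show "\<forall>\<^sub>F x in at x0. norm (dist_A d (unord d (\<lambda>i. F i x))
             (unord d (\<lambda>i. F i x0 + L i * complex_of_real (x - x0)))) \<le> c * norm \<bar>x - x0\<bar>"
  proof eventually_elim
    case (elim x)
    have "dist_A d (unord d (\<lambda>i. F i x)) (unord d (\<lambda>i. F i x0 + L i * complex_of_real (x - x0)))
        \<le> perm_dist d (\<lambda>i. F i x) (\<lambda>i. F i x0 + L i * complex_of_real (x - x0)) id"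
      by (rule dist_A_le[OF permutes_id])
    also have "\<dots> \<le> c * \<bar>x - x0\<bar>"
      using elim by (intro perm_dist_le assms(1)) (auto simp: scaleR_conv_of_real algebra_simps)
    finally show ?case using dist_A_nonneg by simp
  qed
qed (rule co)

text \<open>
  Close to \<open>x0\<close> an optimal matching pairs \<open>F i x\<close> only with indices \<open>j\<close> such that \<open>F j x0 = F i x0\<close>,
  and these have \<open>L j = L i\<close>. So the derivatives of a continuous parameterization in the sense of
  unordered tuples are derivatives in the usual sense; in particular they are unique.
\<close>

lemma has_D_imp_vector_derivative:
  assumes "d \<ge> 1" and cont: "\<And>i. i < d \<Longrightarrow> isCont (F i) x0" and D: "has_D d F x0 L" and "i < d"
  shows "(F i has_vector_derivative L i) (at x0)"
  unfolding has_vector_derivative_iff_norm_le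
proof (intro allI impI)
  fix c :: real assume "c > 0"
  let ?dist = "\<lambda>x. dist_A d (unord d (\<lambda>i. F i x)) (unord d (\<lambda>i. F i x0 + L i * complex_of_real (x - x0)))"
  have co: "L i = L j" if "i < d" "j < d" "F i x0 = F j x0" for i j using D that unfolding has_D_def by blast
  obtain \<gamma> where \<gamma>: "\<gamma> > 0" "\<And>i j. i < d \<Longrightarrow> j < d \<Longrightarrow> F i x0 \<noteq> F j x0 \<Longrightarrow> \<gamma> \<le> norm (F i x0 - F j x0)"
    using finite_gap[of d "\<lambda>i. F i x0"] by blast
  have small: "\<forall>\<^sub>F x in at x0. ?dist x \<le> e * \<bar>x - x0\<bar>" if "e > 0" for e
    using D that unfolding has_D_def by (auto dest!: landau_o.smallD[of _ _ _ e] elim!: eventually_mono)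
  define e where "e = c / sqrt d"
  have e: "e > 0" "sqrt d * e = c" using \<open>c > 0\<close> assms(1) by (auto simp: e_def)
  have "\<forall>\<^sub>F x in at x0. \<forall>j\<in>{..<d}. norm (F j x - F j x0) < \<gamma> / 3"
  proof (rule eventually_ball_finite, simp, intro ballI)
    fix j assume "j \<in> {..<d}"
    then have "(F j \<longlongrightarrow> F j x0) (at x0)" using cont by (auto simp: isCont_def)
    then show "\<forall>\<^sub>F x in at x0. norm (F j x - F j x0) < \<gamma> / 3"
      using \<gamma>(1) unfolding tendsto_iff dist_norm by (meson divide_pos_pos zero_less_numeral)
  qed
  moreover have "\<forall>\<^sub>F x in at x0. \<forall>j\<in>{..<d}. norm (L j * complex_of_real (x - x0)) < \<gamma> / 3"
  proof (rule eventually_ball_finite, simp, intro ballI)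
    fix j
    have "((\<lambda>x. norm (L j * complex_of_real (x - x0))) \<longlongrightarrow> norm (L j * complex_of_real (x0 - x0))) (at x0)" by (intro tendsto_intros)
    then show "\<forall>\<^sub>F x in at x0. norm (L j * complex_of_real (x - x0)) < \<gamma> / 3"
      using \<gamma>(1) by (intro order_tendstoD(2)) auto
  qed
  moreover have "\<forall>\<^sub>F x in at x0. c * \<bar>x - x0\<bar> < \<gamma> / 3"
  proof -
    have "((\<lambda>x. c * \<bar>x - x0\<bar>) \<longlongrightarrow> c * \<bar>x0 - x0\<bar>) (at x0)" by (intro tendsto_intros)
    then show ?thesis using \<gamma>(1) by (intro order_tendstoD(2)) auto
  qed
  ultimately show "\<forall>\<^sub>F x in at x0. norm (F i x - F i x0 - (x - x0) *\<^sub>R L i) \<le> c * \<bar>x - x0\<bar>"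
    using small[OF e(1)]
  proof eventually_elim
    case (elim x)
    obtain \<tau> where \<tau>: "\<tau> permutes {..<d}" 
      "perm_dist d (\<lambda>i. F i x) (\<lambda>i. F i x0 + L i * complex_of_real (x - x0)) \<tau> = ?dist x"
      by (rule dist_A_attained)
    define j where "j = \<tau> i"
    have j: "j < d" using permutes_in_image[OF \<tau>(1), of i] \<open>i < d\<close> by (simp add: j_def)
    have "cmod (F i x - (F j x0 + L j * complex_of_real (x - x0))) \<le> sqrt d * ?dist x"
      using norm_le_perm_dist[OF assms(1,4), of "\<lambda>i. F i x" "\<lambda>i. F i x0 + L i * complex_of_real (x - x0)" \<tau>]
      by (simp only: \<tau>(2) j_def)
    also have "\<dots> \<le> sqrt d * (e * \<bar>x - x0\<bar>)" using elim(4) by (intro mult_left_mono) auto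
    also have "\<dots> = c * \<bar>x - x0\<bar>" using e(2) by (simp only: mult.assoc[symmetric])
    finally have le: "cmod (F i x - (F j x0 + L j * complex_of_real (x - x0))) \<le> c * \<bar>x - x0\<bar>" .
    have "F i x0 - F j x0 = - (F i x - F i x0) + L j * complex_of_real (x - x0) + (F i x - (F j x0 + L j * complex_of_real (x - x0)))"
      by simp
    then have "norm (F i x0 - F j x0) \<le> norm (F i x - F i x0) + norm (L j * complex_of_real (x - x0))
        + norm (F i x - (F j x0 + L j * complex_of_real (x - x0)))"
      by (metis norm_minus_cancel norm_triangle_mono norm_triangle_ineq order_refl)
    also have "\<dots> < \<gamma>"
      using bspec[OF elim(1), of i] bspec[OF elim(2), of j] elim(3) le \<open>i < d\<close> j by simp
    finally have "F i x0 = F j x0" using \<gamma>(2)[OF \<open>i < d\<close> j] by force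
    moreover from this have "L i = L j" using co[OF \<open>i < d\<close> j] by simp
    ultimately show ?case using le by (simp add: scaleR_conv_of_real algebra_simps)
  qed
qed

lemma D_A_eq:
  assumes "d \<ge> 1" and D: "\<And>i. i < d \<Longrightarrow> (F i has_vector_derivative L i) (at x0)"
    and co: "\<And>i j. i < d \<Longrightarrow> j < d \<Longrightarrow> F i x0 = F j x0 \<Longrightarrow> L i = L j"
  shows "differentiable_A d F x0" "\<And>i. i < d \<Longrightarrow> D_A d F x0 i = L i"
proof -
  have h: "has_D d F x0 L" by (rule has_D_of_vector_derivatives[OF assms])
  then show "differentiable_A d F x0" by (auto simp: differentiable_A_def)
  have "has_D d F x0 (D_A d F x0)" unfolding D_A_def by (rule someI[of "has_D d F x0", OF h])
  then have "(F i has_vector_derivative D_A d F x0 i) (at x0)" if "i < d" for i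
    using D assms(1) that by (intro has_D_imp_vector_derivative) (auto intro: has_vector_derivative_continuous)
  then show "D_A d F x0 i = L i" if "i < d" for i
    using D that vector_derivative_unique_at by blast
qed

text \<open>
  A zero with nonzero derivative is isolated, so it is the only zero in some interval with
  rational end points.
\<close>

lemma countable_zeros_nonzero_derivative:
  fixes g :: "real \<Rightarrow> real"
  shows "countable {x. g x = 0 \<and> (\<exists>D. D \<noteq> 0 \<and> (g has_field_derivative D) (at x))}" (is "countable ?S")
proof (rule countable_subset)
  let ?T = "\<lambda>(r, s). {x. {y \<in> {r<..<s}. g y = 0} = {x}}"
  show "?S \<subseteq> (\<Union>p\<in>\<rat> \<times> \<rat>. ?T p)"
  proof
    fix x assume "x \<in> ?S"
    then obtain D where x: "g x = 0" "D \<noteq> 0" "(g has_field_derivative D) (at x)" by auto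
    then have "((\<lambda>y. (g y - g x) / (y - x)) \<longlongrightarrow> D) (at x)" by (simp add: has_field_derivative_iff)
    then have "\<forall>\<^sub>F y in at x. (g y - g x) / (y - x) \<noteq> 0" using x(2) by (rule tendsto_imp_eventually_ne)
    then obtain \<delta> where \<delta>: "\<delta> > 0" "\<And>y. y \<noteq> x \<Longrightarrow> dist y x < \<delta> \<Longrightarrow> (g y - g x) / (y - x) \<noteq> 0"
      by (auto simp: eventually_at)
    obtain r where r: "r \<in> \<rat>" "x - \<delta> < r" "r < x" using Rats_dense_in_real[of "x - \<delta>" x] \<delta>(1) by auto
    obtain s where s: "s \<in> \<rat>" "x < s" "s < x + \<delta>" using Rats_dense_in_real[of x "x + \<delta>"] \<delta>(1) by auto
    have "{y \<in> {r<..<s}. g y = 0} = {x}"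
    proof (intro equalityI subsetI)
      fix y assume y: "y \<in> {y \<in> {r<..<s}. g y = 0}"
      then have "dist y x < \<delta>" using r(2,3) s(2,3) by (simp add: dist_real_def) linarith
      then show "y \<in> {x}" using \<delta>(2)[of y] y x(1) by (cases "y = x") simp_all
    qed (use r(3) s(2) x(1) in simp)
    then have "x \<in> ?T (r, s)" by simp
    then show "x \<in> (\<Union>p\<in>\<rat> \<times> \<rat>. ?T p)" using r(1) s(1) by blast
  qed
  have "countable (?T p)" for p
  proof (cases p)
    case (Pair r s)
    have "?T (r, s) \<subseteq> {the_elem {y \<in> {r<..<s}. g y = 0}}"
    proof
      fix x assume "x \<in> ?T (r, s)"
      then have e: "{y \<in> {r<..<s}. g y = 0} = {x}" by simp
      show "x \<in> {the_elem {y \<in> {r<..<s}. g y = 0}}" unfolding e by simp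
    qed
    then have "finite (?T (r, s))" by (rule finite_subset) simp
    then show ?thesis unfolding Pair by (rule countable_finite)
  qed
  then show "countable (\<Union>p\<in>\<rat> \<times> \<rat>. ?T p)" by (intro countable_UN countable_SIGMA) (auto intro: countable_rat)
qed

lemma AE_derivative_zero_on_zeros:
  fixes g v :: "real \<Rightarrow> real"
  assumes "AE x in lebesgue_on S. (g has_field_derivative v x) (at x)" "S \<in> sets lebesgue"
  shows "AE x in lebesgue_on S. g x = 0 \<longrightarrow> v x = 0"
proof -
  let ?N = "{x. g x = 0 \<and> (\<exists>D. D \<noteq> 0 \<and> (g has_field_derivative D) (at x))}"
  have "negligible ?N" using countable_imp_null_set_lborel[OF countable_zeros_nonzero_derivative]
    by (simp add: negligible_iff_null_sets null_sets_completionI)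
  then have "AE x in lebesgue_on S. x \<notin> ?N"
    using assms(2) by (auto simp: AE_lebesgue_on_iff_negligible intro: negligible_subset)
  with assms(1) show ?thesis by eventually_elim blast
qed

section \<open>Selection of orderings\<close>

lemma compact_PiE_UNIV:
  fixes S :: "'i \<Rightarrow> 'b::topological_space set"
  assumes "\<And>i. compact (S i)"
  shows "compact (PiE UNIV S)"
proof -
  have "compactin (product_topology (\<lambda>i. euclidean) UNIV) (PiE UNIV S)"
    unfolding compactin_PiE using assms by simp
  then show ?thesis by (simp add: euclidean_product_topology)
qed

lemma finite_orderings: "finite {z. unord d z = m \<and> (\<forall>i\<ge>d. z i = 0)}"
proof (rule finite_subset)
  show "{z. unord d z = m \<and> (\<forall>i\<ge>d. z i = 0)} \<subseteq> {z. \<forall>i. (i \<in> {..<d} \<longrightarrow> z i \<in> set_mset m) \<and> (i \<notin> {..<d} \<longrightarrow> z i = 0)}"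
    by (auto simp: unord_def)
  show "finite \<dots>" by (rule finite_set_of_finite_funs) auto
qed

lemma unord_cong: "(\<And>i. i < d \<Longrightarrow> z i = w i) \<Longrightarrow> unord d z = unord d w"
  unfolding unord_def by (rule image_mset_cong) auto

text \<open>
  The orderings are chosen from left to right, each matched with the one at the preceding point;
  \<open>add\<close> turns the bounds on neighbours into bounds on all pairs.
\<close>

lemma finite_selection:
  fixes m :: "real \<Rightarrow> complex multiset" and \<rho> :: "real \<Rightarrow> real \<Rightarrow> real"
  assumes "finite X" "X \<subseteq> I"
    and size: "\<And>x. x \<in> I \<Longrightarrow> size (m x) = d"
    and step: "\<And>x y z. x \<in> I \<Longrightarrow> y \<in> I \<Longrightarrow> x \<le> y \<Longrightarrow> unord d z = m x \<Longrightarrow>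
       \<exists>w. unord d w = m y \<and> (\<forall>i<d. cmod (z i - w i) \<le> \<rho> x y)"
    and refl: "\<And>x. x \<in> I \<Longrightarrow> 0 \<le> \<rho> x x"
    and add: "\<And>x y z. x \<in> I \<Longrightarrow> y \<in> I \<Longrightarrow> z \<in> I \<Longrightarrow> x \<le> y \<Longrightarrow> y \<le> z \<Longrightarrow> \<rho> x y + \<rho> y z \<le> \<rho> x z"
  shows "\<exists>G. (\<forall>x\<in>X. unord d (G x) = m x) \<and> (\<forall>x\<in>X. \<forall>y\<in>X. x \<le> y \<longrightarrow> (\<forall>i<d. cmod (G x i - G y i) \<le> \<rho> x y))"
  using assms(1,2)
proof (induction rule: finite_linorder_max_induct)
  case (insert b A)
  then obtain G where G: "\<forall>x\<in>A. unord d (G x) = m x" "\<forall>x\<in>A. \<forall>y\<in>A. x \<le> y \<longrightarrow> (\<forall>i<d. cmod (G x i - G y i) \<le> \<rho> x y)"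
    by auto
  have b: "b \<in> I" "\<forall>a\<in>A. a < b" "A \<subseteq> I" using insert by auto
  have "\<exists>w. unord d w = m b \<and> (\<forall>x\<in>A. \<forall>i<d. cmod (G x i - w i) \<le> \<rho> x b)"
  proof (cases "A = {}")
    case True
    then show ?thesis using unord_surj[OF size[OF b(1)]] by auto
  next
    case False
    define a where "a = Max A"
    have a: "a \<in> A" "\<And>x. x \<in> A \<Longrightarrow> x \<le> a" using insert(1) False by (auto simp: a_def)
    then obtain w where w: "unord d w = m b" "\<forall>i<d. cmod (G a i - w i) \<le> \<rho> a b"
      using step[of a b "G a"] G(1) b by (meson less_imp_le subsetD)
    have "cmod (G x i - w i) \<le> \<rho> x b" if "x \<in> A" "i < d" for x i
    proof -
      have "cmod (G x i - w i) \<le> cmod (G x i - G a i) + cmod (G a i - w i)"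
        using norm_triangle_ineq[of "G x i - G a i" "G a i - w i"] by simp
      also have "\<dots> \<le> \<rho> x a + \<rho> a b" using G(2) w(2) a that by (intro add_mono) auto
      also have "\<dots> \<le> \<rho> x b" using add[of x a b] a that b by (meson less_imp_le subsetD)
      finally show ?thesis .
    qed
    with w(1) show ?thesis by blast
  qed
  then obtain w where w: "unord d w = m b" "\<forall>x\<in>A. \<forall>i<d. cmod (G x i - w i) \<le> \<rho> x b" by blast
  have "b \<notin> A" using b by auto
  show ?case
  proof (intro exI[of _ "G(b := w)"] conjI ballI impI allI)
    show "unord d ((G(b := w)) x) = m x" if "x \<in> insert b A" for x using that G(1) w(1) by auto
    fix x y i assume xy: "x \<in> insert b A" "y \<in> insert b A" "x \<le> y" "i < d"
    consider "x = b" "y = b" | "x \<in> A" "x \<noteq> b" "y = b" | "x \<in> A" "y \<in> A" "x \<noteq> b" "y \<noteq> b"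
      using xy b \<open>b \<notin> A\<close> by (metis insertE not_less)
    then show "cmod ((G(b := w)) x i - (G(b := w)) y i) \<le> \<rho> x y"
      by cases (use refl[OF b(1)] w(2) G(2) xy in auto)
  qed
qed auto

text \<open>
  At each point there are only finitely many orderings, so by Tychonoff's theorem the families of
  orderings form a compact space, in which the bound for a pair of points is a closed
  condition. Finitely many of these conditions can be met by \<open>finite_selection\<close>.
\<close>

theorem selection:
  fixes m :: "real \<Rightarrow> complex multiset" and \<rho> :: "real \<Rightarrow> real \<Rightarrow> real"
  assumes size: "\<And>x. x \<in> I \<Longrightarrow> size (m x) = d"
    and step: "\<And>x y z. x \<in> I \<Longrightarrow> y \<in> I \<Longrightarrow> x \<le> y \<Longrightarrow> unord d z = m x \<Longrightarrow>
       \<exists>w. unord d w = m y \<and> (\<forall>i<d. cmod (z i - w i) \<le> \<rho> x y)"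
    and refl: "\<And>x. x \<in> I \<Longrightarrow> 0 \<le> \<rho> x x"
    and add: "\<And>x y z. x \<in> I \<Longrightarrow> y \<in> I \<Longrightarrow> z \<in> I \<Longrightarrow> x \<le> y \<Longrightarrow> y \<le> z \<Longrightarrow> \<rho> x y + \<rho> y z \<le> \<rho> x z"
  obtains G where "\<And>x. x \<in> I \<Longrightarrow> unord d (G x) = m x"
    "\<And>x y i. x \<in> I \<Longrightarrow> y \<in> I \<Longrightarrow> x \<le> y \<Longrightarrow> i < d \<Longrightarrow> cmod (G x i - G y i) \<le> \<rho> x y"
proof -
  define S where "S x = (if x \<in> I then {z. unord d z = m x \<and> (\<forall>i\<ge>d. z i = 0)} else {\<lambda>_. 0})" for x
  define U where "U = PiE UNIV S"
  have "compact (S x)" for x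
    by (rule finite_imp_compact) (simp add: S_def finite_orderings)
  then have U: "compact U" unfolding U_def by (rule compact_PiE_UNIV)
  define C where "C = (\<lambda>(x, y). {G :: real \<Rightarrow> nat \<Rightarrow> complex. \<forall>i<d. cmod (G x i - G y i) \<le> \<rho> x y})"
  define P where "P = {(x, y). x \<in> I \<and> y \<in> I \<and> x \<le> y}"
  have closed: "closed (C p)" for p
  proof (cases p)
    case (Pair x y)
    have co: "continuous_on UNIV (\<lambda>G :: real \<Rightarrow> nat \<Rightarrow> complex. G x i)" for x i
      by (rule continuous_on_product_then_coordinatewise) simp
    have "closed (\<Inter>i\<in>{..<d}. {G :: real \<Rightarrow> nat \<Rightarrow> complex. cmod (G x i - G y i) \<le> \<rho> x y})"
      by (intro closed_INT ballI closed_Collect_le continuous_intros co)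
    moreover have "C p = (\<Inter>i\<in>{..<d}. {G :: real \<Rightarrow> nat \<Rightarrow> complex. cmod (G x i - G y i) \<le> \<rho> x y})"
      by (auto simp: C_def Pair)
    ultimately show ?thesis by simp
  qed
  have fip: "U \<inter> \<Inter>B \<noteq> {}" if B: "B \<subseteq> C ` P" "finite B" for B
  proof -
    obtain Q where Q: "Q \<subseteq> P" "finite Q" "B = C ` Q" using finite_subset_image[OF B(2,1)] by blast
    define X where "X = fst ` Q \<union> snd ` Q"
    have X: "finite X" "X \<subseteq> I" using Q by (auto simp: X_def P_def)
    obtain G where G: "\<forall>x\<in>X. unord d (G x) = m x" "\<forall>x\<in>X. \<forall>y\<in>X. x \<le> y \<longrightarrow> (\<forall>i<d. cmod (G x i - G y i) \<le> \<rho> x y)"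
      using finite_selection[of X I m d \<rho>, OF X size step refl add] by blast
    have "\<exists>z. unord d z = m x" if "x \<in> I" for x using unord_surj[OF size[OF that]] .
    then obtain Z where Z: "\<And>x. x \<in> I \<Longrightarrow> unord d (Z x) = m x" by metis
    define K where "K x i = (if x \<in> I \<and> i < d then (if x \<in> X then G x i else Z x i) else 0)" for x i
    have "K x \<in> S x" for x
    proof (cases "x \<in> I")
      case True
      have "unord d (K x) = unord d (if x \<in> X then G x else Z x)" using True by (intro unord_cong) (auto simp: K_def)
      also have "\<dots> = m x" using G(1) Z True by auto
      finally show ?thesis using True by (auto simp: S_def K_def)
    qed (auto simp: S_def K_def)
    then have "K \<in> U" by (simp add: U_def PiE_UNIV_domain)
    moreover have "K \<in> C p" if "p \<in> Q" for p
    proof -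
      obtain x y where p: "p = (x, y)" by (cases p)
      then have "x \<in> X" "y \<in> X" "x \<le> y" using that Q(1) by (force simp: X_def P_def)+
      then show ?thesis using G(2) X(2) by (auto simp: C_def p K_def)
    qed
    ultimately show ?thesis using Q(3) by auto
  qed
  have "U \<inter> \<Inter>(C ` P) \<noteq> {}"
    using U unfolding compact_fip using closed fip by blast
  then obtain G where G: "G \<in> U" "\<And>p. p \<in> P \<Longrightarrow> G \<in> C p" by auto
  show ?thesis
  proof (rule that)
    show "unord d (G x) = m x" if "x \<in> I" for x
    proof -
      have "G x \<in> S x" using G(1) by (auto simp: U_def PiE_def Pi_def)
      then show ?thesis using that by (simp add: S_def)
    qed
    show "cmod (G x i - G y i) \<le> \<rho> x y" if "x \<in> I" "y \<in> I" "x \<le> y" "i < d" for x y i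
      using G(2)[of "(x, y)"] that by (auto simp: P_def C_def)
  qed
qed

section \<open>Existence of Sobolev parameterizations\<close>

lemma almgren_map_dist_Lipschitz:
  assumes "d \<ge> 1" "cmod \<theta> = 1" "size m = d" "size m' = d" "k < d"
  shows "\<bar>almgren_map \<theta> m ! k - almgren_map \<theta> m' ! k\<bar> \<le> sqrt d * dist_A d m m'"
proof -
  obtain z w where z: "unord d z = m" "unord d w = m'" using unord_surj assms(3,4) by metis
  obtain \<tau> where \<tau>: "\<tau> permutes {..<d}" "perm_dist d z w \<tau> = dist_A d (unord d z) (unord d w)" by (rule dist_A_attained)
  have "\<bar>almgren_map \<theta> (unord d z) ! k - almgren_map \<theta> (unord d w) ! k\<bar> \<le> sqrt d * dist_A d (unord d z) (unord d w)"
  proof (rule almgren_map_sup_Lipschitz[OF \<tau>(1) _ assms(5)])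
    fix i assume "i < d"
    have "\<bar>Re (\<theta> * z i) - Re (\<theta> * w (\<tau> i))\<bar> = \<bar>Re (\<theta> * (z i - w (\<tau> i)))\<bar>" by (simp add: algebra_simps)
    also have "\<dots> \<le> cmod (z i - w (\<tau> i))" using abs_Re_le_cmod[of "\<theta> * (z i - w (\<tau> i))"] assms(2) by (simp add: norm_mult)
    also have "\<dots> \<le> sqrt d * perm_dist d z w \<tau>" by (rule norm_le_perm_dist[OF assms(1) \<open>i < d\<close>])
    finally show "\<bar>Re (\<theta> * z i) - Re (\<theta> * w (\<tau> i))\<bar> \<le> sqrt d * dist_A d (unord d z) (unord d w)" by (simp only: \<tau>(2))
  qed
  then show ?thesis by (simp only: z)
qed

lemma almgren_emb_index:
  assumes "k < d" "l < h"
  shows "almgren_emb d h \<theta> m (l * d + k) = almgren_map (\<theta> l) m ! k / sqrt h" "l * d + k < d * h"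
proof -
  have "(l * d + k) div d = l" "(l * d + k) mod d = k" using assms by auto
  then show "almgren_emb d h \<theta> m (l * d + k) = almgren_map (\<theta> l) m ! k / sqrt h" unfolding almgren_emb_def by simp
  have "l * d + k < l * d + d" using assms by simp
  also have "\<dots> = Suc l * d" by simp
  also have "\<dots> \<le> h * d" using assms by (intro mult_right_mono) auto
  finally show "l * d + k < d * h" by (simp add: mult.commute)
qed

lemma index_split:
  fixes d h k :: nat
  assumes "k < d * h"
  shows "k div d < h" "k mod d < d" "k = (k div d) * d + k mod d"
proof -
  have "d > 0" using assms by (cases d) auto
  then show "k div d < h" "k mod d < d" "k = (k div d) * d + k mod d"
    using assms by (auto simp: less_mult_imp_div_less mult.commute)
qed

lemma W1_A_coordinate:
  assumes "d \<ge> 1" "separating d h \<theta> \<alpha>" "f \<in> W1_A d h \<theta> q I" "k < d * h"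
  defines "e \<equiv> \<lambda>x. almgren_emb d h \<theta> (f x) k"
  shows "continuous_on I e" "in_Lq q I e" "in_Lq q I (weak_deriv q I e)" "is_weak_deriv I e (weak_deriv q I e)"
proof -
  note k = index_split[OF assms(4)]
  have size: "size (f x) = d" if "x \<in> I" for x using assms(3) that by (simp add: W1_A_def)
  have th: "cmod (\<theta> (k div d)) = 1" using assms(2) k by (simp add: separating_def)
  have "h > 0" using k(1) by simp
  have e: "e x = almgren_map (\<theta> (k div d)) (f x) ! (k mod d) / sqrt h" for x by (simp add: e_def almgren_emb_def)
  show "continuous_on I e" unfolding continuous_on_def
  proof
    fix x assume x: "x \<in> I"
    have lim: "((\<lambda>y. sqrt d * dist_A d (f y) (f x) / sqrt h) \<longlongrightarrow> 0) (at x within I)"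
      using assms(3) x \<open>h > 0\<close> by (auto simp: W1_A_def intro!: tendsto_eq_intros)
    have "\<forall>\<^sub>F y in at x within I. norm (e y - e x) \<le> sqrt d * dist_A d (f y) (f x) / sqrt h"
      unfolding eventually_at_filter
    proof (intro always_eventually allI impI)
      fix y assume "y \<in> I"
      have "norm (e y - e x) = \<bar>almgren_map (\<theta> (k div d)) (f y) ! (k mod d) - almgren_map (\<theta> (k div d)) (f x) ! (k mod d)\<bar> / sqrt h"
        unfolding e by (simp add: diff_divide_distrib[symmetric] abs_divide)
      also have "\<dots> \<le> sqrt d * dist_A d (f y) (f x) / sqrt h"
        by (intro divide_right_mono almgren_map_dist_Lipschitz assms(1) th size x \<open>y \<in> I\<close> k) simp
      finally show "norm (e y - e x) \<le> sqrt d * dist_A d (f y) (f x) / sqrt h" .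
    qed
    then have "((\<lambda>y. e y - e x) \<longlongrightarrow> 0) (at x within I)" using lim by (rule Lim_null_comparison)
    then show "(e \<longlongrightarrow> e x) (at x within I)" by (simp add: LIM_zero_iff)
  qed
  have "e \<in> W1 q I" using assms(3,4) by (simp add: W1_A_def W1_vec_def e_def)
  then show "in_Lq q I e" by (simp add: W1_def)
  have "\<exists>v. in_Lq q I v \<and> is_weak_deriv I e v" using \<open>e \<in> W1 q I\<close> by (simp add: W1_def)
  from someI_ex[OF this] show "in_Lq q I (weak_deriv q I e)" "is_weak_deriv I e (weak_deriv q I e)"
    by (simp_all add: weak_deriv_def)
qed

lemma in_Lq_sum:
  fixes v :: "'i \<Rightarrow> real \<Rightarrow> 'a::euclidean_space"
  assumes "0 \<le> q" "finite K" "\<And>k. k \<in> K \<Longrightarrow> in_Lq q {a<..<b} (v k)"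
  shows "in_Lq q {a<..<b} (\<lambda>x. \<Sum>k\<in>K. v k x)"
  using assms(2,3)
proof (induction K rule: finite_induct)
  case empty
  then show ?case using in_Lq_const[of q a b "0 :: 'a"] by simp
next
  case (insert k K)
  then show ?case using in_Lq_add[OF assms(1), of "{a<..<b}" "v k" "\<lambda>x. \<Sum>k\<in>K. v k x"] by simp
qed

lemma in_Lq_norm:
  assumes "0 \<le> q" "in_Lq q I v"
  shows "in_Lq q I (\<lambda>x. norm (v x))"
  using assms unfolding in_Lq_def by (intro conjI borel_measurable_norm) auto

lemma unord_permute: "\<tau> permutes {..<d} \<Longrightarrow> unord d (\<lambda>i. w (\<tau> i)) = unord d w"
proof -
  assume \<tau>: "\<tau> permutes {..<d}"
  have "image_mset (\<lambda>i. w (\<tau> i)) (mset_set {..<d}) = image_mset w (image_mset \<tau> (mset_set {..<d}))"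
    by (simp add: multiset.map_comp o_def)
  also have "image_mset \<tau> (mset_set {..<d}) = mset_set {..<d}"
    using permutes_image[OF \<tau>] by (subst image_mset_mset_set) (auto intro: inj_on_subset[OF permutes_inj[OF \<tau>]])
  finally show ?thesis by (simp add: unord_def)
qed

text \<open>
  The increments of the coordinates of the embedded curve are dominated by integrals of their weak
  derivatives. The lower Lipschitz bound of the embedding turns this into matchings between the
  values of \<open>f\<close> at any two points, and \<open>selection\<close> makes these matchings consistent. The branches
  inherit the bound on the increments, hence they are Sobolev functions.
\<close>

theorem param_exists:
  assumes "d \<ge> 1" "a < b" "1 \<le> q" and sep: "separating d h \<theta> \<alpha>" and f: "f \<in> W1_A d h \<theta> q {a<..<b}"
  shows "is_param d q {a<..<b} f (param d q {a<..<b} f)"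
proof -
  let ?I = "{a<..<b}"
  have q0: "0 \<le> q" using assms(3) by simp
  have \<alpha>: "\<alpha> > 0" using sep by (simp add: separating_def)
  have size: "size (f x) = d" if "x \<in> ?I" for x using f that by (simp add: W1_A_def)
  define e where "e k = (\<lambda>x. almgren_emb d h \<theta> (f x) k)" for k
  define v where "v k = weak_deriv q ?I (e k)" for k
  have ev: "continuous_on ?I (e k)" "in_Lq q ?I (e k)" "in_Lq q ?I (v k)" "is_weak_deriv ?I (e k) (v k)" if "k < d * h" for k
    using W1_A_coordinate[OF assms(1) sep f that] by (simp_all add: e_def v_def)
  define g where "g x = sqrt h / \<alpha> * (\<Sum>k<d * h. \<bar>v k x\<bar>)" for x
  have gL: "in_Lq q ?I g"
  proof -
    have "in_Lq q ?I (\<lambda>x. \<Sum>k<d * h. \<bar>v k x\<bar>)"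
      using ev(3) q0 by (intro in_Lq_sum) (auto dest!: in_Lq_norm[of q ?I "v _"])
    then show ?thesis unfolding g_def by (rule in_Lq_bounded_linear[OF q0]) (rule bounded_linear_mult_right)
  qed
  have abs_int: "u absolutely_integrable_on {a..b}" if "in_Lq q ?I u" for u :: "real \<Rightarrow> real"
    using in_Lq_integrable[OF assms(3) that] by (simp add: integrable_lebesgue_on_Ioo_iff)
  have int: "u integrable_on {x..y}" if "in_Lq q ?I u" "x \<in> ?I" "y \<in> ?I" for u :: "real \<Rightarrow> real" and x y
    using set_lebesgue_integral_eq_integral(1)[OF abs_int[OF that(1)]] that
    by (auto intro: integrable_on_subinterval)
  have einc: "sqrt h * \<bar>e k y - e k x\<bar> \<le> \<alpha> * integral {x..y} g" if k: "k < d * h" and xy: "x \<in> ?I" "y \<in> ?I" "x \<le> y" for k x y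
  proof -
    obtain c where c: "\<And>x. x \<in> ?I \<Longrightarrow> e k x = c + integral {a..x} (v k)"
      using weak_deriv_integral_representation[OF assms(2) ev(1)[OF k] in_Lq_integrable[OF assms(3) ev(2)[OF k]]
        in_Lq_integrable[OF assms(3) ev(3)[OF k]] ev(4)[OF k]] by blast
    have "e k y - e k x = integral {a..y} (v k) - integral {a..x} (v k)" using c xy by simp
    also have "\<dots> = integral {x..y} (v k)"
      using xy by (intro integral_diff_subinterval[OF set_lebesgue_integral_eq_integral(1)[OF abs_int[OF ev(3)[OF k]]]]) auto
    finally have "\<bar>e k y - e k x\<bar> = \<bar>integral {x..y} (v k)\<bar>" by simp
    also have "\<dots> \<le> integral {x..y} (\<lambda>x. \<alpha> / sqrt h * g x)"
    proof -
      have hpos: "h > 0" using k by (cases h) auto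
      have "norm (integral {x..y} (v k)) \<le> integral {x..y} (\<lambda>x. \<alpha> / sqrt h * g x)"
      proof (rule integral_norm_bound_integral)
        show "v k integrable_on {x..y}" by (rule int[OF ev(3)[OF k] xy(1,2)])
        show "(\<lambda>x. \<alpha> / sqrt h * g x) integrable_on {x..y}" using integrable_cmul[OF int[OF gL xy(1,2)], of "\<alpha> / sqrt h"] by simp
        fix t
        have "norm (v k t) \<le> (\<Sum>k<d * h. \<bar>v k t\<bar>)" using k by (auto intro: member_le_sum)
        also have "\<dots> = \<alpha> / sqrt h * g t" using \<alpha> hpos by (simp add: g_def)
        finally show "norm (v k t) \<le> \<alpha> / sqrt h * g t" .
      qed
      then show ?thesis by simp
    qed
    also have "\<dots> = \<alpha> / sqrt h * integral {x..y} g" by simp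
    finally have *: "\<bar>e k y - e k x\<bar> \<le> \<alpha> / sqrt h * integral {x..y} g" .
    have "sqrt h > 0" using k by (cases h) auto
    with * show ?thesis by (simp add: pos_le_divide_eq mult.commute)
  qed
  obtain G where G: "\<And>x. x \<in> ?I \<Longrightarrow> unord d (G x) = f x"
    "\<And>x y i. x \<in> ?I \<Longrightarrow> y \<in> ?I \<Longrightarrow> x \<le> y \<Longrightarrow> i < d \<Longrightarrow> cmod (G x i - G y i) \<le> integral {x..y} g"
  proof (rule selection[of ?I f d "\<lambda>x y. integral {x..y} g"])
    show "size (f x) = d" if "x \<in> ?I" for x by (rule size[OF that])
    show "0 \<le> integral {x..x} g" for x by simp
    show "integral {x..y} g + integral {y..z} g \<le> integral {x..z} g"
      if "x \<in> ?I" "y \<in> ?I" "z \<in> ?I" "x \<le> y" "y \<le> z" for x y z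
      using Henstock_Kurzweil_Integration.integral_combine[of x y z g] int[OF gL that(1,3)] that by simp
    show "\<exists>w. unord d w = f y \<and> (\<forall>i<d. cmod (z i - w i) \<le> integral {x..y} g)"
      if xy: "x \<in> ?I" "y \<in> ?I" "x \<le> y" and z: "unord d z = f x" for x y z
    proof -
      obtain w where w: "unord d w = f y" using unord_surj[OF size[OF xy(2)]] by blast
      have le: "\<bar>almgren_map (\<theta> l) (unord d z) ! k - almgren_map (\<theta> l) (unord d w) ! k\<bar> \<le> \<alpha> * integral {x..y} g"
        if "l < h" "k < d" for l k
      proof -
        note ix = almgren_emb_index[OF that(2,1)]
        have h: "sqrt h > 0" using that by simp
        have "sqrt h * \<bar>e (l * d + k) y - e (l * d + k) x\<bar> = \<bar>almgren_map (\<theta> l) (f y) ! k - almgren_map (\<theta> l) (f x) ! k\<bar>"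
          unfolding e_def ix(1) using h by (simp add: diff_divide_distrib[symmetric] abs_divide)
        with einc[OF ix(2) xy] show ?thesis by (simp add: z w abs_minus_commute)
      qed
      obtain \<tau> where \<tau>: "\<tau> permutes {..<d}" "\<And>i. i < d \<Longrightarrow> cmod (z i - w (\<tau> i)) \<le> \<alpha> * integral {x..y} g / \<alpha>"
        using separating_matching[OF sep le] by blast
      have "unord d (\<lambda>i. w (\<tau> i)) = f y" using unord_permute[OF \<tau>(1)] w by simp
      with \<tau>(2) \<alpha> show ?thesis by (intro exI[of _ "\<lambda>i. w (\<tau> i)"]) simp
    qed
  qed blast
  have W: "continuous_on ?I (\<lambda>x. G x i) \<and> (\<lambda>x. G x i) \<in> W1 q ?I" if "i < d" for i
  proof -
    have "cmod (G y i - G x i) \<le> integral {x..y} g" if "a < x" "x \<le> y" "y < b" for x y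
      using G(2)[of x y i] that \<open>i < d\<close> by (simp add: norm_minus_commute)
    from dominated_increments_imp_W1[OF assms(2,3) gL this] show ?thesis by blast
  qed
  have "is_param d q ?I f (\<lambda>i x. G x i)" using G(1) W by (simp add: is_param_def)
  then show ?thesis unfolding param_def by (rule someI[of "is_param d q ?I f"])
qed

section \<open>Derivatives of the embedded curve\<close>

text \<open>
  The second condition lets the sorted values of a form be differentiated: branches on which the form
  takes the same value must not separate to first order.
\<close>

definition regular_at :: "nat \<Rightarrow> nat \<Rightarrow> (nat \<Rightarrow> complex) \<Rightarrow> (nat \<Rightarrow> real \<Rightarrow> complex) \<Rightarrow> (nat \<Rightarrow> complex) \<Rightarrow> real \<Rightarrow> bool" where
  "regular_at d h \<theta> F L x \<longleftrightarrow> (\<forall>i<d. (F i has_vector_derivative L i) (at x)) \<and>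
     (\<forall>l<h. \<forall>i<d. \<forall>j<d. Re (\<theta> l * F i x) = Re (\<theta> l * F j x) \<longrightarrow> Re (\<theta> l * L i) = Re (\<theta> l * L j))"

lemma has_derivative_form:
  assumes "(F has_vector_derivative D) (at x)"
  shows "((\<lambda>y. Re (\<theta> * F y)) has_field_derivative Re (\<theta> * D)) (at x)"
proof -
  have "((\<lambda>y. \<theta> * F y) has_vector_derivative \<theta> * D) (at x)" using assms by (rule has_vector_derivative_mult_right)
  then show ?thesis by (simp add: has_vector_derivative_complex_iff)
qed

lemma W1_weak_deriv:
  assumes "u \<in> W1 q I"
  shows "in_Lq q I u" "in_Lq q I (weak_deriv q I u)" "is_weak_deriv I u (weak_deriv q I u)"
proof -
  show "in_Lq q I u" using assms by (simp add: W1_def)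
  have "\<exists>v. in_Lq q I v \<and> is_weak_deriv I u v" using assms by (simp add: W1_def)
  from someI_ex[OF this] show "in_Lq q I (weak_deriv q I u)" "is_weak_deriv I u (weak_deriv q I u)"
    by (simp_all add: weak_deriv_def)
qed

text \<open>
  The difference of the values of a form on two branches has derivative zero at almost all of its zeros.
\<close>

theorem is_param_AE_regular:
  assumes "a < b" "1 \<le> q" and F: "is_param d q {a<..<b} f F"
  shows "AE x in lebesgue_on {a<..<b}. regular_at d h \<theta> F (\<lambda>i. weak_deriv q {a<..<b} (F i) x) x"
proof -
  let ?I = "{a<..<b}" and ?M = "lebesgue_on {a<..<b}"
  define L where "L i = weak_deriv q ?I (F i)" for i
  have Fi: "continuous_on ?I (F i)" "F i \<in> W1 q ?I" if "i < d" for i using F that by (auto simp: is_param_def)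
  have D: "AE x in ?M. (F i has_vector_derivative L i x) (at x)" if "i < d" for i
    unfolding L_def using Fi[OF that] W1_weak_deriv[OF Fi(2)[OF that]] assms(1,2)
    by (intro weak_deriv_AE_derivative_complex in_Lq_integrable[of q]) auto
  have 1: "AE x in ?M. \<forall>i\<in>{..<d}. (F i has_vector_derivative L i x) (at x)"
    using D by (intro AE_finite_allI) auto
  have 2: "AE x in ?M. \<forall>l\<in>{..<h}. \<forall>i\<in>{..<d}. \<forall>j\<in>{..<d}.
      Re (\<theta> l * F i x) - Re (\<theta> l * F j x) = 0 \<longrightarrow> Re (\<theta> l * L i x) - Re (\<theta> l * L j x) = 0"
  proof (intro AE_finite_allI)
    fix l i j assume ij: "i \<in> {..<d}" "j \<in> {..<d}"
    have "AE x in ?M. ((\<lambda>x. Re (\<theta> l * F i x) - Re (\<theta> l * F j x)) has_field_derivative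
        Re (\<theta> l * L i x) - Re (\<theta> l * L j x)) (at x)"
      using 1
    proof eventually_elim
      case (elim x)
      then show ?case using ij by (intro DERIV_diff has_derivative_form) blast+
    qed
    then show "AE x in ?M. Re (\<theta> l * F i x) - Re (\<theta> l * F j x) = 0 \<longrightarrow> Re (\<theta> l * L i x) - Re (\<theta> l * L j x) = 0"
      by (rule AE_derivative_zero_on_zeros) simp
  qed auto
  show ?thesis using 1 2
  proof eventually_elim
    case (elim x)
    show ?case unfolding regular_at_def L_def[symmetric]
    proof (intro conjI allI impI)
      show "(F i has_vector_derivative L i x) (at x)" if "i < d" for i using elim(1) that by blast
      fix l i j assume lij: "l < h" "i < d" "j < d" and eq: "Re (\<theta> l * F i x) = Re (\<theta> l * F j x)"
      have "Re (\<theta> l * F i x) - Re (\<theta> l * F j x) = 0 \<longrightarrow> Re (\<theta> l * L i x) - Re (\<theta> l * L j x) = 0"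
        using elim(2) lij by blast
      with eq show "Re (\<theta> l * L i x) = Re (\<theta> l * L j x)" by linarith
    qed
  qed
qed

lemma regular_at_coincide:
  assumes "separating d h \<theta> \<alpha>" "d \<ge> 1" "regular_at d h \<theta> F L x" "i < d" "j < d" "F i x = F j x"
  shows "L i = L j"
proof -
  obtain l where l: "l < h" "\<alpha> * cmod (L i - L j) \<le> \<bar>Re (\<theta> l * (L i - L j))\<bar>"
    using separating_ex_form[OF assms(1,2), of "L i - L j"] by blast
  have "Re (\<theta> l * L i) = Re (\<theta> l * L j)" using assms(3-6) l(1) unfolding regular_at_def by metis
  then have "\<alpha> * cmod (L i - L j) \<le> 0" using l(2) by (simp add: algebra_simps)
  moreover have "\<alpha> > 0" using assms(1) by (simp add: separating_def)
  ultimately show ?thesis by (simp add: mult_le_0_iff)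
qed

lemma regular_at_D_A:
  assumes "separating d h \<theta> \<alpha>" "d \<ge> 1" "regular_at d h \<theta> F L x"
  shows "differentiable_A d F x" "\<And>i. i < d \<Longrightarrow> D_A d F x i = L i"
proof -
  have *: "(F i has_vector_derivative L i) (at x)" if "i < d" for i using assms(3) that by (simp add: regular_at_def)
  show "differentiable_A d F x" by (rule D_A_eq(1)[OF assms(2) * regular_at_coincide[OF assms]])
  show "D_A d F x i = L i" if "i < d" for i by (rule D_A_eq(2)[OF assms(2) * regular_at_coincide[OF assms] that])
qed

text \<open>
  For \<open>y\<close> close to \<open>x\<close> the sorted value of index \<open>k\<close> is taken on a branch on which the form
  has, at \<open>x\<close>, the same value as on the branch \<open>p k\<close>. By regularity the form has the same derivative
  along all these branches.
\<close>

theorem almgren_map_has_derivative: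
  assumes "d \<ge> 1" "cmod (\<theta> l) = 1" and reg: "regular_at d h \<theta> F L x" and "l < h" "k < d"
    and p: "p permutes {..<d}" "\<And>k. k < d \<Longrightarrow> almgren_map (\<theta> l) (unord d (\<lambda>i. F i x)) ! k = Re (\<theta> l * F (p k) x)"
  shows "((\<lambda>y. almgren_map (\<theta> l) (unord d (\<lambda>i. F i y)) ! k) has_field_derivative Re (\<theta> l * L (p k))) (at x)"
proof -
  define X where "X i y = Re (\<theta> l * F i y)" for i y
  define S where "S y = almgren_map (\<theta> l) (unord d (\<lambda>i. F i y)) ! k" for y
  define D where "D i = Re (\<theta> l * L i)" for i
  have pk: "p k < d" using permutes_in_image[OF p(1), of k] \<open>k < d\<close> by simp
  have Sx: "S x = X (p k) x" using p(2)[OF \<open>k < d\<close>] by (simp add: S_def X_def)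
  have co: "D i = D j" if "i < d" "j < d" "X i x = X j x" for i j
    using reg that \<open>l < h\<close> unfolding regular_at_def D_def X_def by blast
  have der: "(X i has_vector_derivative D i) (at x)" if "i < d" for i
    unfolding D_def X_def[abs_def] has_real_derivative_iff_has_vector_derivative[symmetric]
    by (rule has_derivative_form) (use reg that in \<open>simp add: regular_at_def\<close>)
  obtain \<gamma> where \<gamma>: "\<gamma> > 0" "\<And>i j. i < d \<Longrightarrow> j < d \<Longrightarrow> X i x \<noteq> X j x \<Longrightarrow> \<gamma> \<le> norm (X i x - X j x)"
    using finite_gap[of d "\<lambda>i. X i x"] by blast
  have "\<forall>\<^sub>F y in at x. \<forall>i\<in>{..<d}. norm (X i y - X i x) < \<gamma> / 2"
  proof (rule eventually_ball_finite, simp, intro ballI)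
    fix i assume "i \<in> {..<d}"
    then have "isCont (X i) x" using has_vector_derivative_continuous[OF der] by simp
    then have "(X i \<longlongrightarrow> X i x) (at x)" by (simp add: isCont_def)
    then show "\<forall>\<^sub>F y in at x. norm (X i y - X i x) < \<gamma> / 2"
      using \<gamma>(1) unfolding tendsto_iff dist_norm by (meson half_gt_zero)
  qed
  then have ev: "\<forall>\<^sub>F y in at x. \<exists>j<d. X j x = X (p k) x \<and> S y = X j y"
  proof eventually_elim
    case (elim y)
    obtain p' where p': "p' permutes {..<d}" "S y = X (p' k) y"
      using almgren_map_unord[of d "\<theta> l" "\<lambda>i. F i y"] \<open>k < d\<close> by (auto simp: S_def X_def)
    have j: "p' k < d" using permutes_in_image[OF p'(1), of k] \<open>k < d\<close> by simp
    have "\<bar>S y - S x\<bar> \<le> Max ((\<lambda>i. \<bar>X i y - X i x\<bar>) ` {..<d})"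
      unfolding S_def
    proof (rule almgren_map_sup_Lipschitz[OF permutes_id _ \<open>k < d\<close>])
      fix i assume "i < d"
      then show "\<bar>Re (\<theta> l * F i y) - Re (\<theta> l * F (id i) x)\<bar> \<le> Max ((\<lambda>i. \<bar>X i y - X i x\<bar>) ` {..<d})"
        by (intro Max_ge) (auto simp: X_def)
    qed
    also have "\<dots> < \<gamma> / 2"
    proof (subst Max_less_iff)
      show "(\<lambda>i. \<bar>X i y - X i x\<bar>) ` {..<d} \<noteq> {}" using \<open>k < d\<close> by blast
    qed (use elim in auto)
    finally have "\<bar>X (p' k) y - X (p k) x\<bar> < \<gamma> / 2" by (simp add: p'(2) Sx)
    moreover have "\<bar>X (p' k) y - X (p' k) x\<bar> < \<gamma> / 2" using elim j by auto
    ultimately have "norm (X (p' k) x - X (p k) x) < \<gamma>" unfolding real_norm_def by linarith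
    then have "X (p' k) x = X (p k) x" using \<gamma>(2)[OF j pk] by force
    then show ?case using j p'(2) by blast
  qed
  have "(S has_vector_derivative D (p k)) (at x)"
    unfolding has_vector_derivative_iff_norm_le
  proof (intro allI impI)
    fix c :: real assume "c > 0"
    have "\<forall>\<^sub>F y in at x. \<forall>i\<in>{..<d}. norm (X i y - X i x - (y - x) *\<^sub>R D i) \<le> c * \<bar>y - x\<bar>"
      using der \<open>c > 0\<close> by (intro eventually_ball_finite) (auto simp: has_vector_derivative_iff_norm_le)
    with ev show "\<forall>\<^sub>F y in at x. norm (S y - S x - (y - x) *\<^sub>R D (p k)) \<le> c * \<bar>y - x\<bar>"
    proof eventually_elim
      case (elim y)
      then obtain j where j: "j < d" "X j x = X (p k) x" "S y = X j y" by blast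
      have "D (p k) = D j" using co[OF j(1) pk j(2)] by simp
      then show ?case using bspec[OF elim(2), of j] j by (simp add: Sx)
    qed
  qed
  then show ?thesis unfolding S_def[abs_def] D_def by (simp add: has_real_derivative_iff_has_vector_derivative)
qed

lemma sum_index_split:
  fixes \<phi> :: "nat \<Rightarrow> nat \<Rightarrow> real"
  shows "(\<Sum>k<d * h. \<phi> (k div d) (k mod d)) = (\<Sum>l<h. \<Sum>k<d. \<phi> l k)"
proof -
  have "(\<Sum>k<d * h. \<phi> (k div d) (k mod d)) = (\<Sum>l<h. \<Sum>k = l * d..<l * d + d. \<phi> (k div d) (k mod d))"
    using sum.nat_group[of "\<lambda>k. \<phi> (k div d) (k mod d)" d h] by (simp add: mult.commute)
  also have "\<dots> = (\<Sum>l<h. \<Sum>k<d. \<phi> l k)"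
  proof (rule sum.cong)
    fix l
    have "(\<Sum>k = l * d..<l * d + d. \<phi> (k div d) (k mod d)) = (\<Sum>k = 0..<d. \<phi> ((k + l * d) div d) ((k + l * d) mod d))"
      using sum.shift_bounds_nat_ivl[of "\<lambda>k. \<phi> (k div d) (k mod d)" 0 "l * d" d] by (simp add: add.commute)
    also have "\<dots> = (\<Sum>k<d. \<phi> l k)" by (rule sum.cong) auto
    finally show "(\<Sum>k = l * d..<l * d + d. \<phi> (k div d) (k mod d)) = (\<Sum>k<d. \<phi> l k)" .
  qed simp
  finally show ?thesis .
qed

text \<open>
  No form exceeds the norm, and each entry of \<open>\<zeta>\<close> is detected by one of the forms up to the factor \<open>\<alpha>\<close>.
\<close>

lemma forms_norm_equiv:
  fixes \<zeta> :: "nat \<Rightarrow> complex"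
  assumes sep: "separating d h \<theta> \<alpha>" and "d \<ge> 1"
  shows "sqrt ((\<Sum>l<h. \<Sum>i<d. (Re (\<theta> l * \<zeta> i))\<^sup>2) / h) \<le> L2_set (\<lambda>i. cmod (\<zeta> i)) {..<d}"
    "L2_set (\<lambda>i. cmod (\<zeta> i)) {..<d} \<le> sqrt h / \<alpha> * sqrt ((\<Sum>l<h. \<Sum>i<d. (Re (\<theta> l * \<zeta> i))\<^sup>2) / h)"
proof -
  have \<alpha>: "\<alpha> > 0" using sep by (simp add: separating_def)
  have h: "h > 0" using separating_ex_form[OF assms, of 0] by (metis not_less_zero gr0I)
  have up: "(Re (\<theta> l * \<zeta> i))\<^sup>2 \<le> (cmod (\<zeta> i))\<^sup>2" if "l < h" for l i
  proof -
    have "\<bar>Re (\<theta> l * \<zeta> i)\<bar> \<le> cmod (\<zeta> i)"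
      using abs_Re_le_cmod[of "\<theta> l * \<zeta> i"] sep that by (simp add: norm_mult separating_def)
    then show ?thesis by (simp add: abs_le_square_iff[symmetric])
  qed
  have "(\<Sum>l<h. \<Sum>i<d. (Re (\<theta> l * \<zeta> i))\<^sup>2) \<le> (\<Sum>l<h. \<Sum>i<d. (cmod (\<zeta> i))\<^sup>2)"
    using up by (intro sum_mono) auto
  also have "\<dots> = h * (\<Sum>i<d. (cmod (\<zeta> i))\<^sup>2)" by simp
  finally show "sqrt ((\<Sum>l<h. \<Sum>i<d. (Re (\<theta> l * \<zeta> i))\<^sup>2) / h) \<le> L2_set (\<lambda>i. cmod (\<zeta> i)) {..<d}"
    using h unfolding L2_set_def by (intro real_sqrt_le_mono) (simp add: divide_le_eq mult.commute)
  have low: "\<alpha>\<^sup>2 * (cmod (\<zeta> i))\<^sup>2 \<le> (\<Sum>l<h. (Re (\<theta> l * \<zeta> i))\<^sup>2)" for i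
  proof -
    obtain l where l: "l < h" "\<alpha> * cmod (\<zeta> i) \<le> \<bar>Re (\<theta> l * \<zeta> i)\<bar>"
      using separating_ex_form[OF assms, of "\<zeta> i"] by blast
    then have "(\<alpha> * cmod (\<zeta> i))\<^sup>2 \<le> \<bar>Re (\<theta> l * \<zeta> i)\<bar>\<^sup>2" using \<alpha> by (intro power_mono) auto
    also have "\<dots> = (Re (\<theta> l * \<zeta> i))\<^sup>2" by simp
    also have "\<dots> \<le> (\<Sum>l<h. (Re (\<theta> l * \<zeta> i))\<^sup>2)" using l(1) by (intro member_le_sum) auto
    finally show ?thesis by (simp add: power_mult_distrib)
  qed
  have "\<alpha>\<^sup>2 * (\<Sum>i<d. (cmod (\<zeta> i))\<^sup>2) \<le> (\<Sum>i<d. \<Sum>l<h. (Re (\<theta> l * \<zeta> i))\<^sup>2)"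
    using low by (simp add: sum_distrib_left sum_mono)
  also have "\<dots> = (\<Sum>l<h. \<Sum>i<d. (Re (\<theta> l * \<zeta> i))\<^sup>2)" by (rule sum.swap)
  finally have "(\<Sum>i<d. (cmod (\<zeta> i))\<^sup>2) \<le> (sqrt h / \<alpha>)\<^sup>2 * ((\<Sum>l<h. \<Sum>i<d. (Re (\<theta> l * \<zeta> i))\<^sup>2) / h)"
    using \<alpha> h by (simp add: power_divide pos_le_divide_eq mult.commute)
  then have "sqrt (\<Sum>i<d. (cmod (\<zeta> i))\<^sup>2) \<le> sqrt ((sqrt h / \<alpha>)\<^sup>2 * ((\<Sum>l<h. \<Sum>i<d. (Re (\<theta> l * \<zeta> i))\<^sup>2) / h))"
    by (rule real_sqrt_le_mono)
  also have "\<dots> = sqrt h / \<alpha> * sqrt ((\<Sum>l<h. \<Sum>i<d. (Re (\<theta> l * \<zeta> i))\<^sup>2) / h)"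
    using \<alpha> by (simp only: real_sqrt_mult) simp
  finally show "L2_set (\<lambda>i. cmod (\<zeta> i)) {..<d} \<le> sqrt h / \<alpha> * sqrt ((\<Sum>l<h. \<Sum>i<d. (Re (\<theta> l * \<zeta> i))\<^sup>2) / h)"
    by (simp add: L2_set_def)
qed

section \<open>Pointwise comparison of derivatives\<close>

text \<open>
  The smallest distance between different values of a form on the entries of \<open>z\<close>, capped at 1 by the
  pairs of equal values. It is positive also if all values coincide.
\<close>

definition gap :: "nat \<Rightarrow> nat \<Rightarrow> (nat \<Rightarrow> complex) \<Rightarrow> (nat \<Rightarrow> complex) \<Rightarrow> real" where
  "gap d h \<theta> z = Min ((\<lambda>(l, i, j). if Re (\<theta> l * z i) = Re (\<theta> l * z j) then 1 else \<bar>Re (\<theta> l * z i) - Re (\<theta> l * z j)\<bar>)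
     ` ({..<h} \<times> {..<d} \<times> {..<d}))"

lemma gap_pos: "d \<ge> 1 \<Longrightarrow> h > 0 \<Longrightarrow> gap d h \<theta> z > 0"
  unfolding gap_def by (subst Min_gr_iff) (auto simp: lessThan_empty_iff)

lemma gap_le:
  assumes "l < h" "i < d" "j < d" "Re (\<theta> l * z i) \<noteq> Re (\<theta> l * z j)"
  shows "gap d h \<theta> z \<le> \<bar>Re (\<theta> l * z i) - Re (\<theta> l * z j)\<bar>"
  unfolding gap_def
proof (rule Min_le)
  show "\<bar>Re (\<theta> l * z i) - Re (\<theta> l * z j)\<bar> \<in> (\<lambda>(l, i, j). if Re (\<theta> l * z i) = Re (\<theta> l * z j) then 1 else \<bar>Re (\<theta> l * z i) - Re (\<theta> l * z j)\<bar>)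
     ` ({..<h} \<times> {..<d} \<times> {..<d})"
    by (rule image_eqI[of _ _ "(l, i, j)"]) (use assms in \<open>simp_all del: times_complex.sel\<close>)
qed auto

lemma L2_set_diff_le: "L2_set (\<lambda>i. x i - y i) A \<le> L2_set x A + L2_set y A"
  using L2_set_triangle_ineq[of x "\<lambda>i. - y i" A] by (simp add: L2_set_def)

lemma L2_set_norm_diff_le:
  "L2_set (\<lambda>i. cmod (x i - y i)) A \<le> L2_set (\<lambda>i. cmod (x i)) A + L2_set (\<lambda>i. cmod (y i)) A"
proof -
  have "L2_set (\<lambda>i. cmod (x i - y i)) A \<le> L2_set (\<lambda>i. cmod (x i) + cmod (y i)) A"
    by (intro L2_set_mono norm_triangle_ineq4) auto
  also have "\<dots> \<le> L2_set (\<lambda>i. cmod (x i)) A + L2_set (\<lambda>i. cmod (y i)) A" by (rule L2_set_triangle_ineq)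
  finally show ?thesis .
qed

lemma L2_set_permute: "\<tau> permutes {..<d} \<Longrightarrow> L2_set (\<lambda>i. x (\<tau> i)) {..<d} = L2_set x {..<d}"
  unfolding L2_set_def using sum.permute[of \<tau> "{..<d}" "\<lambda>i. (x i)\<^sup>2"] by (simp add: o_def)

lemma perm_dist_cong:
  assumes "\<sigma> permutes {..<d}" "\<And>i. i < d \<Longrightarrow> z i = z' i" "\<And>i. i < d \<Longrightarrow> w i = w' i"
  shows "perm_dist d z w \<sigma> = perm_dist d z' w' \<sigma>"
proof -
  have "\<sigma> i < d" if "i < d" for i using permutes_in_image[OF assms(1), of i] that by simp
  then have "L2_set (\<lambda>i. cmod (z i - w (\<sigma> i))) {..<d} = L2_set (\<lambda>i. cmod (z' i - w' (\<sigma> i))) {..<d}"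
    by (intro L2_set_cong) (simp_all add: assms(2,3))
  then show ?thesis by (simp only: perm_dist_def)
qed

lemma L2_set_eq_perm_dist: "d \<ge> 1 \<Longrightarrow> L2_set (\<lambda>i. cmod (z i - w (\<sigma> i))) {..<d} = sqrt d * perm_dist d z w \<sigma>"
  by (simp add: perm_dist_def)

lemma s1_regular:
  assumes "separating d h \<theta> \<alpha>" "d \<ge> 1" "regular_at d h \<theta> F L x" "regular_at d h \<theta> G M x"
  obtains \<tau> where "\<tau> \<in> optimal d (\<lambda>i. F i x) (\<lambda>i. G i x)" "s1 d F G x = perm_dist d L M \<tau>"
proof -
  note F = regular_at_D_A[OF assms(1-3)] and G = regular_at_D_A[OF assms(1,2,4)]
  let ?O = "optimal d (\<lambda>i. F i x) (\<lambda>i. G i x)"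
  have "perm_dist d (D_A d F x) (D_A d G x) \<tau> = perm_dist d L M \<tau>" if "\<tau> \<in> ?O" for \<tau>
    using that F(2) G(2) by (intro perm_dist_cong) (auto simp: optimal_def)
  then have "s1 d F G x = Max (perm_dist d L M ` ?O)" by (simp add: s1_eq_Max[OF F(1) G(1)] cong: image_cong)
  moreover have "Max (perm_dist d L M ` ?O) \<in> perm_dist d L M ` ?O"
  proof (rule Max_in)
    have "finite ?O" by (rule finite_subset[of _ "{\<sigma>. \<sigma> permutes {..<d}}"]) (auto simp: optimal_def)
    then show "finite (perm_dist d L M ` ?O)" by simp
    show "perm_dist d L M ` ?O \<noteq> {}" using dist_A_attained[of d "\<lambda>i. F i x" "\<lambda>i. G i x"] by (auto simp: optimal_def)
  qed
  ultimately show ?thesis using that by auto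
qed

text \<open>
  Here \<open>E\<close> is the speed of the difference of the two embedded curves. If the curves are closer at \<open>x\<close>
  than the gap allows, \<open>sorted_derivative_matching\<close> expresses \<open>E\<close> through the differences of the
  derivatives along an optimal matching, and \<open>forms_norm_equiv\<close> gives the comparison. In
  general the triangle inequality leaves an error term with the speed \<open>N\<close> of the first curve.
\<close>

theorem derivative_comparison:
  assumes sep: "separating d h \<theta> \<alpha>" and "d \<ge> 1"
    and F: "regular_at d h \<theta> F L x" and G: "regular_at d h \<theta> G M x"
    and w: "\<And>k. k < d * h \<Longrightarrow> ((\<lambda>y. almgren_emb d h \<theta> (unord d (\<lambda>i. F i y)) k - almgren_emb d h \<theta> (unord d (\<lambda>i. G i y)) k)
              has_field_derivative w k) (at x)"
  defines "E \<equiv> L2_set w {..<d * h}" and "N \<equiv> L2_set (\<lambda>i. cmod (L i)) {..<d}" and "s \<equiv> sqrt d * s1 d F G x"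
  shows "2 * (sqrt d * dist_A d (unord d (\<lambda>i. F i x)) (unord d (\<lambda>i. G i x))) < gap d h \<theta> (\<lambda>i. F i x)
           \<Longrightarrow> E \<le> s \<and> s \<le> sqrt h / \<alpha> * E"
    and "E \<le> 2 * N + s" "s \<le> N + sqrt h / \<alpha> * (N + E)"
proof -
  let ?z = "\<lambda>i. F i x" and ?w = "\<lambda>i. G i x"
  have \<alpha>: "\<alpha> > 0" using sep by (simp add: separating_def)
  have h: "h > 0" using separating_ex_form[OF sep \<open>d \<ge> 1\<close>, of 0] by (metis not_less_zero gr0I)
  have th: "cmod (\<theta> l) = 1" if "l < h" for l using sep that by (simp add: separating_def)
  have "\<forall>l. \<exists>p. p permutes {..<d} \<and> (\<forall>k<d. almgren_map (\<theta> l) (unord d ?z) ! k = Re (\<theta> l * ?z (p k)))"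
    using almgren_map_unord by metis
  then obtain p where p: "\<And>l. p l permutes {..<d}" "\<And>l k. k < d \<Longrightarrow> almgren_map (\<theta> l) (unord d ?z) ! k = Re (\<theta> l * ?z (p l k))"
    by metis
  have "\<forall>l. \<exists>p. p permutes {..<d} \<and> (\<forall>k<d. almgren_map (\<theta> l) (unord d ?w) ! k = Re (\<theta> l * ?w (p k)))"
    using almgren_map_unord by metis
  then obtain p' where p': "\<And>l. p' l permutes {..<d}" "\<And>l k. k < d \<Longrightarrow> almgren_map (\<theta> l) (unord d ?w) ! k = Re (\<theta> l * ?w (p' l k))"
    by metis
  define A where "A l k = Re (\<theta> l * L (p l k))" for l k
  define B where "B l k = Re (\<theta> l * M (p' l k))" for l k
  have wk: "w k = (A (k div d) (k mod d) - B (k div d) (k mod d)) / sqrt h" if k: "k < d * h" for k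
  proof -
    note ks = index_split[OF k]
    let ?l = "k div d" and ?m = "k mod d"
    have dA: "((\<lambda>y. almgren_map (\<theta> ?l) (unord d (\<lambda>i. F i y)) ! ?m) has_field_derivative A ?l ?m) (at x)"
      unfolding A_def
      by (rule almgren_map_has_derivative[OF \<open>d \<ge> 1\<close> th[OF ks(1)] F ks(1,2) p(1)[of ?l] p(2)[of _ ?l]])
    have dB: "((\<lambda>y. almgren_map (\<theta> ?l) (unord d (\<lambda>i. G i y)) ! ?m) has_field_derivative B ?l ?m) (at x)"
      unfolding B_def
      by (rule almgren_map_has_derivative[OF \<open>d \<ge> 1\<close> th[OF ks(1)] G ks(1,2) p'(1)[of ?l] p'(2)[of _ ?l]])
    have "w k = A ?l ?m / sqrt h - B ?l ?m / sqrt h"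
      by (rule DERIV_unique[OF w[OF k, unfolded almgren_emb_def] DERIV_diff[OF DERIV_cdivide[OF dA] DERIV_cdivide[OF dB]]])
    then show ?thesis by (simp only: diff_divide_distrib)
  qed
  have L2: "L2_set (\<lambda>k. X (k div d) (k mod d) / sqrt h) {..<d * h} = sqrt ((\<Sum>l<h. \<Sum>k<d. (X l k)\<^sup>2) / h)" for X :: "nat \<Rightarrow> nat \<Rightarrow> real"
    using sum_index_split[of "\<lambda>l k. (X l k)\<^sup>2" d h] h
    by (simp add: L2_set_def power_divide sum_divide_distrib[symmetric])
  have E_eq: "E = L2_set (\<lambda>k. A (k div d) (k mod d) / sqrt h - B (k div d) (k mod d) / sqrt h) {..<d * h}"
    unfolding E_def by (rule L2_set_cong) (auto simp: wk diff_divide_distrib)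
  then have E_eq': "E = sqrt ((\<Sum>l<h. \<Sum>k<d. (A l k - B l k)\<^sup>2) / h)"
    using L2[of "\<lambda>l k. A l k - B l k"] by (simp add: diff_divide_distrib)
  obtain \<tau> where \<tau>: "\<tau> \<in> optimal d ?z ?w" "s1 d F G x = perm_dist d L M \<tau>" by (rule s1_regular[OF sep \<open>d \<ge> 1\<close> F G])
  have \<tau>p: "\<tau> permutes {..<d}" and \<tau>d: "perm_dist d ?z ?w \<tau> = dist_A d (unord d ?z) (unord d ?w)"
    using \<tau>(1) by (auto simp: optimal_def)
  define \<zeta> where "\<zeta> i = L i - M (\<tau> i)" for i
  have s_eq: "s = L2_set (\<lambda>i. cmod (\<zeta> i)) {..<d}"
    unfolding s_def \<tau>(2) \<zeta>_def using L2_set_eq_perm_dist[OF \<open>d \<ge> 1\<close>] by simp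
  show "E \<le> s \<and> s \<le> sqrt h / \<alpha> * E"
    if near: "2 * (sqrt d * dist_A d (unord d ?z) (unord d ?w)) < gap d h \<theta> ?z"
  proof -
    have "(\<Sum>k<d. (A l k - B l k)\<^sup>2) = (\<Sum>i<d. (Re (\<theta> l * \<zeta> i))\<^sup>2)" if l: "l < h" for l
    proof -
      let ?\<epsilon> = "sqrt d * dist_A d (unord d ?z) (unord d ?w)"
      have c1: "\<bar>Re (\<theta> l * ?z i) - Re (\<theta> l * ?w (\<tau> i))\<bar> \<le> ?\<epsilon>" if "i < d" for i
      proof -
        have "\<bar>Re (\<theta> l * ?z i) - Re (\<theta> l * ?w (\<tau> i))\<bar> = \<bar>Re (\<theta> l * (?z i - ?w (\<tau> i)))\<bar>" by (simp add: algebra_simps)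
        also have "\<dots> \<le> cmod (?z i - ?w (\<tau> i))" using abs_Re_le_cmod[of "\<theta> l * (?z i - ?w (\<tau> i))"] th[OF l] by (simp add: norm_mult)
        also have "\<dots> \<le> sqrt d * perm_dist d ?z ?w \<tau>" by (rule norm_le_perm_dist[OF \<open>d \<ge> 1\<close> that])
        finally show ?thesis by (simp only: \<tau>d)
      qed
      have "(\<Sum>k<d. (A l k - B l k)\<^sup>2) = (\<Sum>i<d. (Re (\<theta> l * L i) - Re (\<theta> l * M (\<tau> i)))\<^sup>2)"
        unfolding A_def B_def
      proof (rule sorted_derivative_matching[where X="\<lambda>i. Re (\<theta> l * ?z i)" and Y="\<lambda>i. Re (\<theta> l * ?w i)" and \<epsilon>="?\<epsilon>"
            and L="\<lambda>i. Re (\<theta> l * L i)" and M="\<lambda>i. Re (\<theta> l * M i)", OF p(1) p'(1) \<tau>p])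
        show "Re (\<theta> l * L i) = Re (\<theta> l * L j)" if "i < d" "j < d" "Re (\<theta> l * ?z i) = Re (\<theta> l * ?z j)" for i j
          using F l that unfolding regular_at_def by blast
        show "2 * ?\<epsilon> < \<bar>Re (\<theta> l * ?z i) - Re (\<theta> l * ?z j)\<bar>" if "i < d" "j < d" "Re (\<theta> l * ?z i) \<noteq> Re (\<theta> l * ?z j)" for i j
          using near gap_le[of l h i d j \<theta> ?z, OF l that] by linarith
        show "\<bar>Re (\<theta> l * ?z i) - Re (\<theta> l * ?w (\<tau> i))\<bar> \<le> ?\<epsilon>" if "i < d" for i by (rule c1[OF that])
        show "\<bar>Re (\<theta> l * ?z (p l k)) - Re (\<theta> l * ?w (p' l k))\<bar> \<le> ?\<epsilon>" if "k < d" for k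
          using almgren_map_sup_Lipschitz[of \<tau> d "\<theta> l" ?z ?w ?\<epsilon> k, OF \<tau>p c1 that] p(2)[OF that, of l] p'(2)[OF that, of l] by simp
      qed
      also have "\<dots> = (\<Sum>i<d. (Re (\<theta> l * \<zeta> i))\<^sup>2)" by (rule sum.cong) (auto simp: \<zeta>_def algebra_simps)
      finally show ?thesis .
    qed
    then have "E = sqrt ((\<Sum>l<h. \<Sum>i<d. (Re (\<theta> l * \<zeta> i))\<^sup>2) / h)" unfolding E_eq' by simp
    with forms_norm_equiv[OF sep \<open>d \<ge> 1\<close>, of \<zeta>] show ?thesis by (simp only: s_eq)
  qed
  define a where "a = L2_set (\<lambda>k. A (k div d) (k mod d) / sqrt h) {..<d * h}"
  define b where "b = L2_set (\<lambda>k. B (k div d) (k mod d) / sqrt h) {..<d * h}"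
  have perm: "(\<Sum>k<d. (Re (\<theta> l * Y (r k)))\<^sup>2) = (\<Sum>i<d. (Re (\<theta> l * Y i))\<^sup>2)" if "r permutes {..<d}" for l r and Y :: "nat \<Rightarrow> complex"
    using sum.permute[OF that, of "\<lambda>i. (Re (\<theta> l * Y i))\<^sup>2"] by (simp add: o_def)
  have a: "a = sqrt ((\<Sum>l<h. \<Sum>i<d. (Re (\<theta> l * L i))\<^sup>2) / h)"
    unfolding a_def by (subst L2) (simp only: A_def perm[OF p(1)])
  have b: "b = sqrt ((\<Sum>l<h. \<Sum>i<d. (Re (\<theta> l * M i))\<^sup>2) / h)"
    unfolding b_def by (subst L2) (simp only: B_def perm[OF p'(1)])
  define NM where "NM = L2_set (\<lambda>i. cmod (M i)) {..<d}"
  have NM: "NM = L2_set (\<lambda>i. cmod (M (\<tau> i))) {..<d}" unfolding NM_def by (rule L2_set_permute[OF \<tau>p, symmetric])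
  have "NM \<le> N + s"
  proof -
    have "NM = L2_set (\<lambda>i. cmod (L i - \<zeta> i)) {..<d}" unfolding NM \<zeta>_def by simp
    also have "\<dots> \<le> N + s" unfolding N_def s_eq by (rule L2_set_norm_diff_le)
    finally show ?thesis .
  qed
  moreover have "E \<le> a + b" unfolding E_eq a_def b_def by (rule L2_set_diff_le)
  moreover have "a \<le> N" "b \<le> NM" unfolding a b N_def NM_def by (rule forms_norm_equiv(1)[OF sep \<open>d \<ge> 1\<close>])+
  ultimately show "E \<le> 2 * N + s" by linarith
  have "b = L2_set (\<lambda>k. A (k div d) (k mod d) / sqrt h - (A (k div d) (k mod d) / sqrt h - B (k div d) (k mod d) / sqrt h)) {..<d * h}"
    unfolding b_def by simp
  also have "\<dots> \<le> a + E" unfolding E_eq a_def by (rule L2_set_diff_le)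
  also have "\<dots> \<le> N + E" using \<open>a \<le> N\<close> by simp
  finally have "sqrt h / \<alpha> * b \<le> sqrt h / \<alpha> * (N + E)" using \<alpha> by (intro mult_left_mono) auto
  moreover have "NM \<le> sqrt h / \<alpha> * b" unfolding b NM_def by (rule forms_norm_equiv(2)[OF sep \<open>d \<ge> 1\<close>])
  moreover have "s \<le> N + NM" unfolding s_eq N_def NM \<zeta>_def by (rule L2_set_norm_diff_le)
  ultimately show "s \<le> N + sqrt h / \<alpha> * (N + E)" by linarith
qed

section \<open>Convergence in Lebesgue spaces\<close>

lemma ennreal_tendsto_0_iff:
  fixes X :: "nat \<Rightarrow> ennreal"
  shows "X \<longlonglongrightarrow> 0 \<longleftrightarrow> (\<forall>c>0. \<forall>\<^sub>F n in sequentially. X n < ennreal c)"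
proof
  assume "X \<longlonglongrightarrow> 0"
  then show "\<forall>c>0. \<forall>\<^sub>F n in sequentially. X n < ennreal c" by (auto intro: order_tendstoD(2))
next
  assume *: "\<forall>c>0. \<forall>\<^sub>F n in sequentially. X n < ennreal c"
  show "X \<longlonglongrightarrow> 0"
  proof (rule order_tendstoI)
    fix u :: ennreal assume "0 < u"
    then obtain c where c: "c > 0" "ennreal c \<le> u"
      by (cases u) (auto simp: top_unique intro: that[of 1])
    from c(1) * have "\<forall>\<^sub>F n in sequentially. X n < ennreal c" by blast
    then show "\<forall>\<^sub>F n in sequentially. X n < u" using c(2) by (auto elim: eventually_mono)
  qed simp
qed

lemma Lq_norm_less_iff:
  assumes "q > 0" "c > 0"
  shows "Lq_norm q I s < ennreal c \<longleftrightarrow> (\<integral>\<^sup>+ x. ennreal (\<bar>s x\<bar> powr q) \<partial>lebesgue_on I) < ennreal (c powr q)"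
proof -
  define J where "J = (\<integral>\<^sup>+ x. ennreal (\<bar>s x\<bar> powr q) \<partial>lebesgue_on I)"
  show ?thesis
  proof (cases "J = \<infinity>")
    case True
    then show ?thesis by (simp add: Lq_norm_def Let_def J_def[symmetric])
  next
    case False
    then obtain r where r: "r \<ge> 0" "J = ennreal r" by (cases J) auto
    have "r powr (1 / q) < c \<longleftrightarrow> r < c powr q"
    proof
      assume "r powr (1 / q) < c"
      then have "(r powr (1 / q)) powr q < c powr q" using assms by (intro powr_less_mono2) auto
      then show "r < c powr q" using assms r by (simp add: powr_powr)
    next
      assume "r < c powr q"
      then have "r powr (1 / q) < (c powr q) powr (1 / q)" using assms r by (intro powr_less_mono2) auto
      then show "r powr (1 / q) < c" using assms by (simp add: powr_powr)
    qed
    then show ?thesis using r assms by (simp add: Lq_norm_def Let_def J_def[symmetric] ennreal_less_iff)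
  qed
qed

lemma Lq_norm_tendsto_0_iff:
  assumes "q > 0"
  shows "(\<lambda>n. Lq_norm q I (s n)) \<longlonglongrightarrow> 0 \<longleftrightarrow> (\<lambda>n. \<integral>\<^sup>+ x. ennreal (\<bar>s n x\<bar> powr q) \<partial>lebesgue_on I) \<longlonglongrightarrow> 0"
    (is "?L \<longleftrightarrow> ?J \<longlonglongrightarrow> 0")
proof
  assume L: ?L
  show "?J \<longlonglongrightarrow> 0" unfolding ennreal_tendsto_0_iff
  proof (intro allI impI)
    fix c :: real assume "c > 0"
    then have c: "c powr (1 / q) > 0" "(c powr (1 / q)) powr q = c" using assms by (auto simp: powr_powr)
    have "\<forall>\<^sub>F n in sequentially. Lq_norm q I (s n) < ennreal (c powr (1 / q))"
      using L c(1) unfolding ennreal_tendsto_0_iff by blast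
    then show "\<forall>\<^sub>F n in sequentially. ?J n < ennreal c"
      by (simp only: Lq_norm_less_iff[OF assms c(1)] c(2))
  qed
next
  assume J: "?J \<longlonglongrightarrow> 0"
  show ?L unfolding ennreal_tendsto_0_iff
  proof (intro allI impI)
    fix c :: real assume "c > 0"
    then have "c powr q > 0" by simp
    then have "\<forall>\<^sub>F n in sequentially. ?J n < ennreal (c powr q)"
      using J unfolding ennreal_tendsto_0_iff by blast
    then show "\<forall>\<^sub>F n in sequentially. Lq_norm q I (s n) < ennreal c"
      by (simp only: Lq_norm_less_iff[OF assms \<open>c > 0\<close>])
  qed
qed

text \<open>
  The integral of a nonnegative function is a supremum over simple functions below it, so it is
  subadditive as soon as one of the two summands is measurable. In the application the
  measurable summand is \<open>G\<close>, and \<open>A\<close> or \<open>B\<close> comes from \<^const>\<open>s1\<close>.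
\<close>

lemma nn_integral_le_cmult_add:
  fixes A B G :: "'a \<Rightarrow> ennreal"
  assumes G: "G \<in> borel_measurable M" and c: "c > 0"
    and le: "AE x in M. A x \<le> ennreal c * (B x + G x)"
  shows "(\<integral>\<^sup>+x. A x \<partial>M) \<le> ennreal c * ((\<integral>\<^sup>+x. B x \<partial>M) + (\<integral>\<^sup>+x. G x \<partial>M))"
proof -
  have "(\<integral>\<^sup>+x. A x \<partial>M) \<le> (\<integral>\<^sup>+x. ennreal c * (B x + G x) \<partial>M)" by (rule nn_integral_mono_AE[OF le])
  also have "\<dots> \<le> ennreal c * ((\<integral>\<^sup>+x. B x \<partial>M) + (\<integral>\<^sup>+x. G x \<partial>M))"
    unfolding nn_integral_def_finite[of M "\<lambda>x. ennreal c * (B x + G x)"]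
  proof (rule SUP_least)
    fix s assume "s \<in> {g. simple_function M g \<and> g \<le> (\<lambda>x. ennreal c * (B x + G x)) \<and> (\<forall>x. g x < top)}"
    then have s: "simple_function M s" "\<And>x. s x \<le> ennreal c * (B x + G x)" "\<And>x. s x < top" by (auto simp: le_fun_def)
    have [measurable]: "s \<in> borel_measurable M" by (rule borel_measurable_simple_function[OF s(1)])
    (* Truncated subtraction of G leaves a measurable function below B. *)
    define t where "t x = ennreal (1 / c) * s x" for x
    have ts: "ennreal c * t x = s x" for x
      using c by (simp add: t_def mult.assoc[symmetric] ennreal_mult[symmetric])
    have tB: "t x - G x \<le> B x" for x
    proof -
      have "t x \<le> ennreal (1 / c) * (ennreal c * (B x + G x))" unfolding t_def using s(2) by (intro mult_left_mono) auto
      also have "\<dots> = B x + G x" using c by (simp add: mult.assoc[symmetric] ennreal_mult[symmetric])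
      finally have "t x \<le> G x + B x" by (simp add: add.commute)
      moreover have "t x \<noteq> top" using s(3)[of x] by (auto simp: t_def ennreal_mult_eq_top_iff)
      ultimately show ?thesis by (simp add: ennreal_minus_le_iff)
    qed
    have "integral\<^sup>S M s = (\<integral>\<^sup>+x. s x \<partial>M)" by (rule nn_integral_eq_simple_integral[OF s(1), symmetric])
    also have "\<dots> = ennreal c * (\<integral>\<^sup>+x. t x \<partial>M)"
      unfolding ts[symmetric] by (rule nn_integral_cmult) (simp add: t_def)
    also have "(\<integral>\<^sup>+x. t x \<partial>M) \<le> (\<integral>\<^sup>+x. (t x - G x) + G x \<partial>M)"
      by (rule nn_integral_mono) (metis add.commute ennreal_minus_le_iff order_refl le_add2 add_diff_eq_ennreal diff_add_cancel_ennreal linear ennreal_diff_le_mono_left diff_eq_0_iff_ennreal)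
    also have "\<dots> = (\<integral>\<^sup>+x. t x - G x \<partial>M) + (\<integral>\<^sup>+x. G x \<partial>M)"
      using G by (intro nn_integral_add) (auto simp: t_def)
    also have "\<dots> \<le> (\<integral>\<^sup>+x. B x \<partial>M) + (\<integral>\<^sup>+x. G x \<partial>M)" using tB by (intro add_right_mono nn_integral_mono) auto
    finally show "integral\<^sup>S M s \<le> ennreal c * ((\<integral>\<^sup>+x. B x \<partial>M) + (\<integral>\<^sup>+x. G x \<partial>M))"
      by (simp add: mult_left_mono)
  qed
  finally show ?thesis .
qed

lemma Lq_norm_tendsto_0_transfer:
  fixes A B G :: "nat \<Rightarrow> real \<Rightarrow> real"
  assumes "1 \<le> q" "C > 0"
    and le: "\<And>n. AE x in lebesgue_on I. \<bar>A n x\<bar> \<le> C * (\<bar>B n x\<bar> + \<bar>G n x\<bar>)"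
    and G: "\<And>n. G n \<in> borel_measurable (lebesgue_on I)"
    and B0: "(\<lambda>n. Lq_norm q I (B n)) \<longlonglongrightarrow> 0" and G0: "(\<lambda>n. Lq_norm q I (G n)) \<longlonglongrightarrow> 0"
  shows "(\<lambda>n. Lq_norm q I (A n)) \<longlonglongrightarrow> 0"
proof -
  have q: "q > 0" using assms by simp
  define J where "J u = (\<integral>\<^sup>+ x. ennreal (\<bar>u x\<bar> powr q) \<partial>lebesgue_on I)" for u :: "real \<Rightarrow> real"
  define K where "K = C powr q * 2 powr q"
  have K: "K > 0" using assms by (simp add: K_def)
  have "J (A n) \<le> ennreal K * (J (B n) + J (G n))" for n
    unfolding J_def
  proof (rule nn_integral_le_cmult_add[OF _ K])
    show "(\<lambda>x. ennreal (\<bar>G n x\<bar> powr q)) \<in> borel_measurable (lebesgue_on I)" using G by measurable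
    show "AE x in lebesgue_on I. ennreal (\<bar>A n x\<bar> powr q) \<le> ennreal K * (ennreal (\<bar>B n x\<bar> powr q) + ennreal (\<bar>G n x\<bar> powr q))"
      using le[of n]
    proof eventually_elim
      case (elim x)
      have "\<bar>A n x\<bar> powr q \<le> (C * (\<bar>B n x\<bar> + \<bar>G n x\<bar>)) powr q" using elim q by (intro powr_mono2) auto
      also have "\<dots> = C powr q * (\<bar>B n x\<bar> + \<bar>G n x\<bar>) powr q" using assms by (simp add: powr_mult)
      also have "\<dots> \<le> C powr q * (2 powr q * (\<bar>B n x\<bar> powr q + \<bar>G n x\<bar> powr q))"
        using q by (intro mult_left_mono add_powr_le) auto
      also have "\<dots> = K * (\<bar>B n x\<bar> powr q + \<bar>G n x\<bar> powr q)" by (simp add: K_def)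
      finally have "ennreal (\<bar>A n x\<bar> powr q) \<le> ennreal (K * (\<bar>B n x\<bar> powr q + \<bar>G n x\<bar> powr q))" by (rule ennreal_leI)
      then show ?case using K by (simp add: ennreal_mult)
    qed
  qed
  moreover have "(\<lambda>n. ennreal K * (J (B n) + J (G n))) \<longlonglongrightarrow> ennreal K * (0 + 0)"
    using B0 G0 unfolding Lq_norm_tendsto_0_iff[OF q] J_def[symmetric]
    by (intro ennreal_tendsto_cmult tendsto_add) auto
  ultimately have "(\<lambda>n. J (A n)) \<longlonglongrightarrow> 0"
    by (intro tendsto_sandwich[of "\<lambda>_. 0" "\<lambda>n. J (A n)" sequentially "\<lambda>n. ennreal K * (J (B n) + J (G n))" 0]) auto
  then show ?thesis unfolding Lq_norm_tendsto_0_iff[OF q] J_def .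
qed

text \<open>
  Dominated convergence, with \<open>N\<close> as majorant.
\<close>

lemma Lq_norm_tendsto_0_eventually_zero:
  fixes N :: "real \<Rightarrow> real"
  assumes "1 \<le> q" and N: "in_Lq q I N" and P: "\<And>n. {x \<in> space (lebesgue_on I). P n x} \<in> sets (lebesgue_on I)"
    and ev: "AE x in lebesgue_on I. \<forall>\<^sub>F n in sequentially. P n x"
  shows "(\<lambda>n. Lq_norm q I (\<lambda>x. if P n x then 0 else N x)) \<longlonglongrightarrow> 0"
proof -
  have q: "q > 0" using assms by simp
  have [measurable]: "N \<in> borel_measurable (lebesgue_on I)" using N by (simp add: in_Lq_def)
  have "(\<lambda>n. \<integral>\<^sup>+ x. ennreal (\<bar>if P n x then 0 else N x\<bar> powr q) \<partial>lebesgue_on I) \<longlonglongrightarrow> (\<integral>\<^sup>+ x. 0 \<partial>lebesgue_on I)"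
  proof (rule nn_integral_dominated_convergence[where w="\<lambda>x. ennreal (\<bar>N x\<bar> powr q)"])
    show "(\<lambda>x. ennreal (\<bar>if P n x then 0 else N x\<bar> powr q)) \<in> borel_measurable (lebesgue_on I)" for n
      using P[of n] by measurable
    show "AE x in lebesgue_on I. ennreal (\<bar>if P n x then 0 else N x\<bar> powr q) \<le> ennreal (\<bar>N x\<bar> powr q)" for n
      by (rule AE_I2) (auto intro!: ennreal_leI)
    show "(\<integral>\<^sup>+ x. ennreal (\<bar>N x\<bar> powr q) \<partial>lebesgue_on I) < \<infinity>"
      using N unfolding in_Lq_def by (auto dest!: integrableD(2) simp: top.not_eq_extremum)
    show "AE x in lebesgue_on I. (\<lambda>n. ennreal (\<bar>if P n x then 0 else N x\<bar> powr q)) \<longlonglongrightarrow> 0"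
      using ev
    proof eventually_elim
      case (elim x)
      then have "\<forall>\<^sub>F n in sequentially. ennreal (\<bar>if P n x then 0 else N x\<bar> powr q) = 0"
        by eventually_elim simp
      then show ?case by (rule tendsto_eventually)
    qed
  qed auto
  then show ?thesis unfolding Lq_norm_tendsto_0_iff[OF q] by simp
qed

lemma Lq_norm_tendsto_0_uniform:
  assumes "1 \<le> q" and u: "\<And>c. c > 0 \<Longrightarrow> \<forall>\<^sub>F n in sequentially. AE x in lebesgue_on {a<..<b}. \<bar>s n x\<bar> \<le> c" and "a < b"
  shows "(\<lambda>n. Lq_norm q {a<..<b} (s n)) \<longlonglongrightarrow> 0"
  unfolding ennreal_tendsto_0_iff
proof (intro allI impI)
  have q: "q > 0" using assms by simp
  fix c :: real assume c: "c > 0"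
  define l where "l = b - a"
  have l: "l > 0" using \<open>a < b\<close> by (simp add: l_def)
  define K where "K = c powr q / (2 * l)"
  have K: "K > 0" "K * l = c powr q / 2" using c l by (simp_all add: K_def)
  define c' where "c' = K powr (1 / q)"
  have c': "c' > 0" "c' powr q = K" using K q by (auto simp: c'_def powr_powr)
  show "\<forall>\<^sub>F n in sequentially. Lq_norm q {a<..<b} (s n) < ennreal c"
    using u[OF c'(1)]
  proof eventually_elim
    case (elim n)
    have "(\<integral>\<^sup>+ x. ennreal (\<bar>s n x\<bar> powr q) \<partial>lebesgue_on {a<..<b}) \<le> (\<integral>\<^sup>+ x. ennreal K \<partial>lebesgue_on {a<..<b})"
    proof (rule nn_integral_mono_AE)
      show "AE x in lebesgue_on {a<..<b}. ennreal (\<bar>s n x\<bar> powr q) \<le> ennreal K"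
        using elim
      proof eventually_elim
        case (elim x)
        then have "\<bar>s n x\<bar> powr q \<le> c' powr q" using q by (intro powr_mono2) auto
        then show ?case using c'(2) by (simp add: ennreal_leI)
      qed
    qed
    also have "\<dots> = ennreal (K * l)"
      using \<open>a < b\<close> K(1) by (simp add: emeasure_restrict_space ennreal_mult l_def)
    also have "\<dots> < ennreal (c powr q)" unfolding K(2) using c by (intro ennreal_lessI) simp_all
    finally show ?case using Lq_norm_less_iff[OF q c] by blast
  qed
qed

text \<open>
  A substitute for Hoelder's inequality: it makes an \<open>L\<^sup>1\<close> norm small when the \<open>L\<^sup>q\<close> norm tends to 0.
\<close>

lemma le_power_interpolation:
  fixes t :: real
  assumes "1 \<le> q" "\<epsilon> > 0" "t \<ge> 0"
  shows "t \<le> \<epsilon> + \<epsilon> powr (1 - q) * t powr q"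
proof (cases "t \<le> \<epsilon>")
  case False
  then have t: "t > \<epsilon>" by simp
  have "(t / \<epsilon>) powr 1 \<le> (t / \<epsilon>) powr q" using assms t by (intro powr_mono) auto
  then have "t \<le> \<epsilon> * (t / \<epsilon>) powr q" using assms t by (simp add: field_simps)
  also have "\<dots> = \<epsilon> powr (1 - q) * t powr q" using assms t by (simp add: powr_divide powr_diff)
  finally show ?thesis using assms by simp
qed (simp add: add_increasing2)

text \<open>
  Average \<open>\<bar>u x\<bar> \<le> \<bar>u y\<bar> + \<integral> \<bar>w\<bar>\<close> over \<open>y\<close>, and apply \<open>le_power_interpolation\<close> to both terms.
\<close>

lemma W1_sup_bound:
  fixes u w :: "real \<Rightarrow> real"
  assumes "a < b" "1 \<le> q" "\<epsilon> > 0" and u: "continuous_on {a<..<b} u" "in_Lq q {a<..<b} u"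
    and w: "in_Lq q {a<..<b} w" "is_weak_deriv {a<..<b} u w" and x: "x \<in> {a<..<b}"
  shows "(b - a) * \<bar>u x\<bar> \<le> \<epsilon> * (b - a) * (1 + (b - a)) + \<epsilon> powr (1 - q) *
    ((LINT y|lebesgue_on {a<..<b}. \<bar>u y\<bar> powr q) + (b - a) * (LINT y|lebesgue_on {a<..<b}. \<bar>w y\<bar> powr q))"
proof -
  let ?M = "lebesgue_on {a<..<b}"
  interpret finite_measure ?M by (rule finite_measure_lebesgue_on_Ioo)
  have meas: "measure ?M (space ?M) = b - a" using \<open>a < b\<close> by (simp add: measure_restrict_space)
  have uM: "integrable ?M u" and wM: "integrable ?M w" using in_Lq_integrable assms(2) u(2) w(1) by blast+
  define Jw where "Jw = (LINT y|?M. \<bar>w y\<bar>)"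
  have L1: "(LINT y|?M. \<bar>v y\<bar>) \<le> \<epsilon> * (b - a) + \<epsilon> powr (1 - q) * (LINT y|?M. \<bar>v y\<bar> powr q)" if v: "in_Lq q {a<..<b} v" for v :: "real \<Rightarrow> real"
  proof -
    have vq: "integrable ?M (\<lambda>y. \<bar>v y\<bar> powr q)" using v by (simp add: in_Lq_def)
    have "(LINT y|?M. \<bar>v y\<bar>) \<le> (LINT y|?M. \<epsilon> + \<epsilon> powr (1 - q) * \<bar>v y\<bar> powr q)"
      using in_Lq_integrable[OF assms(2) v] vq le_power_interpolation[OF assms(2,3)] by (intro integral_mono) auto
    also have "\<dots> = \<epsilon> * (b - a) + \<epsilon> powr (1 - q) * (LINT y|?M. \<bar>v y\<bar> powr q)" using vq meas by simp
    finally show ?thesis .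
  qed
  obtain c where c: "\<And>x. x \<in> {a<..<b} \<Longrightarrow> u x = c + integral {a..x} w"
    using weak_deriv_integral_representation[OF assms(1) u(1) uM wM w(2)] by blast
  have wa: "w absolutely_integrable_on {a..b}" using wM by (simp add: integrable_lebesgue_on_Ioo_iff)
  then have wi: "w integrable_on {a..b}" "(\<lambda>x. \<bar>w x\<bar>) integrable_on {a..b}" by (auto simp: absolutely_integrable_on_def)
  have Jw_eq: "Jw = integral {a..b} (\<lambda>x. \<bar>w x\<bar>)"
    unfolding Jw_def using wa by (intro LINT_lebesgue_on_Ioo) (simp add: set_integrable_abs)
  have inc: "\<bar>integral {s..t} w\<bar> \<le> Jw" if "a \<le> s" "t \<le> b" for s t
  proof -
    have sub: "w integrable_on {s..t}" "(\<lambda>x. \<bar>w x\<bar>) integrable_on {s..t}"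
      using wi that by (auto intro: integrable_on_subinterval)
    have "norm (integral {s..t} w) \<le> integral {s..t} (\<lambda>x. \<bar>w x\<bar>)" using sub by (intro integral_norm_bound_integral) auto
    also have "\<dots> \<le> integral {a..b} (\<lambda>x. \<bar>w x\<bar>)" using sub wi that by (intro integral_subset_le) auto
    finally show ?thesis by (simp add: Jw_eq)
  qed
  have diff: "\<bar>u x\<bar> \<le> \<bar>u y\<bar> + Jw" if y: "y \<in> {a<..<b}" for y
  proof -
    have "\<bar>u x - u y\<bar> \<le> Jw"
    proof (cases "x \<le> y")
      case True
      then have "u y - u x = integral {x..y} w"
        using c[OF x] c[OF y] integral_diff_subinterval[OF wi(1), of x y] x y by simp
      then show ?thesis using inc[of x y] x y by (simp add: abs_minus_commute)
    next
      case False
      then have "u x - u y = integral {y..x} w"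
        using c[OF x] c[OF y] integral_diff_subinterval[OF wi(1), of y x] x y by simp
      then show ?thesis using inc[of y x] x y by simp
    qed
    then show ?thesis by linarith
  qed
  have "(b - a) * \<bar>u x\<bar> = (LINT y|?M. \<bar>u x\<bar>)" using meas by simp
  also have "\<dots> \<le> (LINT y|?M. \<bar>u y\<bar> + Jw)"
    using uM diff by (intro integral_mono_AE AE_I2) (auto simp: space_restrict_space)
  also have "\<dots> = (LINT y|?M. \<bar>u y\<bar>) + (b - a) * Jw" using uM meas by simp
  also have "\<dots> \<le> (\<epsilon> * (b - a) + \<epsilon> powr (1 - q) * (LINT y|?M. \<bar>u y\<bar> powr q))
      + (b - a) * (\<epsilon> * (b - a) + \<epsilon> powr (1 - q) * (LINT y|?M. \<bar>w y\<bar> powr q))"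
    unfolding Jw_def using L1[OF u(2)] L1[OF w(1)] \<open>a < b\<close> by (intro add_mono mult_left_mono) auto
  also have "\<dots> = \<epsilon> * (b - a) * (1 + (b - a)) + \<epsilon> powr (1 - q) *
    ((LINT y|?M. \<bar>u y\<bar> powr q) + (b - a) * (LINT y|?M. \<bar>w y\<bar> powr q))" by (simp add: algebra_simps)
  finally show ?thesis .
qed

text \<open>
  The Sobolev embedding in dimension one: the first term in \<open>W1_sup_bound\<close> is made small by the choice
  of \<open>\<epsilon>\<close>, and then the second one by letting \<open>n\<close> tend to infinity.
\<close>

theorem W1_tendsto_0_uniformly:
  fixes u w :: "nat \<Rightarrow> real \<Rightarrow> real"
  assumes "a < b" "1 \<le> q" and u: "\<And>n. continuous_on {a<..<b} (u n)" "\<And>n. in_Lq q {a<..<b} (u n)"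
    and w: "\<And>n. in_Lq q {a<..<b} (w n)" "\<And>n. is_weak_deriv {a<..<b} (u n) (w n)"
    and u0: "(\<lambda>n. Lq_norm q {a<..<b} (u n)) \<longlonglongrightarrow> 0" and w0: "(\<lambda>n. Lq_norm q {a<..<b} (w n)) \<longlonglongrightarrow> 0"
    and "c > 0"
  shows "\<forall>\<^sub>F n in sequentially. \<forall>x\<in>{a<..<b}. \<bar>u n x\<bar> \<le> c"
proof -
  have q: "q > 0" using assms(2) by simp
  define l where "l = b - a"
  have l: "l > 0" using \<open>a < b\<close> by (simp add: l_def)
  (* The constants \<epsilon> and \<kappa> make each of the two parts of W1_sup_bound equal to l * c / 2. *)
  define \<epsilon> where "\<epsilon> = c / (2 * (1 + l))"
  have \<epsilon>: "\<epsilon> > 0" "\<epsilon> * l * (1 + l) = l * c / 2" using \<open>c > 0\<close> l by (auto simp: \<epsilon>_def field_simps)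
  define K where "K = \<epsilon> powr (1 - q)"
  have K: "K > 0" using \<epsilon> by (simp add: K_def)
  define P where "P = K * (1 + l)"
  have P: "P > 0" using K l by (simp add: P_def)
  define \<kappa> where "\<kappa> = l * c / (2 * P)"
  have \<kappa>: "\<kappa> > 0" using \<open>c > 0\<close> l P by (simp add: \<kappa>_def)
  have P\<kappa>: "K * (\<kappa> + l * \<kappa>) = l * c / 2"
  proof -
    have "K * (\<kappa> + l * \<kappa>) = P * \<kappa>" by (simp add: P_def algebra_simps)
    also have "\<dots> = l * c / 2" using P by (simp add: \<kappa>_def)
    finally show ?thesis .
  qed
  have int: "(\<integral>\<^sup>+ x. ennreal (\<bar>v x\<bar> powr q) \<partial>lebesgue_on {a<..<b}) = ennreal (LINT x|lebesgue_on {a<..<b}. \<bar>v x\<bar> powr q)"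
    if "in_Lq q {a<..<b} v" for v :: "real \<Rightarrow> real"
    using that by (intro nn_integral_eq_integral) (auto simp: in_Lq_def)
  have "\<forall>\<^sub>F n in sequentially. (LINT x|lebesgue_on {a<..<b}. \<bar>v n x\<bar> powr q) < \<kappa>"
    if "(\<lambda>n. Lq_norm q {a<..<b} (v n)) \<longlonglongrightarrow> 0" "\<And>n. in_Lq q {a<..<b} (v n)" for v :: "nat \<Rightarrow> real \<Rightarrow> real"
    using that(1) \<kappa> unfolding Lq_norm_tendsto_0_iff[OF q] ennreal_tendsto_0_iff int[OF that(2)]
    by (auto simp: ennreal_less_iff)
  from this[OF u0 u(2)] this[OF w0 w(1)] show ?thesis
  proof eventually_elim
    case (elim n)
    show ?case
    proof
      fix x assume x: "x \<in> {a<..<b}"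
      have "l * \<bar>u n x\<bar> \<le> \<epsilon> * l * (1 + l) + K *
        ((LINT y|lebesgue_on {a<..<b}. \<bar>u n y\<bar> powr q) + l * (LINT y|lebesgue_on {a<..<b}. \<bar>w n y\<bar> powr q))"
        unfolding l_def K_def by (rule W1_sup_bound[OF assms(1,2) \<epsilon>(1) u w x])
      also have "\<dots> \<le> \<epsilon> * l * (1 + l) + K * (\<kappa> + l * \<kappa>)"
        using elim K l by (intro add_left_mono mult_left_mono add_mono) auto
      also have "\<dots> = l * c" by (simp add: \<epsilon>(2) P\<kappa>)
      finally show "\<bar>u n x\<bar> \<le> c" using l by simp
    qed
  qed
qed

section \<open>Equivalence of the two kinds of convergence\<close>

lemma is_paramD:
  assumes "is_param d q I f F"
  shows "x \<in> I \<Longrightarrow> f x = unord d (\<lambda>i. F i x)" "i < d \<Longrightarrow> continuous_on I (F i)" "i < d \<Longrightarrow> F i \<in> W1 q I"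
  using assms by (auto simp: is_param_def)

lemma emb_difference_W1:
  assumes "d \<ge> 1" "1 \<le> q" "separating d h \<theta> \<alpha>" "f \<in> W1_A d h \<theta> q {a<..<b}" "g \<in> W1_A d h \<theta> q {a<..<b}" "k < d * h"
  defines "e \<equiv> \<lambda>x. almgren_emb d h \<theta> (f x) k - almgren_emb d h \<theta> (g x) k"
  shows "continuous_on {a<..<b} e" "in_Lq q {a<..<b} e" "in_Lq q {a<..<b} (weak_deriv q {a<..<b} e)"
    "is_weak_deriv {a<..<b} e (weak_deriv q {a<..<b} e)"
proof -
  have q0: "0 \<le> q" using assms(2) by simp
  note f = W1_A_coordinate[OF assms(1,3,4,6)] and g = W1_A_coordinate[OF assms(1,3,5,6)]
  show "continuous_on {a<..<b} e" unfolding e_def by (intro continuous_on_diff f(1) g(1))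
  have eL: "in_Lq q {a<..<b} e" unfolding e_def by (rule in_Lq_diff[OF q0 f(2) g(2)])
  have "e \<in> W1 q {a<..<b}"
    unfolding W1_def using eL in_Lq_diff[OF q0 f(3) g(3)]
      is_weak_deriv_diff[OF in_Lq_integrable[OF assms(2) f(2)] in_Lq_integrable[OF assms(2) f(3)]
        in_Lq_integrable[OF assms(2) g(2)] in_Lq_integrable[OF assms(2) g(3)] f(4) g(4)]
    unfolding e_def by blast
  from W1_weak_deriv[OF this] show "in_Lq q {a<..<b} e" "in_Lq q {a<..<b} (weak_deriv q {a<..<b} e)"
    "is_weak_deriv {a<..<b} e (weak_deriv q {a<..<b} e)" .
qed

lemma emb_difference_le_s0:
  assumes "d \<ge> 1" "separating d h \<theta> \<alpha>" "size m = d" "size m' = d" "k < d * h"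
  shows "\<bar>almgren_emb d h \<theta> m k - almgren_emb d h \<theta> m' k\<bar> \<le> sqrt d * dist_A d m m'"
proof -
  note k = index_split[OF assms(5)]
  have h: "sqrt h \<ge> 1" using k(1) by simp
  have th: "cmod (\<theta> (k div d)) = 1" using assms(2) k by (simp add: separating_def)
  let ?D = "\<bar>almgren_map (\<theta> (k div d)) m ! (k mod d) - almgren_map (\<theta> (k div d)) m' ! (k mod d)\<bar>"
  have "\<bar>almgren_emb d h \<theta> m k - almgren_emb d h \<theta> m' k\<bar> = ?D / sqrt h"
    unfolding almgren_emb_def by (simp add: diff_divide_distrib[symmetric] abs_divide)
  also have "\<dots> \<le> ?D / 1" using h by (intro divide_left_mono) auto
  also have "\<dots> \<le> sqrt d * dist_A d m m'" using almgren_map_dist_Lipschitz[OF assms(1) th assms(3,4) k(2)] by simp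
  finally show ?thesis .
qed

lemma dist_A_le_emb_difference:
  assumes "d \<ge> 1" "separating d h \<theta> \<alpha>" "size m = d" "size m' = d"
    and le: "\<And>k. k < d * h \<Longrightarrow> \<bar>almgren_emb d h \<theta> m k - almgren_emb d h \<theta> m' k\<bar> \<le> c"
  shows "dist_A d m m' \<le> sqrt h * c / \<alpha>"
proof -
  obtain z w where z: "unord d z = m" "unord d w = m'" using unord_surj assms(3,4) by metis
  have le': "\<bar>almgren_map (\<theta> l) (unord d z) ! k - almgren_map (\<theta> l) (unord d w) ! k\<bar> \<le> sqrt h * c" if "l < h" "k < d" for l k
  proof -
    note ix = almgren_emb_index[OF that(2,1)]
    have h: "sqrt h > 0" using that by simp
    have "\<bar>almgren_map (\<theta> l) m ! k - almgren_map (\<theta> l) m' ! k\<bar> / sqrt h \<le> c"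
      using le[OF ix(2)] unfolding ix(1) by (simp add: diff_divide_distrib[symmetric] abs_divide)
    then show ?thesis using h by (simp add: z pos_divide_le_eq mult.commute)
  qed
  obtain \<tau> where \<tau>: "\<tau> permutes {..<d}" "\<And>i. i < d \<Longrightarrow> cmod (z i - w (\<tau> i)) \<le> sqrt h * c / \<alpha>"
    using separating_matching[OF assms(2) le'] by blast
  have "dist_A d (unord d z) (unord d w) \<le> perm_dist d z w \<tau>" by (rule dist_A_le[OF \<tau>(1)])
  also have "\<dots> \<le> sqrt h * c / \<alpha>" by (rule perm_dist_le[OF assms(1)]) (rule \<tau>(2))
  finally show ?thesis by (simp add: z)
qed

lemma s0_measurable:
  assumes F: "is_param d q {a<..<b} f F" and G: "is_param d q {a<..<b} g G"
  shows "s0 d f g \<in> borel_measurable (lebesgue_on {a<..<b})"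
proof -
  let ?M = "lebesgue_on {a<..<b}"
  have [measurable]: "F i \<in> borel_measurable ?M" "G i \<in> borel_measurable ?M" if "i < d" for i
    using is_paramD(2)[OF F that] is_paramD(2)[OF G that] by (auto intro: continuous_imp_measurable_on_sets_lebesgue)
  have "(\<lambda>x. perm_dist d (\<lambda>i. F i x) (\<lambda>i. G i x) \<sigma>) \<in> borel_measurable ?M" if \<sigma>: "\<sigma> permutes {..<d}" for \<sigma>
  proof -
    have "\<sigma> i < d" if "i < d" for i using permutes_in_image[OF \<sigma>, of i] that by simp
    then show ?thesis unfolding perm_dist_def L2_set_def by measurable
  qed
  then have "(\<lambda>x. Min ((\<lambda>\<sigma>. perm_dist d (\<lambda>i. F i x) (\<lambda>i. G i x) \<sigma>) ` {\<sigma>. \<sigma> permutes {..<d}})) \<in> borel_measurable ?M"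
    by (intro borel_measurable_Min) auto
  then show ?thesis
    by (rule measurable_cong[THEN iffD1, rotated])
       (simp add: s0_def is_paramD(1)[OF F] is_paramD(1)[OF G] dist_A_unord)
qed

lemma gap_measurable:
  assumes F: "is_param d q {a<..<b} f F"
  shows "(\<lambda>x. gap d h \<theta> (\<lambda>i. F i x)) \<in> borel_measurable (lebesgue_on {a<..<b})"
proof -
  let ?M = "lebesgue_on {a<..<b}"
  have [measurable]: "F i \<in> borel_measurable ?M" if "i < d" for i
    using is_paramD(2)[OF F that] by (auto intro: continuous_imp_measurable_on_sets_lebesgue)
  have "(\<lambda>x. Min ((\<lambda>p. (case p of (l, i, j) \<Rightarrow> if Re (\<theta> l * F i x) = Re (\<theta> l * F j x) then 1
      else \<bar>Re (\<theta> l * F i x) - Re (\<theta> l * F j x)\<bar>)) ` ({..<h} \<times> {..<d} \<times> {..<d}))) \<in> borel_measurable ?M"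
  proof (rule borel_measurable_Min)
    fix p assume "p \<in> {..<h} \<times> {..<d} \<times> {..<d}"
    then obtain l i j where p: "p = (l, i, j)" "i < d" "j < d" by auto
    have m: "(\<lambda>x. Re (\<theta> l * F i x)) \<in> borel_measurable ?M" "(\<lambda>x. Re (\<theta> l * F j x)) \<in> borel_measurable ?M"
      using p(2,3) by measurable
    show "(\<lambda>x. case p of (l, i, j) \<Rightarrow> if Re (\<theta> l * F i x) = Re (\<theta> l * F j x) then 1
      else \<bar>Re (\<theta> l * F i x) - Re (\<theta> l * F j x)\<bar>) \<in> borel_measurable ?M"
      unfolding p prod.case
      by (intro measurable_If borel_measurable_abs borel_measurable_diff borel_measurable_const borel_measurable_eq m)
  qed simp
  then show ?thesis unfolding gap_def .
qed

text \<open>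
  The pointwise comparison holds at almost every point, with an error term \<open>R\<close> that
  vanishes where the curves are close and is elsewhere the speed of \<open>f\<close>. This speed
  does not depend on \<open>g\<close>, which makes dominated convergence applicable to a sequence of curves \<open>g\<close>.
\<close>

theorem AE_derivative_comparison:
  assumes "d \<ge> 1" "a < b" "1 \<le> q" and sep: "separating d h \<theta> \<alpha>"
    and f: "f \<in> W1_A d h \<theta> q {a<..<b}" and g: "g \<in> W1_A d h \<theta> q {a<..<b}"
    and F: "is_param d q {a<..<b} f F" and G: "is_param d q {a<..<b} g G"
  defines "E \<equiv> \<lambda>x. L2_set (\<lambda>k. weak_deriv q {a<..<b} (\<lambda>y. almgren_emb d h \<theta> (f y) k - almgren_emb d h \<theta> (g y) k) x) {..<d * h}"
    and "R \<equiv> \<lambda>x. if 2 * (sqrt d * s0 d f g x) < gap d h \<theta> (\<lambda>i. F i x) then 0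
                 else L2_set (\<lambda>i. cmod (weak_deriv q {a<..<b} (F i) x)) {..<d}"
  shows "AE x in lebesgue_on {a<..<b}. \<bar>E x\<bar> \<le> (2 + sqrt d) * (\<bar>s1 d F G x\<bar> + \<bar>R x\<bar>)"
    "AE x in lebesgue_on {a<..<b}. \<bar>s1 d F G x\<bar> \<le> (1 + sqrt h / \<alpha>) * (\<bar>E x\<bar> + \<bar>R x\<bar>)"
proof -
  let ?I = "{a<..<b}" and ?M = "lebesgue_on {a<..<b}"
  define W where "W k = weak_deriv q ?I (\<lambda>y. almgren_emb d h \<theta> (f y) k - almgren_emb d h \<theta> (g y) k)" for k
  have \<alpha>: "\<alpha> > 0" using sep by (simp add: separating_def)
  have dW: "AE x in ?M. ((\<lambda>y. almgren_emb d h \<theta> (f y) k - almgren_emb d h \<theta> (g y) k) has_field_derivative W k x) (at x)"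
    if "k < d * h" for k
    unfolding W_def
    using emb_difference_W1[OF assms(1,3) sep f g that] in_Lq_integrable[OF assms(3)] assms(2)
    by (intro weak_deriv_AE_derivative) auto
  have "AE x in ?M. \<forall>k\<in>{..<d * h}. ((\<lambda>y. almgren_emb d h \<theta> (f y) k - almgren_emb d h \<theta> (g y) k) has_field_derivative W k x) (at x)"
    using dW by (intro AE_finite_allI) auto
  then have both: "AE x in ?M. \<bar>E x\<bar> \<le> (2 + sqrt d) * (\<bar>s1 d F G x\<bar> + \<bar>R x\<bar>) \<and> \<bar>s1 d F G x\<bar> \<le> (1 + sqrt h / \<alpha>) * (\<bar>E x\<bar> + \<bar>R x\<bar>)"
    using is_param_AE_regular[OF assms(2,3) F, of h \<theta>] is_param_AE_regular[OF assms(2,3) G, of h \<theta>] AE_space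
  proof eventually_elim
    case (elim x)
    then have x: "x \<in> ?I" by simp
    let ?L = "\<lambda>i. weak_deriv q ?I (F i) x" and ?M = "\<lambda>i. weak_deriv q ?I (G i) x"
    have w: "((\<lambda>y. almgren_emb d h \<theta> (unord d (\<lambda>i. F i y)) k - almgren_emb d h \<theta> (unord d (\<lambda>i. G i y)) k)
              has_field_derivative W k x) (at x)" if "k < d * h" for k
    proof (rule has_field_derivative_transform_within_open)
      show "((\<lambda>y. almgren_emb d h \<theta> (f y) k - almgren_emb d h \<theta> (g y) k) has_field_derivative W k x) (at x)"
        using elim(1) that by blast
      show "x \<in> ?I" by (rule x)
      show "almgren_emb d h \<theta> (f y) k - almgren_emb d h \<theta> (g y) k =
        almgren_emb d h \<theta> (unord d (\<lambda>i. F i y)) k - almgren_emb d h \<theta> (unord d (\<lambda>i. G i y)) k" if "y \<in> ?I" for y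
        by (simp only: is_paramD(1)[OF F that] is_paramD(1)[OF G that])
    qed simp
    define s where "s = s1 d F G x"
    define N where "N = L2_set (\<lambda>i. cmod (?L i)) {..<d}"
    define \<kappa> where "\<kappa> = sqrt h / \<alpha>"
    have \<kappa>: "\<kappa> \<ge> 0" using \<alpha> by (simp add: \<kappa>_def)
    have E: "E x = L2_set (\<lambda>k. W k x) {..<d * h}" by (simp add: E_def W_def)
    have pos: "E x \<ge> 0" "N \<ge> 0" by (simp_all add: E N_def L2_set_nonneg)
    have s0: "s \<ge> 0"
    proof -
      obtain \<tau> where "s1 d F G x = perm_dist d ?L ?M \<tau>" by (rule s1_regular[OF sep assms(1) elim(2,3)])
      then show ?thesis by (simp add: s_def perm_dist_nonneg)
    qed
    have d: "sqrt d \<ge> 1" using assms(1) by simp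
    note cmp = derivative_comparison[OF sep assms(1) elim(2,3) w, folded E s_def N_def \<kappa>_def, simplified]
    have near: "E x \<le> sqrt d * s \<and> sqrt d * s \<le> \<kappa> * E x" if "2 * (sqrt d * s0 d f g x) < gap d h \<theta> (\<lambda>i. F i x)"
      using cmp(1) that by (simp add: s0_def is_paramD(1)[OF F x] is_paramD(1)[OF G x])
    have far: "E x \<le> 2 * N + sqrt d * s" "sqrt d * s \<le> N + \<kappa> * (N + E x)" using cmp(2,3) by blast+
    have ds: "s \<le> sqrt d * s" using d s0 mult_right_mono[of 1 "sqrt d" s] by simp
    show ?case
    proof (cases "2 * (sqrt d * s0 d f g x) < gap d h \<theta> (\<lambda>i. F i x)")
      case True
      then have R: "R x = 0" by (simp add: R_def)
      have "E x \<le> (2 + sqrt d) * s" using near[OF True] s0 by (simp add: distrib_right)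
      moreover have "s \<le> (1 + \<kappa>) * E x" using near[OF True] ds pos by (simp add: distrib_right)
      ultimately show ?thesis using pos s0 by (simp add: R s_def[symmetric] \<kappa>_def[symmetric])
    next
      case False
      then have R: "R x = N" by (simp add: R_def N_def)
      have "E x \<le> (2 + sqrt d) * (s + N)"
      proof -
        have "(2 + sqrt d) * (s + N) = 2 * N + sqrt d * s + (2 * s + sqrt d * N)" by (simp add: algebra_simps)
        moreover have "2 * s + sqrt d * N \<ge> 0" using s0 pos by simp
        ultimately show ?thesis using far(1) by linarith
      qed
      moreover have "s \<le> (1 + \<kappa>) * (E x + N)"
      proof -
        have "(1 + \<kappa>) * (E x + N) = N + \<kappa> * (N + E x) + E x" by (simp add: algebra_simps)
        then show ?thesis using far(2) ds pos by linarith
      qed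
      ultimately show ?thesis using pos s0 by (simp add: R s_def[symmetric] \<kappa>_def[symmetric])
    qed
  qed
  show "AE x in ?M. \<bar>E x\<bar> \<le> (2 + sqrt d) * (\<bar>s1 d F G x\<bar> + \<bar>R x\<bar>)" using both by eventually_elim blast
  show "AE x in ?M. \<bar>s1 d F G x\<bar> \<le> (1 + sqrt h / \<alpha>) * (\<bar>E x\<bar> + \<bar>R x\<bar>)" using both by eventually_elim blast
qed

lemma param_speed_in_Lq:
  assumes "1 \<le> q" and F: "is_param d q {a<..<b} f F"
  shows "in_Lq q {a<..<b} (\<lambda>x. L2_set (\<lambda>i. cmod (weak_deriv q {a<..<b} (F i) x)) {..<d})"
proof -
  have q0: "0 \<le> q" using assms(1) by simp
  have L: "in_Lq q {a<..<b} (\<lambda>x. cmod (weak_deriv q {a<..<b} (F i) x))" if "i < d" for i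
    using in_Lq_norm[OF q0 W1_weak_deriv(2)[OF is_paramD(3)[OF F that]]] .
  show ?thesis
  proof (rule in_Lq_dominated[OF q0, of _ "\<lambda>x. \<Sum>i<d. cmod (weak_deriv q {a<..<b} (F i) x)" _ 1])
    show "in_Lq q {a<..<b} (\<lambda>x. \<Sum>i<d. cmod (weak_deriv q {a<..<b} (F i) x))"
      using L by (intro in_Lq_sum[OF q0]) auto
    show "(\<lambda>x. L2_set (\<lambda>i. cmod (weak_deriv q {a<..<b} (F i) x)) {..<d}) \<in> borel_measurable (lebesgue_on {a<..<b})"
    proof -
      have [measurable]: "(\<lambda>x. cmod (weak_deriv q {a<..<b} (F i) x)) \<in> borel_measurable (lebesgue_on {a<..<b})"
        if "i < d" for i by (rule in_Lq_measurable[OF L[OF that]])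
      show ?thesis unfolding L2_set_def by measurable
    qed
    show "AE x in lebesgue_on {a<..<b}. norm (L2_set (\<lambda>i. cmod (weak_deriv q {a<..<b} (F i) x)) {..<d})
        \<le> 1 * norm (\<Sum>i<d. cmod (weak_deriv q {a<..<b} (F i) x))"
      by (intro AE_I2) (auto simp: L2_set_nonneg sum_nonneg intro!: L2_set_le_sum)
  qed
qed

text \<open>
  It suffices to treat the countably many bounds \<open>1 / Suc m\<close>, each with countably many \<open>n\<close>.
\<close>

lemma AE_eventually_of_uniform:
  fixes s :: "nat \<Rightarrow> 'a \<Rightarrow> real"
  assumes "\<And>c. c > 0 \<Longrightarrow> \<forall>\<^sub>F n in sequentially. AE x in M. s n x \<le> c"
  shows "AE x in M. \<forall>c>0. \<forall>\<^sub>F n in sequentially. s n x \<le> c"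
proof -
  have "AE x in M. \<forall>\<^sub>F n in sequentially. s n x \<le> 1 / real (Suc m)" for m
  proof -
    obtain n0 where "\<And>n. n \<ge> n0 \<Longrightarrow> AE x in M. s n x \<le> 1 / real (Suc m)"
      using assms[of "1 / real (Suc m)"] unfolding eventually_sequentially by auto
    then have "AE x in M. \<forall>n\<in>{n0..}. s n x \<le> 1 / real (Suc m)"
      by (subst AE_ball_countable) auto
    then show ?thesis by eventually_elim (auto simp: eventually_sequentially)
  qed
  then have "AE x in M. \<forall>m. \<forall>\<^sub>F n in sequentially. s n x \<le> 1 / real (Suc m)"
    by (subst AE_all_countable) auto
  then show ?thesis
  proof eventually_elim
    case (elim x)
    show ?case
    proof (intro allI impI)
      fix c :: real assume "c > 0"
      then obtain m where "1 / real (Suc m) < c" using nat_approx_posE by (metis)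
      then show "\<forall>\<^sub>F n in sequentially. s n x \<le> c"
        using spec[OF elim, of m] by (auto elim!: eventually_mono)
    qed
  qed
qed

lemma esssup_tendsto_0_iff:
  fixes s :: "nat \<Rightarrow> 'a \<Rightarrow> real"
  assumes "\<And>n. s n \<in> borel_measurable M"
  shows "(\<lambda>n. esssup M (\<lambda>x. ennreal (s n x))) \<longlonglongrightarrow> 0 \<longleftrightarrow> (\<forall>c>0. \<forall>\<^sub>F n in sequentially. AE x in M. s n x \<le> c)"
  unfolding ennreal_tendsto_0_iff
proof (intro iffI allI impI)
  fix c :: real assume *: "\<forall>c>0. \<forall>\<^sub>F n in sequentially. esssup M (\<lambda>x. ennreal (s n x)) < ennreal c" and "c > 0"
  then have "\<forall>\<^sub>F n in sequentially. esssup M (\<lambda>x. ennreal (s n x)) < ennreal c" by blast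
  then show "\<forall>\<^sub>F n in sequentially. AE x in M. s n x \<le> c"
  proof eventually_elim
    case (elim n)
    show ?case using esssup_AE[of "\<lambda>x. ennreal (s n x)" M]
    proof eventually_elim
      case (elim x)
      then have "ennreal (s n x) \<le> ennreal c" using \<open>esssup M (\<lambda>x. ennreal (s n x)) < ennreal c\<close> by simp
      then show ?case using \<open>c > 0\<close> by (auto simp: ennreal_le_iff)
    qed
  qed
next
  fix c :: real assume *: "\<forall>c>0. \<forall>\<^sub>F n in sequentially. AE x in M. s n x \<le> c" and "c > 0"
  then have "\<forall>\<^sub>F n in sequentially. AE x in M. s n x \<le> c / 2" by (meson half_gt_zero)
  then show "\<forall>\<^sub>F n in sequentially. esssup M (\<lambda>x. ennreal (s n x)) < ennreal c"
  proof eventually_elim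
    case (elim n)
    have "esssup M (\<lambda>x. ennreal (s n x)) \<le> ennreal (c / 2)"
    proof (rule esssup_I)
      show "(\<lambda>x. ennreal (s n x)) \<in> borel_measurable M" using assms by measurable
      show "AE x in M. ennreal (s n x) \<le> ennreal (c / 2)" using elim by eventually_elim (rule ennreal_leI)
    qed
    also have "\<dots> < ennreal c" using \<open>c > 0\<close> by (intro ennreal_lessI) auto
    finally show ?case .
  qed
qed

lemma ennreal_add_tendsto_0_iff:
  fixes X Y :: "nat \<Rightarrow> ennreal"
  shows "(\<lambda>n. X n + Y n) \<longlonglongrightarrow> 0 \<longleftrightarrow> X \<longlonglongrightarrow> 0 \<and> Y \<longlonglongrightarrow> 0"
proof (intro iffI conjI)
  assume *: "(\<lambda>n. X n + Y n) \<longlonglongrightarrow> 0"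
  show "X \<longlonglongrightarrow> 0" by (rule tendsto_sandwich[OF _ _ tendsto_const *]) auto
  show "Y \<longlonglongrightarrow> 0" by (rule tendsto_sandwich[OF _ _ tendsto_const *]) auto
next
  assume "X \<longlonglongrightarrow> 0 \<and> Y \<longlonglongrightarrow> 0"
  then show "(\<lambda>n. X n + Y n) \<longlonglongrightarrow> 0" using tendsto_add[of X 0 sequentially Y 0] by simp
qed

text \<open>
  Both kinds of convergence imply that the distances tend to 0 uniformly: the first contains this
  explicitly, and for the second it follows from \<open>W1_tendsto_0_uniformly\<close> and the lower Lipschitz bound.
  Then the error terms \<open>R n\<close> tend to 0 in \<open>L\<^sup>q\<close>, and \<open>AE_derivative_comparison\<close>
  bounds \<open>S n\<close> and \<open>E n\<close> by each other up to \<open>R n\<close>.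
\<close>

theorem convergence_equivalence:
  fixes fn :: "nat \<Rightarrow> real \<Rightarrow> complex multiset"
  assumes "d \<ge> 1" "a < b" "1 \<le> q" and sep: "separating d h \<theta> \<alpha>"
    and f: "f \<in> W1_A d h \<theta> q {a<..<b}" and fn: "\<And>n. fn n \<in> W1_A d h \<theta> q {a<..<b}"
  shows "(\<lambda>n. dist_W1_A d q {a<..<b} f (fn n)) \<longlonglongrightarrow> 0 \<longleftrightarrow>
         (\<lambda>n. W1_vec_norm (d * h) q {a<..<b}
                (\<lambda>x k. almgren_emb d h \<theta> (f x) k - almgren_emb d h \<theta> (fn n x) k)) \<longlonglongrightarrow> 0"
proof -
  let ?I = "{a<..<b}" and ?M = "lebesgue_on {a<..<b}"
  define e where "e k n x = almgren_emb d h \<theta> (f x) k - almgren_emb d h \<theta> (fn n x) k" for k n x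
  define W where "W k n = weak_deriv q ?I (e k n)" for k n
  define E where "E n x = L2_set (\<lambda>k. W k n x) {..<d * h}" for n x
  define U where "U n x = L2_set (\<lambda>k. e k n x) {..<d * h}" for n x
  define F where "F = param d q ?I f"
  define G where "G n = param d q ?I (fn n)" for n
  define S where "S n = s1 d F (G n)" for n
  define near where "near n x \<longleftrightarrow> 2 * (sqrt d * s0 d f (fn n) x) < gap d h \<theta> (\<lambda>i. F i x)" for n x
  define N where "N x = L2_set (\<lambda>i. cmod (weak_deriv q ?I (F i) x)) {..<d}" for x
  define R where "R n x = (if near n x then 0 else N x)" for n x
  have q: "q > 0" using assms(3) by simp
  have \<alpha>: "\<alpha> > 0" using sep by (simp add: separating_def)
  have h: "h > 0" using separating_ex_form[OF sep assms(1), of 0] by (metis not_less_zero gr0I)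
  have F: "is_param d q ?I f F" unfolding F_def by (rule param_exists[OF assms(1-3) sep f])
  have G: "is_param d q ?I (fn n) (G n)" for n unfolding G_def by (rule param_exists[OF assms(1-3) sep fn])
  have size: "size (f x) = d" "size (fn n x) = d" if "x \<in> ?I" for x n
    using f fn[of n] that by (auto simp: W1_A_def)
  note ev = emb_difference_W1[OF assms(1,3) sep f fn, folded e_def W_def]
  have s0m: "s0 d f (fn n) \<in> borel_measurable ?M" for n by (rule s0_measurable[OF F G])
  have s0_nonneg: "s0 d f (fn n) x \<ge> 0" if "x \<in> ?I" for n x
    using that by (simp add: s0_def is_paramD(1)[OF F] is_paramD(1)[OF G] dist_A_nonneg)
  have nearm: "{x \<in> space ?M. near n x} \<in> sets ?M" for n
    unfolding near_def using s0m[of n] gap_measurable[OF F, of h \<theta>] by measurable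
  have NL: "in_Lq q ?I N" unfolding N_def by (rule param_speed_in_Lq[OF assms(3) F])
  have [measurable]: "N \<in> borel_measurable ?M" by (rule in_Lq_measurable[OF NL])
  have Rm: "R n \<in> borel_measurable ?M" for n unfolding R_def using nearm[of n] by measurable
  have cmp: "AE x in ?M. \<bar>E n x\<bar> \<le> (2 + sqrt d) * (\<bar>S n x\<bar> + \<bar>R n x\<bar>)"
    "AE x in ?M. \<bar>S n x\<bar> \<le> (1 + sqrt h / \<alpha>) * (\<bar>E n x\<bar> + \<bar>R n x\<bar>)" for n
    unfolding E_def W_def e_def[abs_def] S_def R_def near_def N_def
    by (rule AE_derivative_comparison[OF assms(1-3) sep f fn[of n] F G[of n]])+
  define unif where "unif \<longleftrightarrow> (\<forall>c>0. \<forall>\<^sub>F n in sequentially. AE x in ?M. s0 d f (fn n) x \<le> c)"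
  have R0: "(\<lambda>n. Lq_norm q ?I (R n)) \<longlonglongrightarrow> 0" if unif
    unfolding R_def
  proof (rule Lq_norm_tendsto_0_eventually_zero[OF assms(3) NL nearm])
    have "AE x in ?M. \<forall>c>0. \<forall>\<^sub>F n in sequentially. s0 d f (fn n) x \<le> c"
      using that by (intro AE_eventually_of_uniform) (simp add: unif_def)
    then show "AE x in ?M. \<forall>\<^sub>F n in sequentially. near n x"
    proof eventually_elim
      case (elim x)
      define \<gamma> where "\<gamma> = gap d h \<theta> (\<lambda>i. F i x)"
      have \<gamma>: "\<gamma> > 0" unfolding \<gamma>_def by (rule gap_pos[OF assms(1) h])
      have sd: "sqrt d > 0" using assms(1) by simp
      have "\<forall>\<^sub>F n in sequentially. s0 d f (fn n) x \<le> \<gamma> / (4 * sqrt d)" using elim \<gamma> sd by simp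
      then show ?case
      proof eventually_elim
        case (elim n)
        then have "sqrt d * s0 d f (fn n) x \<le> \<gamma> / 4" using sd by (simp add: field_simps)
        then show ?case using \<gamma> by (simp add: near_def \<gamma>_def[symmetric])
      qed
    qed
  qed
  have dist_iff: "(\<lambda>n. dist_W1_A d q ?I f (fn n)) \<longlonglongrightarrow> 0 \<longleftrightarrow> unif \<and> (\<lambda>n. Lq_norm q ?I (S n)) \<longlonglongrightarrow> 0"
    unfolding dist_W1_A_def ennreal_add_tendsto_0_iff esssup_tendsto_0_iff[OF s0m] unif_def S_def F_def G_def ..
  have norm_iff: "(\<lambda>n. W1_vec_norm (d * h) q ?I (\<lambda>x k. almgren_emb d h \<theta> (f x) k - almgren_emb d h \<theta> (fn n x) k)) \<longlonglongrightarrow> 0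
      \<longleftrightarrow> (\<lambda>n. Lq_norm q ?I (U n)) \<longlonglongrightarrow> 0 \<and> (\<lambda>n. Lq_norm q ?I (E n)) \<longlonglongrightarrow> 0"
    unfolding W1_vec_norm_def ennreal_add_tendsto_0_iff by (simp add: U_def[abs_def] E_def[abs_def] W_def e_def[abs_def])
  have U0: "(\<lambda>n. Lq_norm q ?I (U n)) \<longlonglongrightarrow> 0" if unif
  proof (rule Lq_norm_tendsto_0_uniform[OF assms(3) _ assms(2)])
    fix c :: real assume "c > 0"
    define K where "K = real (d * h) * sqrt d"
    have K: "K > 0" using assms(1) h by (simp add: K_def)
    have "\<forall>\<^sub>F n in sequentially. AE x in ?M. s0 d f (fn n) x \<le> c / K"
      using that \<open>c > 0\<close> K by (simp add: unif_def)
    then show "\<forall>\<^sub>F n in sequentially. AE x in ?M. \<bar>U n x\<bar> \<le> c"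
    proof eventually_elim
      case (elim n)
      show ?case using elim AE_space
      proof eventually_elim
        case (elim x)
        then have x: "x \<in> ?I" by simp
        have "\<bar>U n x\<bar> = U n x" by (simp add: U_def L2_set_nonneg)
        also have "U n x \<le> (\<Sum>k<d * h. \<bar>e k n x\<bar>)" unfolding U_def by (rule L2_set_le_sum_abs)
        also have "\<dots> \<le> (\<Sum>k<d * h. sqrt d * s0 d f (fn n) x)"
          unfolding e_def s0_def using emb_difference_le_s0[OF assms(1) sep size[OF x]] by (intro sum_mono) auto
        also have "\<dots> = K * s0 d f (fn n) x" by (simp add: K_def)
        also have "\<dots> \<le> c" using elim(1) K by (simp add: pos_le_divide_eq mult.commute)
        finally show ?case .
      qed
    qed
  qed
  have unif: unif if U: "(\<lambda>n. Lq_norm q ?I (U n)) \<longlonglongrightarrow> 0" and E: "(\<lambda>n. Lq_norm q ?I (E n)) \<longlonglongrightarrow> 0"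
    unfolding unif_def
  proof (intro allI impI)
    fix c :: real assume "c > 0"
    (* The bound c' on the coordinates becomes c after the lower Lipschitz bound. *)
    define c' where "c' = c * \<alpha> / sqrt h"
    have c': "c' > 0" "sqrt h * c' / \<alpha> = c" using \<open>c > 0\<close> \<alpha> h by (simp_all add: c'_def)
    have zero: "(\<lambda>n::nat. Lq_norm q ?I (\<lambda>_. 0)) \<longlonglongrightarrow> 0" by (simp add: Lq_norm_def)
    have comp: "(\<lambda>n. Lq_norm q ?I (v n)) \<longlonglongrightarrow> 0"
      if "(\<lambda>n. Lq_norm q ?I (V n)) \<longlonglongrightarrow> 0" "\<And>n x. \<bar>v n x\<bar> \<le> \<bar>V n x\<bar>" for v V :: "nat \<Rightarrow> real \<Rightarrow> real"
      by (rule Lq_norm_tendsto_0_transfer[OF assms(3) zero_less_one _ _ that(1) zero]) (use that(2) in auto)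
    have coord: "\<bar>v k\<bar> \<le> \<bar>L2_set v {..<d * h}\<bar>" if "k < d * h" for v :: "nat \<Rightarrow> real" and k
      using member_le_L2_set[of "{..<d * h}" k "\<lambda>k. \<bar>v k\<bar>"] that by (simp add: L2_set_def)
    have "\<forall>\<^sub>F n in sequentially. \<forall>k\<in>{..<d * h}. \<forall>x\<in>?I. \<bar>e k n x\<bar> \<le> c'"
    proof (rule eventually_ball_finite, simp, intro ballI)
      fix k assume "k \<in> {..<d * h}"
      then have k: "k < d * h" by simp
      show "\<forall>\<^sub>F n in sequentially. \<forall>x\<in>?I. \<bar>e k n x\<bar> \<le> c'"
      proof (rule W1_tendsto_0_uniformly[OF assms(2,3) _ _ _ _ _ _ c'(1)])
        show "(\<lambda>n. Lq_norm q ?I (e k n)) \<longlonglongrightarrow> 0" 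
          by (rule comp[OF U]) (unfold U_def, use coord[OF k, of "\<lambda>k. e k n x" for n x] in simp)
        show "(\<lambda>n. Lq_norm q ?I (W k n)) \<longlonglongrightarrow> 0" 
          by (rule comp[OF E]) (unfold E_def, use coord[OF k, of "\<lambda>k. W k n x" for n x] in simp)
      qed (use ev[OF k] in \<open>simp_all add: e_def[abs_def] W_def\<close>)
    qed
    then show "\<forall>\<^sub>F n in sequentially. AE x in ?M. s0 d f (fn n) x \<le> c"
    proof eventually_elim
      case (elim n)
      have "s0 d f (fn n) x \<le> c" if x: "x \<in> ?I" for x
        using dist_A_le_emb_difference[OF assms(1) sep size[OF x], of n c'] elim x c'(2) by (simp add: s0_def e_def)
      then show ?case by (intro AE_I2) simp
    qed
  qed
  show ?thesis unfolding dist_iff norm_iff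
  proof
    assume *: "unif \<and> (\<lambda>n. Lq_norm q ?I (S n)) \<longlonglongrightarrow> 0"
    have "(\<lambda>n. Lq_norm q ?I (E n)) \<longlonglongrightarrow> 0"
      by (rule Lq_norm_tendsto_0_transfer[OF assms(3) _ cmp(1) Rm]) (use * R0 in \<open>auto simp: add_pos_nonneg\<close>)
    then show "(\<lambda>n. Lq_norm q ?I (U n)) \<longlonglongrightarrow> 0 \<and> (\<lambda>n. Lq_norm q ?I (E n)) \<longlonglongrightarrow> 0" using U0 * by blast
  next
    assume *: "(\<lambda>n. Lq_norm q ?I (U n)) \<longlonglongrightarrow> 0 \<and> (\<lambda>n. Lq_norm q ?I (E n)) \<longlonglongrightarrow> 0"
    then have u: unif using unif by blast
    have "(\<lambda>n. Lq_norm q ?I (S n)) \<longlonglongrightarrow> 0"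
      by (rule Lq_norm_tendsto_0_transfer[OF assms(3) _ cmp(2) Rm]) (use * R0[OF u] \<alpha> in \<open>auto simp: add_pos_nonneg\<close>)
    then show "unif \<and> (\<lambda>n. Lq_norm q ?I (S n)) \<longlonglongrightarrow> 0" using u by blast
  qed
qed

theorem theorem3p11:
  fixes d h :: nat and \<theta> :: "nat \<Rightarrow> complex" and a b q :: real
    and f :: "real \<Rightarrow> complex multiset" and fn :: "nat \<Rightarrow> real \<Rightarrow> complex multiset"
  assumes "d \<ge> 1" and "a < b" and "1 \<le> q"
    and "almgren_forms d h \<theta>"
    and "f \<in> W1_A d h \<theta> q {a<..<b}"
    and "\<And>n. n \<ge> 1 \<Longrightarrow> fn n \<in> W1_A d h \<theta> q {a<..<b}"
  shows "(\<lambda>n. dist_W1_A d q {a<..<b} f (fn n)) \<longlonglongrightarrow> 0 \<longleftrightarrow>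
         (\<lambda>n. W1_vec_norm (d * h) q {a<..<b}
                (\<lambda>x k. almgren_emb d h \<theta> (f x) k - almgren_emb d h \<theta> (fn n x) k)) \<longlonglongrightarrow> 0"
proof -
  obtain \<alpha> where "separating d h \<theta> \<alpha>" using almgren_forms_separating[OF assms(4)] .
  (* The hypothesis on fn starts at index 1, so the equivalence is applied to the shifted sequence. *)
  from convergence_equivalence[OF assms(1-3) this assms(5), of "\<lambda>n. fn (Suc n)"]
  have "(\<lambda>n. dist_W1_A d q {a<..<b} f (fn (Suc n))) \<longlonglongrightarrow> 0 \<longleftrightarrow>
         (\<lambda>n. W1_vec_norm (d * h) q {a<..<b}
                (\<lambda>x k. almgren_emb d h \<theta> (f x) k - almgren_emb d h \<theta> (fn (Suc n) x) k)) \<longlonglongrightarrow> 0"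
    using assms(6) by simp
  then show ?thesis
    using filterlim_sequentially_Suc[of "\<lambda>n. dist_W1_A d q {a<..<b} f (fn n)" "nhds 0"]
      filterlim_sequentially_Suc[of "\<lambda>n. W1_vec_norm (d * h) q {a<..<b}
                (\<lambda>x k. almgren_emb d h \<theta> (f x) k - almgren_emb d h \<theta> (fn n x) k)" "nhds 0"]
    by blast
qed

end
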